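(* Let $d$ be a positive integer and let $G$ be a group acting properly and cocompactly by cellular automorphisms on a $d$-acyclic combinatorial complex $X$. Then $\mathrm{FV}_X^{d+1}(m)$ is finite for all $m\in\mathbb{N}$.
   Context: All spaces are combinatorial complexes and all maps are combinatorial, in the sense of Bridson–Haefliger (Ch. I, Appendix): a continuous map between complexes is combinatorial if its restriction to each open cell is a homeomorphism onto an open cell of the target, and a combinatorial complex is a cell complex whose attaching maps are combinatorial with respect to combinatorial complex structures on the boundary spheres of the cells. A $G$-action on a complex $X$ is proper if for every compact subcomplex $K$ of $X$ the set $\{g\in G : K\cap g(K)\neq\emptyset\}$ is finite. It is cocompact if there is a compact subcomplex $K$ of $X$ such that $\{gK : g\in G\}$ covers $X$. A complex $X$ is $d$-acyclic if the reduced homology groups $\bar H_i(X,\mathbb{Z})$ are trivial for $0\le i\le d$. The cellular chain group $C_d(X,\mathbb{Z})$ is a free $\mathbb{Z}$-module with basis the collection of $d$-dimensional cells of $X$, each with a chosen orientation; $\|\cdot\|_1$ denotes the $\ell_1$-norm with respect to this basis (the sum of the absolute values of the coefficients). $Z_d(X,\mathbb{Z})$ denotes the $\mathbb{Z}$-module of integral cellular $d$-cycles and $\partial\colon C_{d+1}(X,\mathbb{Z})\to Z_d(X,\mathbb{Z})$ the boundary map. The $(d+1)$-dimensional filling function of $X$ is the function $\mathrm{FV}_X^{d+1}\colon\mathbb{N}\to\mathbb{N}\cup\{\infty\}$ given by $$\mathrm{FV}_X^{d+1}(k)=\sup\{\|\gamma\|_\partial : \gamma\in Z_d(X,\mathbb{Z}),\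 \|\gamma\|_1\le k\},$$ where $$\|\gamma\|_\partial=\inf\{\|\mu\|_1 : \mu\in C_{d+1}(X,\mathbb{Z}),\ \partial(\mu)=\gamma\},$$ and the supremum and infimum of the empty set are defined to be $0$ and $\infty$ respectively. *)

theory Defs
  imports "HOL-Homology.Homology" "HOL-Algebra.Group_Action" "HOL-Library.Extended_Nat"
begin

section \<open>Cell complexes\<close>

text \<open>The closed disc of dimension \<open>n\<close> and its boundary sphere live in \<^const>\<open>Euclidean_space\<close>,
  so that \<open>sphere_set (Suc n) = topspace (nsphere n)\<close> and \<open>sphere_set 0 = {}\<close>.\<close>

definition disc :: "nat \<Rightarrow> (nat \<Rightarrow> real) topology" where
  "disc n = subtopology (Euclidean_space n) {x. (\<Sum>i<n. x i ^ 2) \<le> 1}"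

definition sphere_set :: "nat \<Rightarrow> (nat \<Rightarrow> real) set" where
  "sphere_set n = {x \<in> topspace (disc n). (\<Sum>i<n. x i ^ 2) = 1}"

text \<open>\<open>cells K n\<close> is the set of open \<open>n\<close>-cells, a cell being identified with its underlying
  subset; \<open>charmap K e\<close> is the characteristic map of the cell \<open>e\<close>, of which only the values on the
  closed disc matter. The characteristic map also fixes the chosen orientation of \<open>e\<close>
  (see \<open>cell_class\<close> below); precomposing it with a reflection gives the other orientation.\<close>

record 'a cell_complex =
  carrier_top :: "'a topology"
  cells :: "nat \<Rightarrow> 'a set set"
  charmap :: "'a set \<Rightarrow> (nat \<Rightarrow> real) \<Rightarrow> 'a"

definition skeleton :: "('a, 'b) cell_complex_scheme \<Rightarrow> nat \<Rightarrow> 'a set" where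
  "skeleton K n = (\<Union>m\<le>n. \<Union>(cells K m))"

text \<open>The last clause says that the topology is the quotient topology from the disjoint union of
  all closed discs. Closure finiteness is not listed: for combinatorial complexes it follows from
  the condition on attaching maps and the compactness of spheres.\<close>

definition is_cell_complex :: "('a, 'b) cell_complex_scheme \<Rightarrow> bool" where
  "is_cell_complex K \<longleftrightarrow>
     Hausdorff_space (carrier_top K) \<and>
     topspace (carrier_top K) = (\<Union>n. \<Union>(cells K n)) \<and>
     (\<forall>m n. \<forall>e\<in>cells K m. \<forall>e'\<in>cells K n. e \<inter> e' \<noteq> {} \<longrightarrow> m = n \<and> e = e') \<and>
     (\<forall>n. \<forall>e\<in>cells K n.
        continuous_map (disc n) (carrier_top K) (charmap K e) \<and>
        homeomorphic_map (subtopology (disc n) (- sphere_set n))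
          (subtopology (carrier_top K) e) (charmap K e) \<and>
        charmap K e ` sphere_set n \<subseteq> (\<Union>m<n. \<Union>(cells K m))) \<and>
     (\<forall>A. A \<subseteq> topspace (carrier_top K) \<longrightarrow>
        (closedin (carrier_top K) A \<longleftrightarrow>
         (\<forall>n. \<forall>e\<in>cells K n. closedin (disc n) {x \<in> topspace (disc n). charmap K e x \<in> A})))"

definition combinatorial_map ::
  "('a, 'c) cell_complex_scheme \<Rightarrow> ('b, 'd) cell_complex_scheme \<Rightarrow> ('a \<Rightarrow> 'b) \<Rightarrow> bool" where
  "combinatorial_map K L f \<longleftrightarrow>
     continuous_map (carrier_top K) (carrier_top L) f \<and>
     (\<forall>n. \<forall>e\<in>cells K n. \<exists>m. \<exists>e'\<in>cells L m.
        homeomorphic_map (subtopology (carrier_top K) e) (subtopology (carrier_top L) e') f)"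

definition combinatorial_attaching ::
  "((nat \<Rightarrow> real) cell_complex \<Rightarrow> bool) \<Rightarrow> ('a, 'b) cell_complex_scheme \<Rightarrow> bool" where
  "combinatorial_attaching P K \<longleftrightarrow>
     (\<forall>n. \<forall>e\<in>cells K n. \<exists>S. P S \<and> carrier_top S = subtopology (disc n) (sphere_set n) \<and>
        combinatorial_map S K (charmap K e))"

lemma combinatorial_attaching_mono [mono]:
  "P \<le> Q \<Longrightarrow> combinatorial_attaching P K \<longrightarrow> combinatorial_attaching Q K"
  unfolding combinatorial_attaching_def by (fast dest: predicate1D)

text \<open>Combinatorial complexes are defined by recursion on dimension, and the recursion passes
  through structures on the boundary spheres, whose points have type \<^typ>\<open>nat \<Rightarrow> real\<close>. As an
  inductive predicate cannot change its type, the recursion is carried out at that type and then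
  one more step of the same form is made at an arbitrary type. It is well-founded because the
  boundary sphere of an \<open>n\<close>-cell has dimension \<open>n - 1\<close>.\<close>

inductive combinatorial_complex_real :: "(nat \<Rightarrow> real) cell_complex \<Rightarrow> bool" where
  "is_cell_complex K \<Longrightarrow> combinatorial_attaching combinatorial_complex_real K
     \<Longrightarrow> combinatorial_complex_real K"

definition combinatorial_complex :: "('a, 'b) cell_complex_scheme \<Rightarrow> bool" where
  "combinatorial_complex K \<longleftrightarrow>
     is_cell_complex K \<and> combinatorial_attaching combinatorial_complex_real K"

lemma combinatorial_complex_real_eq: "combinatorial_complex_real K \<longleftrightarrow> combinatorial_complex K"
  unfolding combinatorial_complex_def by (subst combinatorial_complex_real.simps) auto

definition subcomplex :: "('a, 'b) cell_complex_scheme \<Rightarrow> 'a set \<Rightarrow> bool" where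
  "subcomplex K A \<longleftrightarrow>
     closedin (carrier_top K) A \<and> (\<forall>n. \<forall>e\<in>cells K n. e \<inter> A \<noteq> {} \<longrightarrow> e \<subseteq> A)"

definition acyclic_complex :: "nat \<Rightarrow> ('a, 'b) cell_complex_scheme \<Rightarrow> bool" where
  "acyclic_complex d K \<longleftrightarrow>
     (\<forall>i\<le>d. trivial_group (reduced_homology_group (int i) (carrier_top K)))"


section \<open>Group actions\<close>

text \<open>Each \<open>\<phi> g\<close> and its inverse \<open>\<phi> (inv g)\<close> are combinatorial, so \<open>G\<close> acts by automorphisms.\<close>

definition cellular_action ::
  "('g, 'm) monoid_scheme \<Rightarrow> ('a, 'b) cell_complex_scheme \<Rightarrow> ('g \<Rightarrow> 'a \<Rightarrow> 'a) \<Rightarrow> bool" where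
  "cellular_action G K \<phi> \<longleftrightarrow>
     group_action G (topspace (carrier_top K)) \<phi> \<and>
     (\<forall>g\<in>carrier G. combinatorial_map K K (\<phi> g))"

definition proper_action ::
  "('g, 'm) monoid_scheme \<Rightarrow> ('a, 'b) cell_complex_scheme \<Rightarrow> ('g \<Rightarrow> 'a \<Rightarrow> 'a) \<Rightarrow> bool" where
  "proper_action G K \<phi> \<longleftrightarrow>
     (\<forall>A. subcomplex K A \<and> compactin (carrier_top K) A \<longrightarrow>
        finite {g \<in> carrier G. A \<inter> \<phi> g ` A \<noteq> {}})"

definition cocompact_action ::
  "('g, 'm) monoid_scheme \<Rightarrow> ('a, 'b) cell_complex_scheme \<Rightarrow> ('g \<Rightarrow> 'a \<Rightarrow> 'a) \<Rightarrow> bool" where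
  "cocompact_action G K \<phi> \<longleftrightarrow>
     (\<exists>A. subcomplex K A \<and> compactin (carrier_top K) A \<and>
        (\<Union>g\<in>carrier G. \<phi> g ` A) = topspace (carrier_top K))"


section \<open>Cellular chains\<close>

definition disc_class :: "nat \<Rightarrow> (nat \<Rightarrow> real) chain set" where
  "disc_class n =
     (SOME a. a \<in> carrier (relative_homology_group (int n) (disc n) (sphere_set n)) \<and>
        subgroup_generated (relative_homology_group (int n) (disc n) (sphere_set n)) {a}
        = relative_homology_group (int n) (disc n) (sphere_set n))"

text \<open>\<open>H\<^sub>n(X\<^sup>n, X\<^sup>n - e)\<close> is infinite cyclic for an open \<open>n\<close>-cell \<open>e\<close>; the generator \<open>cell_class K n e\<close>
  is the orientation of \<open>e\<close>.\<close>

abbreviation local_homology_group ::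
  "('a, 'b) cell_complex_scheme \<Rightarrow> nat \<Rightarrow> 'a set \<Rightarrow> 'a chain set monoid" where
  "local_homology_group K n e \<equiv>
     relative_homology_group (int n) (subtopology (carrier_top K) (skeleton K n)) (skeleton K n - e)"

definition cell_class :: "('a, 'b) cell_complex_scheme \<Rightarrow> nat \<Rightarrow> 'a set \<Rightarrow> 'a chain set" where
  "cell_class K n e =
     hom_induced (int n) (disc n) (sphere_set n)
       (subtopology (carrier_top K) (skeleton K n)) (skeleton K n - e) (charmap K e) (disc_class n)"

text \<open>The incidence number of an \<open>(n+1)\<close>-cell \<open>e\<close> and an \<open>n\<close>-cell \<open>f\<close>: the degree of the composite of
  the attaching map \<open>S\<^sup>n \<rightarrow> X\<^sup>n\<close> of \<open>e\<close> with the collapse \<open>X\<^sup>n \<rightarrow> X\<^sup>n/(X\<^sup>n - f)\<close>, read off from the image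
  of the fundamental class \<open>\<partial> [D\<^sup>n\<^sup>+\<^sup>1]\<close> of the sphere.\<close>

definition incidence :: "('a, 'b) cell_complex_scheme \<Rightarrow> nat \<Rightarrow> 'a set \<Rightarrow> 'a set \<Rightarrow> int" where
  "incidence K n e f =
     (THE k. hom_induced (int n) (subtopology (disc (Suc n)) (sphere_set (Suc n))) {}
          (subtopology (carrier_top K) (skeleton K n)) (skeleton K n - f) (charmap K e)
          (hom_boundary (int (Suc n)) (disc (Suc n)) (sphere_set (Suc n)) (disc_class (Suc n)))
        = cell_class K n f [^]\<^bsub>local_homology_group K n f\<^esub> (k::int))"

definition chains :: "('a, 'b) cell_complex_scheme \<Rightarrow> nat \<Rightarrow> ('a set \<Rightarrow>\<^sub>0 int) set" where
  "chains K n = carrier (free_Abelian_group (cells K n))"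

text \<open>The index set of the inner sum is finite, since the closure of \<open>e\<close> meets finitely many cells.\<close>

fun boundary ::
  "('a, 'b) cell_complex_scheme \<Rightarrow> nat \<Rightarrow> ('a set \<Rightarrow>\<^sub>0 int) \<Rightarrow> ('a set \<Rightarrow>\<^sub>0 int)" where
  "boundary K 0 c = 0"
| "boundary K (Suc n) c =
     frag_extend
       (\<lambda>e. \<Sum>f | f \<in> cells K n \<and> incidence K n e f \<noteq> 0. frag_cmul (incidence K n e f) (frag_of f)) c"

definition cycles :: "('a, 'b) cell_complex_scheme \<Rightarrow> nat \<Rightarrow> ('a set \<Rightarrow>\<^sub>0 int) set" where
  "cycles K n = {c \<in> chains K n. boundary K n c = 0}"

definition l1_norm :: "('e \<Rightarrow>\<^sub>0 int) \<Rightarrow> nat" where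
  "l1_norm c = (\<Sum>e\<in>Poly_Mapping.keys c. nat \<bar>Poly_Mapping.lookup c e\<bar>)"

text \<open>In \<^typ>\<open>enat\<close> the supremum and infimum of the empty set are \<open>0\<close> and \<open>\<infinity>\<close>. Both notions below
  are indexed by the dimension \<open>n \<ge> 1\<close> of the fillings.\<close>

definition filling_norm :: "('a, 'b) cell_complex_scheme \<Rightarrow> nat \<Rightarrow> ('a set \<Rightarrow>\<^sub>0 int) \<Rightarrow> enat" where
  "filling_norm K n \<gamma> = (INF \<mu> \<in> {\<mu> \<in> chains K n. boundary K n \<mu> = \<gamma>}. enat (l1_norm \<mu>))"

definition FV :: "('a, 'b) cell_complex_scheme \<Rightarrow> nat \<Rightarrow> nat \<Rightarrow> enat" where
  "FV K n k = (SUP \<gamma> \<in> {\<gamma> \<in> cycles K (n - 1). l1_norm \<gamma> \<le> k}. filling_norm K n \<gamma>)"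

end

theory Submission
  imports Defs
begin

text \<open>
  A filling bound cannot come from compactness alone, because a cycle of small norm may be spread
  over the whole complex. The proof breaks such a cycle into connected pieces. Call two \<open>d\<close>-cells
  adjacent if their cellular boundaries share a \<open>(d-1)\<close>-cell. Restricting a \<open>d\<close>-cycle to a component
  of its support (for adjacency inside the support) gives a cycle again, because near each
  \<open>(d-1)\<close>-cell either all terms of the cycle or none of them are kept (\<open>component_cycle\<close>). The support
  of a piece has boundedly many cells, so it lies in an adjacency ball of bounded radius. The action
  has finitely many orbits of cells, and each \<open>(d-1)\<close>-cell is a face of finitely many \<open>d\<close>-cells
  (\<open>finite_incident_cofaces\<close>, which is where properness enters). Hence, up to translation, only
  finitely many connected cycles of norm at most \<open>m\<close> exist. If each of them has some filling, then
  one constant \<open>M\<close> bounds all these fillings, and a cycle of norm at most \<open>m\<close>, having at most \<open>m\<close>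
  pieces, has a filling of norm at most \<open>M * m\<close> (\<open>linear_filling_bound\<close>).

  Two facts of cellular homology support this argument. The first is that every cellular \<open>d\<close>-cycle
  is a cellular boundary when the singular group \<open>H\<^sub>d(X)\<close> vanishes (\<open>cellular_cycle_is_boundary\<close>).
  Singular chains have compact support and compact sets meet finitely many cells, so it suffices to
  treat finite unions of cells, and these are handled by removing one top-dimensional cell at a time.
  The only geometric input is that attaching an \<open>n\<close>-cell along \<open>f\<close> to \<open>A\<close> induces an isomorphism from
  \<open>H\<^sub>k(D\<^sup>n, S\<^sup>n\<^sup>-\<^sup>1)\<close> to \<open>H\<^sub>k(A \<union> e, A)\<close> (\<open>iso_hom_induced_attaches_cell\<close>), proved by excision with a
  collar of the sphere.

  The second fact is that group elements act on cellular chains, commuting with the boundary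
  and preserving the norm (\<open>boundary_push_chain\<close>). A group element carries the characteristic map of
  a cell \<open>e\<close> to another map with image the closure of \<open>g e\<close>, in general different from the chosen
  characteristic map of \<open>g e\<close>. Both give generators of the same infinite cyclic group, so they differ
  by a sign, and these signs enter the incidence numbers multiplicatively (\<open>incidence_image\<close>).
\<close>

section \<open>Infinite cyclic groups and homomorphisms on free Abelian groups\<close>

abbreviation disc_map :: "nat \<Rightarrow> 'a topology \<Rightarrow> 'a set \<Rightarrow> ((nat \<Rightarrow> real) \<Rightarrow> 'a) \<Rightarrow> (nat \<Rightarrow> real) chain set \<Rightarrow> 'a chain set" where
  "disc_map n \<equiv> hom_induced (int n) (disc n) (sphere_set n)"

abbreviation open_disc :: "nat \<Rightarrow> (nat \<Rightarrow> real) set" where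
  "open_disc n \<equiv> topspace (disc n) - sphere_set n"

abbreviation sphere_space :: "nat \<Rightarrow> (nat \<Rightarrow> real) topology" where
  "sphere_space n \<equiv> subtopology (disc (Suc n)) (sphere_set (Suc n))"

abbreviation sphere_class :: "nat \<Rightarrow> (nat \<Rightarrow> real) chain set" where
  "sphere_class n \<equiv> hom_boundary (int (Suc n)) (disc (Suc n)) (sphere_set (Suc n)) (disc_class (Suc n))"

abbreviation supp :: "('c \<Rightarrow>\<^sub>0 int) \<Rightarrow> 'c set" where
  "supp \<equiv> Poly_Mapping.keys"

abbreviation coef :: "('c \<Rightarrow>\<^sub>0 int) \<Rightarrow> 'c \<Rightarrow> int" where
  "coef \<equiv> Poly_Mapping.lookup"

text \<open>An infinite cyclic group with a chosen generator. Uniqueness of the exponent makes incidence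
  numbers well defined.\<close>

definition free_generator :: "('a, 'b) monoid_scheme \<Rightarrow> 'a \<Rightarrow> bool" where
  "free_generator G a \<longleftrightarrow> a \<in> carrier G \<and> (\<forall>z\<in>carrier G. \<exists>!k::int. z = a [^]\<^bsub>G\<^esub> k)"

lemma free_generator_pow_eq_iff:
  assumes "group G" "free_generator G a"
  shows "a [^]\<^bsub>G\<^esub> (k::int) = a [^]\<^bsub>G\<^esub> l \<longleftrightarrow> k = l"
proof -
  interpret group G by fact
  show ?thesis
    using assms unfolding free_generator_def by (metis int_pow_closed)
qed

lemma free_generatorE:
  assumes "free_generator G a" "z \<in> carrier G"
  obtains k :: int where "z = a [^]\<^bsub>G\<^esub> k"
  using assms unfolding free_generator_def by (elim conjE ballE ex1E) auto

lemma free_generator_iso: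
  assumes "group G" "group H" "free_generator G a" "h \<in> iso G H"
  shows "free_generator H (h a)"
proof -
  interpret group_hom G H h
    using assms by (simp add: group_hom_def group_hom_axioms_def iso_def)
  have bij: "inj_on h (carrier G)" "h ` carrier G = carrier H"
    using assms(4) by (auto simp: iso_def bij_betw_def)
  have a: "a \<in> carrier G" using assms(3) by (simp add: free_generator_def)
  have pow: "h a [^]\<^bsub>H\<^esub> k = h (a [^]\<^bsub>G\<^esub> k)" for k::int
    using a hom_int_pow by metis
  show ?thesis unfolding free_generator_def
  proof (intro conjI ballI)
    show "h a \<in> carrier H" using a by simp
    fix z assume "z \<in> carrier H"
    then obtain y where y: "y \<in> carrier G" "z = h y" using bij by blast
    then obtain k::int where k: "y = a [^]\<^bsub>G\<^esub> k"
      using assms(3) unfolding free_generator_def by blast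
    show "\<exists>!k::int. z = h a [^]\<^bsub>H\<^esub> k"
    proof (rule ex1I [of _ k])
      show "z = h a [^]\<^bsub>H\<^esub> k" using y k pow by simp
      fix l :: int assume "z = h a [^]\<^bsub>H\<^esub> l"
      then have "y = a [^]\<^bsub>G\<^esub> l"
        using y pow bij(1) a by (metis G.int_pow_closed inj_onD)
      then show "l = k" using k free_generator_pow_eq_iff assms by metis
    qed
  qed
qed

lemma free_generator_unique_up_to_sign:
  assumes "group G" "free_generator G a" "free_generator G b"
  obtains s :: int where "s = 1 \<or> s = -1" "b = a [^]\<^bsub>G\<^esub> s"
proof -
  interpret group G by fact
  obtain s t :: int where s: "b = a [^]\<^bsub>G\<^esub> s" and t: "a = b [^]\<^bsub>G\<^esub> t"
    using assms(2,3) unfolding free_generator_def by metis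
  have a: "a \<in> carrier G" using assms(2) by (simp add: free_generator_def)
  have "a [^]\<^bsub>G\<^esub> (s * t) = a"
    using int_pow_pow [OF a, of s t] unfolding s [symmetric] t [symmetric] by simp
  then have "a [^]\<^bsub>G\<^esub> (s * t) = a [^]\<^bsub>G\<^esub> (1::int)"
    using a by simp
  then have "s * t = 1" using free_generator_pow_eq_iff assms by metis
  then have "s = 1 \<or> s = -1" by (auto simp: zmult_eq_1_iff)
  then show ?thesis using s that by blast
qed

lemma infinite_cyclic_free_generator:
  assumes "group G" "G \<cong> integer_group" "a \<in> carrier G" "subgroup_generated G {a} = G"
  shows "free_generator G a"
proof -
  interpret group G by fact
  have "free_generator integer_group (1::int)"
    unfolding free_generator_def by auto
  moreover have "integer_group \<cong> G"
    using assms(2) by (simp add: iso_sym)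
  ultimately obtain b where b: "free_generator G b"
    using free_generator_iso [OF group_integer_group assms(1)] unfolding is_iso_def by blast
  have bc: "b \<in> carrier G" using b by (simp add: free_generator_def)
  have all: "carrier G = range (\<lambda>n::int. a [^]\<^bsub>G\<^esub> n)"
    using carrier_subgroup_generated_by_singleton assms(3,4) by metis
  obtain j :: int where j: "b = a [^]\<^bsub>G\<^esub> j" using all bc by blast
  obtain i :: int where i: "a = b [^]\<^bsub>G\<^esub> i" using b assms(3) unfolding free_generator_def by blast
  have "b [^]\<^bsub>G\<^esub> (i * j) = b"
    using int_pow_pow [OF bc, of i j] unfolding i [symmetric] j [symmetric] by simp
  then have "b [^]\<^bsub>G\<^esub> (i * j) = b [^]\<^bsub>G\<^esub> (1::int)" using bc by simp
  then have ij: "i * j = 1" using free_generator_pow_eq_iff assms(1) b by metis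
  show ?thesis unfolding free_generator_def
  proof (intro conjI ballI)
    fix z assume "z \<in> carrier G"
    then obtain k :: int where k: "z = a [^]\<^bsub>G\<^esub> k" using all by blast
    show "\<exists>!k::int. z = a [^]\<^bsub>G\<^esub> k"
    proof (rule ex1I, rule k)
      fix l :: int assume "z = a [^]\<^bsub>G\<^esub> l"
      then have "b [^]\<^bsub>G\<^esub> (i * l) = b [^]\<^bsub>G\<^esub> (i * k)"
        using int_pow_pow [OF bc, of i] k unfolding i [symmetric] by simp
      then have "i * l = i * k" using free_generator_pow_eq_iff assms(1) b by metis
      then show "l = k" using ij by auto
    qed
  qed (use assms in auto)
qed

text \<open>Statements about integral combinations of cells are proved by reading both sides as homomorphisms
  of the chain and comparing them on single cells.\<close>

lemma hom_free_Abelian_group_eqI: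
  assumes "group H" "f \<in> hom (free_Abelian_group S) H" "g \<in> hom (free_Abelian_group S) H"
    and "\<And>s. s \<in> S \<Longrightarrow> f (frag_of s) = g (frag_of s)" and "supp c \<subseteq> S"
  shows "f c = g c"
proof -
  interpret f: group_hom "free_Abelian_group S" H f
    using assms by (simp add: group_hom_def group_hom_axioms_def)
  interpret g: group_hom "free_Abelian_group S" H g
    using assms by (simp add: group_hom_def group_hom_axioms_def)
  show ?thesis
    using assms(5)
  proof (rule free_Abelian_group_induct)
    show "f 0 = g 0" using f.hom_one g.hom_one by simp
  next
    fix x y assume *: "supp x \<subseteq> S" "supp y \<subseteq> S" "f x = g x" "f y = g y"
    have eq: "x - y = x \<otimes>\<^bsub>free_Abelian_group S\<^esub> inv\<^bsub>free_Abelian_group S\<^esub> y" using * by simp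
    have xy: "x \<in> carrier (free_Abelian_group S)" "y \<in> carrier (free_Abelian_group S)"
      using * by simp_all
    have "f (x - y) = f x \<otimes>\<^bsub>H\<^esub> inv\<^bsub>H\<^esub> f y"
      unfolding eq using xy f.hom_mult f.hom_inv f.G.inv_closed by metis
    moreover have "g (x - y) = g x \<otimes>\<^bsub>H\<^esub> inv\<^bsub>H\<^esub> g y"
      unfolding eq using xy g.hom_mult g.hom_inv f.G.inv_closed by metis
    ultimately show "f (x - y) = g (x - y)" using * by simp
  qed (use assms in auto)
qed

section \<open>Homology of discs modulo their boundary spheres\<close>

lemma disc_eq_top_of_set: "disc n = top_of_set {x. (\<forall>i\<ge>n. x i = 0) \<and> (\<Sum>i<n. x i ^ 2) \<le> 1}"
  unfolding disc_def Euclidean_space_def euclidean_product_topology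
  by (simp add: subtopology_subtopology Collect_conj_eq)

lemma topspace_disc: "topspace (disc n) = {x. (\<forall>i\<ge>n. x i = 0) \<and> (\<Sum>i<n. x i ^ 2) \<le> 1}"
  by (simp add: disc_eq_top_of_set)

lemma Hausdorff_disc: "Hausdorff_space (disc n)"
  unfolding disc_eq_top_of_set by (simp add: Hausdorff_space_subtopology)

lemma compact_disc: "compact_space (disc n)"
proof -
  let ?D = "{x::nat\<Rightarrow>real. (\<forall>i\<ge>n. x i = 0) \<and> (\<Sum>i<n. x i ^ 2) \<le> 1}"
  let ?B = "PiE UNIV (\<lambda>i. {-1..1::real}) :: (nat \<Rightarrow> real) set"
  have co: "continuous_on UNIV (\<lambda>x::nat\<Rightarrow>real. x i)" for i
    by (rule continuous_on_product_coordinates)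
  have "compactin (powertop_real UNIV) ?B"
    by (simp add: compactin_PiE)
  then have 1: "compact ?B"
    by (simp add: euclidean_product_topology)
  have "{x::nat\<Rightarrow>real. \<forall>i\<ge>n. x i = 0} = (\<Inter>i\<in>{n..}. {x::nat\<Rightarrow>real. x i = 0})"
    by auto
  moreover have "closed (\<Inter>i\<in>{n..}. {x::nat\<Rightarrow>real. x i = 0})"
    by (intro closed_INT ballI closed_Collect_eq continuous_intros co)
  moreover have "closed {x::nat\<Rightarrow>real. (\<Sum>i<n. x i ^ 2) \<le> 1}"
    by (intro closed_Collect_le continuous_intros co)
  ultimately have 2: "closed ?D" by (simp add: Collect_conj_eq closed_Int)
  have "?D \<subseteq> ?B"
  proof
    fix x :: "nat \<Rightarrow> real" assume x: "x \<in> ?D"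
    have "\<bar>x i\<bar> \<le> 1" for i
    proof (cases "i < n")
      case True
      then have "x i ^ 2 \<le> (\<Sum>i<n. x i ^ 2)"
        by (intro member_le_sum) auto
      then have "x i ^ 2 \<le> 1" using x by simp
      then show ?thesis by (simp add: abs_square_le_1)
    qed (use x in auto)
    then have "x i \<in> {-1..1}" for i using abs_le_iff [of "x i" 1] by (simp add: minus_le_iff)
    then show "x \<in> ?B" by (simp add: PiE_UNIV_domain)
  qed
  then have "?B \<inter> ?D = ?D" by blast
  then have "compact ?D" using compact_Int_closed [OF 1 2] by argo
  then show ?thesis by (simp add: disc_eq_top_of_set compact_space_subtopology)
qed

lemma sphere_set_0: "sphere_set 0 = {}"
  by (simp add: sphere_set_def)

lemma sphere_set_subset: "sphere_set n \<subseteq> topspace (disc n)"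
  by (auto simp: sphere_set_def)

lemma sphere_set_eq: "sphere_set n = {x. (\<forall>i\<ge>n. x i = 0) \<and> (\<Sum>i<n. x i ^ 2) = 1}"
  by (auto simp: sphere_set_def topspace_disc)

lemma subtopology_disc_sphere: "sphere_space n = nsphere n"
proof -
  have "{x::nat\<Rightarrow>real. (\<forall>i\<ge>Suc n. x i = 0) \<and> (\<Sum>i<Suc n. x i ^ 2) \<le> 1} \<inter> sphere_set (Suc n)
      = {x. (\<Sum>i\<le>n. x i ^ 2) = 1 \<and> (\<forall>i>n. x i = 0)}"
    unfolding sphere_set_eq by (auto simp: lessThan_Suc_atMost Suc_le_eq)
  then show ?thesis
    unfolding disc_eq_top_of_set nsphere euclidean_product_topology
    by (simp add: subtopology_subtopology)
qed

lemma contractible_disc: "contractible_space (disc n)"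
proof -
  let ?D = "{x::nat\<Rightarrow>real. (\<forall>i\<ge>n. x i = 0) \<and> (\<Sum>i<n. x i ^ 2) \<le> 1}"
  have "continuous_on ({0..1} \<times> ?D) (\<lambda>(t,x) i. (1 - t) * x i :: real)"
    unfolding case_prod_unfold
  proof (rule continuous_on_coordinatewise_then_product)
    fix i
    have "continuous_on ({0..1} \<times> ?D) (\<lambda>p::real \<times> (nat \<Rightarrow> real). snd p i)"
      by (rule continuous_on_product_then_coordinatewise [OF continuous_on_snd [OF continuous_on_id]])
    then show "continuous_on ({0..1} \<times> ?D) (\<lambda>p. (1 - fst p) * snd p i)"
      by (intro continuous_on_mult continuous_on_diff continuous_on_const continuous_on_fst continuous_on_id)
  qed
  moreover have "(\<lambda>(t,x) i. (1 - t) * x i :: real) \<in> {0..1} \<times> ?D \<rightarrow> ?D"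
  proof (clarsimp simp: Pi_iff)
    fix t :: real and x :: "nat \<Rightarrow> real"
    assume t: "0 \<le> t" "t \<le> 1" and x: "(\<Sum>i<n. (x i)\<^sup>2) \<le> 1"
    have "(\<Sum>i<n. ((1 - t) * x i)\<^sup>2) = (1-t)\<^sup>2 * (\<Sum>i<n. (x i)\<^sup>2)"
      by (simp add: power_mult_distrib sum_distrib_left)
    also have "\<dots> \<le> 1 * 1"
      using t x by (intro mult_mono) (auto simp: sum_nonneg power_le_one)
    finally show "(\<Sum>i<n. ((1 - t) * x i)\<^sup>2) \<le> 1" by simp
  qed
  ultimately have "continuous_map (prod_topology (top_of_set {0..1}) (top_of_set ?D)) (top_of_set ?D)
     (\<lambda>(t,x) i. (1 - t) * x i :: real)"
    by (simp add: prod_topology_subtopology_eu continuous_map_in_subtopology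
        image_subset_iff_funcset continuous_map_subtopology_eu)
  then show ?thesis
    unfolding contractible_space_def homotopic_with_def disc_eq_top_of_set
    by (intro exI [of _ "\<lambda>i. 0"] exI [of _ "\<lambda>(t,x) i. (1 - t) * x i :: real"]) auto
qed

text \<open>For \<open>n > 0\<close> the disc is contractible, so the connecting homomorphism reduces the question to the
  reduced homology of a sphere; for \<open>n = 0\<close> the sphere is empty and the disc is a point.\<close>

lemma trivial_group_disc_homology:
  assumes "k \<noteq> int n"
  shows "trivial_group (relative_homology_group k (disc n) (sphere_set n))"
proof (cases n)
  case 0
  have "topspace (disc 0) = {\<lambda>i. 0}" by (auto simp: topspace_disc)
  then show ?thesis
    using 0 assms homology_dimension_axiom by (metis of_nat_0 sphere_set_0)
next
  case (Suc m)
  have "topspace (disc n) \<inter> sphere_set n \<noteq> {}"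
    using in_topspace_nsphere [of m] subtopology_disc_sphere [of m] Suc
    by (metis empty_iff topspace_subtopology)
  then have "relative_homology_group k (disc n) (sphere_set n) \<cong>
      reduced_homology_group (k - 1) (nsphere m)"
    using isomorphic_group_relative_homology_of_contractible [OF contractible_disc]
      subtopology_disc_sphere [of m] Suc by metis
  moreover have "trivial_group (reduced_homology_group (k - 1) (nsphere m))"
    using reduced_homology_group_nsphere(2) assms Suc by auto
  ultimately show ?thesis
    using isomorphic_group_triviality group_reduced_homology_group group_relative_homology_group by blast
qed

lemma integer_disc_homology:
  "relative_homology_group (int n) (disc n) (sphere_set n) \<cong> integer_group"
proof (cases n)
  case 0
  have "topspace (disc 0) = {\<lambda>i. 0}" by (auto simp: topspace_disc)
  then show ?thesis
    using 0 homology_coefficients by (simp add: sphere_set_0)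
next
  case (Suc m)
  have "topspace (disc n) \<inter> sphere_set n \<noteq> {}"
    using in_topspace_nsphere [of m] subtopology_disc_sphere [of m] Suc
    by (metis empty_iff topspace_subtopology)
  then have "relative_homology_group (int n) (disc n) (sphere_set n) \<cong>
      reduced_homology_group (int n - 1) (nsphere m)"
    using isomorphic_group_relative_homology_of_contractible [OF contractible_disc]
      subtopology_disc_sphere [of m] Suc by metis
  moreover have "int n - 1 = int m" using Suc by simp
  ultimately show ?thesis
    using reduced_homology_group_nsphere(1) iso_trans by metis
qed

text \<open>This justifies the choice operator in the definition of the orientation class of the disc.\<close>

lemma free_generator_disc_class:
  "free_generator (relative_homology_group (int n) (disc n) (sphere_set n)) (disc_class n)"
proof -
  let ?H = "relative_homology_group (int n) (disc n) (sphere_set n)"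
  have "cyclic_group ?H"
    using integer_disc_homology isomorphic_group_cyclicity group_relative_homology_group
      cyclic_integer_group group_integer_group by metis
  then have "\<exists>a. a \<in> carrier ?H \<and> subgroup_generated ?H {a} = ?H"
    unfolding cyclic_group_def by blast
  then have "disc_class n \<in> carrier ?H \<and> subgroup_generated ?H {disc_class n} = ?H"
    unfolding disc_class_def by (rule someI_ex)
  then show ?thesis
    by (intro infinite_cyclic_free_generator integer_disc_homology group_relative_homology_group) simp_all
qed

section \<open>Relative homology of attaching one cell\<close>

lemma iso_cancel_left:
  assumes "f \<in> hom G H" "g \<in> iso H K" "h \<in> iso G K"
    and "\<And>x. x \<in> carrier G \<Longrightarrow> g (f x) = h x"
  shows "f \<in> iso G H"
proof -
  have f: "f \<in> carrier G \<rightarrow> carrier H" using assms(1) by (simp add: hom_def)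
  have g: "inj_on g (carrier H)" "g ` carrier H = carrier K"
    and h: "inj_on h (carrier G)" "h ` carrier G = carrier K"
    using assms by (auto simp: iso_def bij_betw_def)
  have "inj_on f (carrier G)"
    using h(1) assms(4) unfolding inj_on_def by metis
  moreover have "f ` carrier G = carrier H"
  proof (intro equalityI subsetI)
    fix y assume y: "y \<in> carrier H"
    then have "g y \<in> h ` carrier G" using g h by blast
    then obtain x where x: "x \<in> carrier G" "g y = h x" by blast
    then have "g (f x) = g y" using assms(4) by simp
    moreover have "f x \<in> carrier H" using f x by blast
    ultimately have "f x = y" using inj_onD [OF g(1)] y by blast
    then show "y \<in> f ` carrier G" using x by blast
  qed (use f in auto)
  ultimately show ?thesis using assms(1) by (simp add: iso_def bij_betw_def)
qed

lemma iso_cancel_right: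
  assumes "g \<in> hom H K" "f \<in> iso G H" "h \<in> iso G K"
    and "\<And>x. x \<in> carrier G \<Longrightarrow> g (f x) = h x"
  shows "g \<in> iso H K"
proof -
  have f: "bij_betw f (carrier G) (carrier H)" and h: "bij_betw h (carrier G) (carrier K)"
    using assms by (auto simp: iso_def)
  have "bij_betw (g \<circ> f) (carrier G) (carrier K)"
    using h assms(4) by (simp cong: bij_betw_cong)
  then have "bij_betw g (carrier H) (carrier K)"
    using f bij_betw_comp_iff by blast
  then show ?thesis using assms(1) by (simp add: iso_def)
qed

lemma iso_hom_induced_trivial_pair:
  assumes "A \<subseteq> M" and triv: "\<And>p. trivial_group (relative_homology_group p (subtopology X M) A)"
  shows "hom_induced p X A X M id \<in> iso (relative_homology_group p X A) (relative_homology_group p X M)"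
proof -
  let ?f = "hom_induced p X A X M id"
  have hom: "?f \<in> hom (relative_homology_group p X A) (relative_homology_group p X M)"
    by (rule hom_induced_hom)
  interpret f: group_hom "relative_homology_group p X A" "relative_homology_group p X M" ?f
    using hom by (simp add: group_hom_def group_hom_axioms_def)
  interpret k: group_hom "relative_homology_group p (subtopology X M) A" "relative_homology_group p X A"
      "hom_induced p (subtopology X M) A X A id"
    by (simp add: group_hom_def group_hom_axioms_def hom_induced_hom)
  interpret b: group_hom "relative_homology_group p X M" "relative_homology_group (p-1) (subtopology X M) A"
      "hom_relboundary p X M A"
    by (simp add: group_hom_def group_hom_axioms_def group_homomorphism_hom_relboundary)
  have "kernel (relative_homology_group p X A) (relative_homology_group p X M) ?f
     = hom_induced p (subtopology X M) A X A id ` carrier (relative_homology_group p (subtopology X M) A)"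
    using homology_exactness_triple_3 [OF assms(1), of p X] by auto
  also have "\<dots> = {\<one>\<^bsub>relative_homology_group p X A\<^esub>}"
    using k.image_from_trivial_group triv by blast
  finally have "inj_on ?f (carrier (relative_homology_group p X A))"
    using f.inj_iff_trivial_ker by blast
  moreover have "?f ` carrier (relative_homology_group p X A)
      = kernel (relative_homology_group p X M) (relative_homology_group (p-1) (subtopology X M) A) (hom_relboundary p X M A)"
    using homology_exactness_triple_1 [OF assms(1), of p X] by auto
  moreover have "\<dots> = carrier (relative_homology_group p X M)"
    using b.kernel_to_trivial_group triv by blast
  ultimately show ?thesis
    using hom by (simp add: iso_def bij_betw_def)
qed

lemma iso_hom_induced_excision:
  assumes "closedin X A" "A \<subseteq> X interior_of M"
  shows "hom_induced p (subtopology X (topspace X - A)) (M - A) X M id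
    \<in> iso (relative_homology_group p (subtopology X (topspace X - A)) (M - A)) (relative_homology_group p X M)"
proof -
  have "hom_induced p (subtopology X (topspace X - A)) (topspace X \<inter> M - A) (subtopology X (topspace X)) (topspace X \<inter> M) id
    \<in> iso (relative_homology_group p (subtopology X (topspace X - A)) (topspace X \<inter> M - A))
          (relative_homology_group p (subtopology X (topspace X)) (topspace X \<inter> M))"
    using assms by (intro homology_excision_axiom) (auto simp: closure_of_closedin interior_of_restrict [symmetric])
  moreover have "topspace (subtopology X (topspace X - A)) \<inter> (M - A) = topspace X \<inter> M - A" by auto
  ultimately show ?thesis
    by (metis hom_induced_restrict relative_homology_group_restrict subtopology_topspace)
qed

text \<open>The classical argument for relative homeomorphisms: thickening \<open>A\<close> to \<open>M\<close> does not change the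
  relative group, and after the thickening \<open>A\<close> can be excised. What remains on both sides are the
  complements of \<open>S\<close> and \<open>A\<close>, between which \<open>f\<close> is a homeomorphism of pairs.\<close>

lemma iso_hom_induced_relative_homeomorphism:
  assumes D: "closedin D S" "S \<subseteq> N" "S \<subseteq> D interior_of N" "N \<subseteq> topspace D"
      "\<And>p. trivial_group (relative_homology_group p (subtopology D N) S)"
    and X: "closedin X A" "A \<subseteq> M" "A \<subseteq> X interior_of M"
      "\<And>p. trivial_group (relative_homology_group p (subtopology X M) A)"
    and f: "continuous_map D X f" "f ` S \<subseteq> A" "f ` N \<subseteq> M"
      "homeomorphic_map (subtopology D (topspace D - S)) (subtopology X (topspace X - A)) f"
      "f ` (N - S) = M - A"
  shows "hom_induced p D S X A f \<in> iso (relative_homology_group p D S) (relative_homology_group p X A)"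
proof -
  let ?D' = "subtopology D (topspace D - S)" and ?X' = "subtopology X (topspace X - A)"
  have e1: "hom_induced p ?D' (N - S) D N id \<in> iso (relative_homology_group p ?D' (N - S)) (relative_homology_group p D N)"
    by (rule iso_hom_induced_excision [OF D(1,3)])
  have e2: "hom_induced p ?X' (M - A) X M id \<in> iso (relative_homology_group p ?X' (M - A)) (relative_homology_group p X M)"
    by (rule iso_hom_induced_excision [OF X(1,3)])
  have f': "hom_induced p ?D' (N - S) ?X' (M - A) f \<in> iso (relative_homology_group p ?D' (N - S)) (relative_homology_group p ?X' (M - A))"
    using D(4) by (intro homeomorphic_map_relative_homology_iso f) auto
  have cf': "continuous_map ?D' ?X' f" using f(4) homeomorphic_imp_continuous_map by blast
  have fNM: "hom_induced p D N X M f \<in> iso (relative_homology_group p D N) (relative_homology_group p X M)"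
  proof (rule iso_cancel_right [OF hom_induced_hom e1 iso_set_trans [OF f' e2]])
    fix x assume x: "x \<in> carrier (relative_homology_group p ?D' (N - S))"
    have "hom_induced p D N X M f (hom_induced p ?D' (N - S) D N id x) = hom_induced p ?D' (N - S) X M (f \<circ> id) x"
      using f by (intro hom_induced_compose') (auto simp: continuous_map_from_subtopology)
    moreover have "hom_induced p ?X' (M - A) X M id (hom_induced p ?D' (N - S) ?X' (M - A) f x)
       = hom_induced p ?D' (N - S) X M (id \<circ> f) x"
      using f cf' by (intro hom_induced_compose') (auto simp: continuous_map_from_subtopology)
    ultimately show "hom_induced p D N X M f (hom_induced p ?D' (N - S) D N id x) =
         (hom_induced p ?X' (M - A) X M id \<circ> hom_induced p ?D' (N - S) ?X' (M - A) f) x"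
      by simp
  qed
  have j1: "hom_induced p D S D N id \<in> iso (relative_homology_group p D S) (relative_homology_group p D N)"
    by (rule iso_hom_induced_trivial_pair [OF D(2,5)])
  have j2: "hom_induced p X A X M id \<in> iso (relative_homology_group p X A) (relative_homology_group p X M)"
    by (rule iso_hom_induced_trivial_pair [OF X(2,4)])
  show ?thesis
  proof (rule iso_cancel_left [OF hom_induced_hom j2 iso_set_trans [OF j1 fNM]])
    fix x assume x: "x \<in> carrier (relative_homology_group p D S)"
    have "hom_induced p X A X M id (hom_induced p D S X A f x) = hom_induced p D S X M (id \<circ> f) x"
      using f X by (intro hom_induced_compose') auto
    moreover have "hom_induced p D N X M f (hom_induced p D S D N id x) = hom_induced p D S X M (f \<circ> id) x"
      using f D by (intro hom_induced_compose') auto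
    ultimately show "hom_induced p X A X M id (hom_induced p D S X A f x) =
         (hom_induced p D N X M f \<circ> hom_induced p D S D N id) x"
      by simp
  qed
qed

definition radius_sq :: "nat \<Rightarrow> (nat \<Rightarrow> real) \<Rightarrow> real" where
  "radius_sq n x = (\<Sum>i<n. x i ^ 2)"

text \<open>The points of norm at least \<open>1/2\<close>; every radius strictly between \<open>0\<close> and \<open>1\<close> would serve.\<close>

definition collar :: "nat \<Rightarrow> (nat \<Rightarrow> real) set" where
  "collar n = {x \<in> topspace (disc n). 1/4 \<le> radius_sq n x}"

text \<open>The straight-line motion from \<open>x\<close> to its radial projection on the sphere.\<close>

definition collar_push :: "nat \<Rightarrow> real \<Rightarrow> (nat \<Rightarrow> real) \<Rightarrow> nat \<Rightarrow> real" where
  "collar_push n t x = (\<lambda>i. x i * ((1 - t) + t / sqrt (radius_sq n x)))"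

lemma radius_sq_collar_push:
  assumes "x \<in> collar n"
  shows "radius_sq n (collar_push n t x) = ((1 - t) * sqrt (radius_sq n x) + t)\<^sup>2"
proof -
  have q: "radius_sq n x > 0" using assms by (simp add: collar_def)
  have "radius_sq n (collar_push n t x) = radius_sq n x * ((1 - t) + t / sqrt (radius_sq n x))\<^sup>2"
    unfolding collar_push_def radius_sq_def by (simp add: power_mult_distrib sum_distrib_right)
  also have "\<dots> = (sqrt (radius_sq n x) * ((1 - t) + t / sqrt (radius_sq n x)))\<^sup>2"
    using q by (simp add: power_mult_distrib)
  also have "sqrt (radius_sq n x) * ((1 - t) + t / sqrt (radius_sq n x)) = (1 - t) * sqrt (radius_sq n x) + t"
    using q by (simp add: distrib_left)
  finally show ?thesis .
qed

lemma collar_push_in_collar: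
  assumes x: "x \<in> collar n" and t: "0 \<le> t" "t \<le> 1"
  shows "collar_push n t x \<in> collar n"
proof -
  let ?r = "sqrt (radius_sq n x)"
  have "sqrt (1/4) \<le> ?r" using x by (intro real_sqrt_le_mono) (simp add: collar_def)
  moreover have "sqrt (1/4) = (1/2::real)" by (simp add: real_sqrt_divide)
  ultimately have r: "1/2 \<le> ?r" by simp
  have r1: "?r \<le> 1" using x by (simp add: collar_def topspace_disc radius_sq_def)
  have "1/2 * (1-t) \<le> ?r * (1 - t)" using r t by (intro mult_right_mono) auto
  then have lo: "1/2 \<le> (1 - t) * ?r + t" using t by (simp add: mult.commute [of ?r])
  have "?r * (1-t) \<le> 1 * (1 - t)" using r1 t by (intro mult_right_mono) auto
  then have hi: "(1 - t) * ?r + t \<le> 1" by (simp add: algebra_simps)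
  have "(1/2)\<^sup>2 \<le> ((1 - t) * ?r + t)\<^sup>2" using lo by (intro power_mono) auto
  moreover have "((1 - t) * ?r + t)\<^sup>2 \<le> 1" using lo hi by (intro power_le_one) auto
  moreover have "\<forall>i\<ge>n. collar_push n t x i = 0"
    using x by (simp add: collar_def topspace_disc collar_push_def)
  ultimately show ?thesis
    using radius_sq_collar_push [OF x, of t]
    by (simp add: collar_def topspace_disc power_divide flip: radius_sq_def)
qed

lemma collar_push_0: "collar_push n 0 x = x"
  by (simp add: collar_push_def)

lemma collar_push_1: "x \<in> collar n \<Longrightarrow> collar_push n 1 x \<in> sphere_set n"
  using radius_sq_collar_push [of x n 1] collar_push_in_collar [of x n 1]
  by (simp add: sphere_set_def collar_def flip: radius_sq_def)

lemma collar_push_sphere: "x \<in> sphere_set n \<Longrightarrow> collar_push n t x = x"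
  by (simp add: collar_push_def sphere_set_def radius_sq_def)

lemma sphere_subset_collar: "sphere_set n \<subseteq> collar n"
  by (auto simp: sphere_set_def collar_def radius_sq_def)

lemma continuous_on_radius_sq: "continuous_on A (radius_sq n)"
  unfolding radius_sq_def
  by (intro continuous_intros continuous_on_subset [OF continuous_on_product_coordinates]) auto

lemma subtopology_disc_eq: "U \<subseteq> topspace (disc n) \<Longrightarrow> subtopology (disc n) U = top_of_set U"
  unfolding disc_eq_top_of_set by (simp add: subtopology_subtopology inf.absorb2)

lemma continuous_map_collar_push:
  "continuous_map (prod_topology (top_of_set {0..1}) (subtopology (disc n) (collar n)))
     (subtopology (disc n) (collar n)) (\<lambda>(t,x). collar_push n t x)"
proof -
  let ?N = "collar n"
  have N: "subtopology (disc n) ?N = top_of_set ?N"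
    by (rule subtopology_disc_eq) (auto simp: collar_def)
  have "continuous_on ({0..1} \<times> ?N) (\<lambda>(t,x). collar_push n t x)"
    unfolding case_prod_unfold collar_push_def
  proof (rule continuous_on_coordinatewise_then_product)
    fix i
    have 1: "continuous_on ({0..1} \<times> ?N) (\<lambda>p::real \<times> (nat \<Rightarrow> real). snd p i)"
      by (rule continuous_on_product_then_coordinatewise [OF continuous_on_snd [OF continuous_on_id]])
    have 2: "continuous_on ({0..1} \<times> ?N) (\<lambda>p::real \<times> (nat \<Rightarrow> real). radius_sq n (snd p))"
      by (rule continuous_on_compose2 [OF continuous_on_radius_sq [of UNIV]])
         (auto intro: continuous_on_snd [OF continuous_on_id])
    show "continuous_on ({0..1} \<times> ?N) (\<lambda>p. snd p i * ((1 - fst p) + fst p / sqrt (radius_sq n (snd p))))"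
      by (intro continuous_on_mult continuous_on_add continuous_on_diff continuous_on_divide
          continuous_on_real_sqrt continuous_on_const continuous_on_fst continuous_on_id 1 2)
         (auto simp: collar_def)
  qed
  moreover have "(\<lambda>(t,x). collar_push n t x) \<in> {0..1} \<times> ?N \<rightarrow> ?N"
    using collar_push_in_collar by auto
  ultimately show ?thesis
    unfolding N
    by (simp add: prod_topology_subtopology_eu continuous_map_in_subtopology
        image_subset_iff_funcset continuous_map_subtopology_eu)
qed

lemma closedin_collar: "closedin (disc n) (collar n)"
proof -
  have "closed {x. 1/4 \<le> radius_sq n x}"
    by (intro closed_Collect_le continuous_on_const continuous_on_radius_sq)
  moreover have "collar n = topspace (disc n) \<inter> {x. 1/4 \<le> radius_sq n x}" by (auto simp: collar_def)
  ultimately show ?thesis unfolding disc_eq_top_of_set by (simp add: closedin_closed_Int)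
qed

lemma closedin_sphere_set: "closedin (disc n) (sphere_set n)"
proof -
  have "closed {x. radius_sq n x = 1}"
    by (intro closed_Collect_eq continuous_on_const continuous_on_radius_sq)
  moreover have "sphere_set n = topspace (disc n) \<inter> {x. radius_sq n x = 1}"
    by (auto simp: sphere_set_def radius_sq_def)
  ultimately show ?thesis unfolding disc_eq_top_of_set by (simp add: closedin_closed_Int)
qed

lemma closedin_half_disc: "closedin (disc n) {x \<in> topspace (disc n). radius_sq n x \<le> 1/4}"
proof -
  have "closed {x. radius_sq n x \<le> 1/4}"
    by (intro closed_Collect_le continuous_on_const continuous_on_radius_sq)
  moreover have "{x \<in> topspace (disc n). radius_sq n x \<le> 1/4} = topspace (disc n) \<inter> {x. radius_sq n x \<le> 1/4}"
    by auto
  ultimately show ?thesis unfolding disc_eq_top_of_set by (simp add: closedin_closed_Int)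
qed

text \<open>The space \<open>X\<close> is \<open>A\<close> with one open \<open>n\<close>-cell glued on by \<open>f\<close>. The map \<open>f\<close> is arbitrary rather than
  the characteristic map of a cell of a complex, because the translates of characteristic maps by
  group elements are attaching data too.\<close>

definition attaches_cell :: "nat \<Rightarrow> 'a topology \<Rightarrow> 'a set \<Rightarrow> ((nat \<Rightarrow> real) \<Rightarrow> 'a) \<Rightarrow> bool" where
  "attaches_cell n X A f \<longleftrightarrow> Hausdorff_space X \<and> closedin X A \<and> continuous_map (disc n) X f \<and>
     f ` sphere_set n \<subseteq> A \<and>
     homeomorphic_map (subtopology (disc n) (open_disc n)) (subtopology X (topspace X - A)) f"

lemma attaches_cell_facts:
  assumes "attaches_cell n X A f"
  shows "inj_on f (open_disc n)"
    and "f ` (open_disc n) = topspace X - A"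
proof -
  have h: "homeomorphic_map (subtopology (disc n) (open_disc n)) (subtopology X (topspace X - A)) f"
    using assms by (simp add: attaches_cell_def)
  show "inj_on f (open_disc n)"
    using homeomorphic_imp_injective_map [OF h] by (simp add: Int_absorb1 Diff_subset)
  show "f ` (open_disc n) = topspace X - A"
    using homeomorphic_imp_surjective_map [OF h] by (simp add: Int_absorb1 Diff_subset)
qed

lemma attaches_cell_disc: "attaches_cell n (disc n) (sphere_set n) id"
  unfolding attaches_cell_def
  using Hausdorff_disc closedin_sphere_set by (auto intro: homeomorphic_map_id [THEN iffD2])

text \<open>The complement of the image of the disc of radius \<open>1/2\<close> is an open set between \<open>A\<close> and the
  thickening: that image is compact, hence closed in a Hausdorff space.\<close>

lemma collar_interior:
  assumes "attaches_cell n X A f"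
  shows "A \<subseteq> X interior_of (A \<union> f ` collar n)"
proof -
  let ?H = "{x \<in> topspace (disc n). radius_sq n x \<le> 1/4}"
  note surj = attaches_cell_facts(2) [OF assms]
  have X: "Hausdorff_space X" "closedin X A" "continuous_map (disc n) X f" "f ` sphere_set n \<subseteq> A"
    using assms by (auto simp: attaches_cell_def)
  have "closedin X (f ` ?H)"
    by (rule compactin_imp_closedin [OF X(1) image_compactin [OF
          closedin_compact_space [OF compact_disc closedin_half_disc] X(3)]])
  then have op: "openin X (topspace X - f ` ?H)" by blast
  have HS: "?H \<subseteq> open_disc n"
    by (auto simp: sphere_set_def radius_sq_def)
  have 1: "topspace X - f ` ?H \<subseteq> A \<union> f ` collar n"
  proof
    fix y assume y: "y \<in> topspace X - f ` ?H"
    show "y \<in> A \<union> f ` collar n"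
    proof (cases "y \<in> A")
      case False
      then have "y \<in> f ` (open_disc n)" using y surj by blast
      then show ?thesis using y by (force simp: collar_def)
    qed auto
  qed
  have "f ` ?H \<inter> A = {}" using image_mono [OF HS, of f] surj by blast
  then have 2: "A \<subseteq> topspace X - f ` ?H" using closedin_subset [OF X(2)] by blast
  show ?thesis using interior_of_maximal [OF 1 op] 2 by blast
qed

text \<open>Pushing the collar radially to the sphere deforms the thickening onto \<open>A\<close> and keeps \<open>A\<close> pointwise
  fixed.\<close>

lemma trivial_homology_collar:
  assumes att: "attaches_cell n X A f"
  shows "trivial_group (relative_homology_group p (subtopology X (A \<union> f ` collar n)) A)"
proof -
  let ?N = "collar n" and ?S = "sphere_set n" and ?D = "topspace (disc n)"
  let ?M = "A \<union> f ` ?N" and ?I = "top_of_set {0..1::real}"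
  let ?XM = "subtopology X ?M"
  note inj = attaches_cell_facts(1) [OF att] and surj = attaches_cell_facts(2) [OF att]
  have X: "Hausdorff_space X" "closedin X A" "continuous_map (disc n) X f" "f ` ?S \<subseteq> A"
    using att by (auto simp: attaches_cell_def)
  have ND: "?N \<subseteq> ?D" by (auto simp: collar_def)
  have fD: "f ` ?D \<subseteq> topspace X" using X(3) continuous_map_image_subset_topspace by blast
  have AX: "A \<subseteq> topspace X" using closedin_subset [OF X(2)] .
  have cN: "compactin (disc n) ?N" using closedin_compact_space [OF compact_disc closedin_collar] .
  have cfN: "compactin X (f ` ?N)" using image_compactin [OF cN X(3)] .
  have clN: "closedin X (f ` ?N)" using compactin_imp_closedin [OF X(1) cfN] .
  define g where "g = inv_into (?D - ?S) f"
  define H where "H = (\<lambda>(t::real, y). if y \<in> A then y else f (collar_push n t (g y)))"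
  have Hf: "H (t, f x) = f (collar_push n t x)" if x: "x \<in> ?N" for t x
  proof (cases "x \<in> ?S")
    case True
    then show ?thesis using X(4) by (auto simp: H_def collar_push_sphere)
  next
    case False
    then have x': "x \<in> ?D - ?S" using x ND by blast
    then have "f x \<notin> A" using surj by blast
    moreover have "g (f x) = x" unfolding g_def using inv_into_f_f [OF inj x'] .
    ultimately show ?thesis by (simp add: H_def)
  qed
  have HM: "H (t, y) \<in> ?M" if "0 \<le> t" "t \<le> 1" "y \<in> ?M" for t y
    using that collar_push_in_collar Hf by (auto simp: H_def) (metis image_eqI)
  have MX: "?M \<subseteq> topspace X" using AX fD ND by blast
  \<comment> \<open>Continuity is checked on the two closed pieces. On the image of the collar it is checked after
    composing with the product of the unit interval and \<open>f\<close>, which is a quotient map since its domain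
    is compact and its target Hausdorff.\<close>
  have contH: "continuous_map (prod_topology ?I ?XM) ?XM H"
  proof (rule pasting_lemma_closed [where I = UNIV and T = "\<lambda>b. {0..1} \<times> (if b then A else f ` ?N)" and f = "\<lambda>b. H"])
    fix b :: bool
    have "closedin ?XM (if b then A else f ` ?N)"
      using X(2) clN by (auto intro: closedin_subset_topspace)
    then show "closedin (prod_topology ?I ?XM) ({0..1} \<times> (if b then A else f ` ?N))"
      by (simp add: closedin_prod_Times_iff)
    show "continuous_map (subtopology (prod_topology ?I ?XM) ({0..1} \<times> (if b then A else f ` ?N))) ?XM H"
    proof (cases b)
      case True
      have "continuous_map (prod_topology ?I ?XM) ?XM snd" by (rule continuous_map_snd)
      then have "continuous_map (subtopology (prod_topology ?I ?XM) ({0..1} \<times> A)) ?XM snd"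
        by (rule continuous_map_from_subtopology)
      then have "continuous_map (subtopology (prod_topology ?I ?XM) ({0..1} \<times> A)) ?XM H"
        by (rule continuous_map_eq) (auto simp: H_def)
      then show ?thesis using True by simp
    next
      case False
      let ?P = "prod_topology ?I (subtopology (disc n) ?N)"
      let ?Q = "prod_topology ?I (subtopology X (f ` ?N))"
      have absorb: "?M \<inter> f ` ?N = f ` ?N" by blast
      have sub: "subtopology (prod_topology ?I ?XM) ({0..1} \<times> f ` ?N) = ?Q"
        using absorb by (simp add: subtopology_Times subtopology_subtopology)
      have cf: "continuous_map (subtopology (disc n) ?N) (subtopology X (f ` ?N)) f"
        using X(3) by (auto simp: continuous_map_in_subtopology continuous_map_from_subtopology)
      have q: "quotient_map ?P ?Q (\<lambda>(t,x). (t, f x))"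
      proof (rule T1_Spaces.continuous_imp_quotient_map)
        show "continuous_map ?P ?Q (\<lambda>(t,x). (t, f x))"
          using cf by (simp add: continuous_map_prod_top [of ?I _ ?I _ "\<lambda>t. t" f])
        show "compact_space ?P"
          using cN by (simp add: compact_space_prod_topology compact_space_subtopology)
        show "Hausdorff_space ?Q"
          using X(1) by (simp add: Hausdorff_space_prod_topology Hausdorff_space_subtopology)
        show "(\<lambda>(t,x). (t, f x)) ` topspace ?P = topspace ?Q"
          using ND fD by (auto simp: image_iff) 
      qed
      have "continuous_map ?P ?XM (f \<circ> (\<lambda>(t,x). collar_push n t x))"
      proof (rule continuous_map_compose [OF continuous_map_collar_push])
        show "continuous_map (subtopology (disc n) ?N) ?XM f"
          using X(3) by (auto simp: continuous_map_in_subtopology continuous_map_from_subtopology)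
      qed
      then have "continuous_map ?P ?XM (H \<circ> (\<lambda>(t,x). (t, f x)))"
        by (rule continuous_map_eq) (use Hf in auto)
      then have "continuous_map ?Q ?XM H" by (rule continuous_compose_quotient_map [OF q])
      then show ?thesis using False sub by simp
    qed
  qed auto
  have H0: "H (0, y) = y" if "y \<in> ?M" for y
    using that Hf collar_push_0 by (auto simp: H_def) metis
  have H1: "H (1, y) \<in> A" if "y \<in> ?M" for y
    using that Hf collar_push_1 X(4) by (auto simp: H_def) (metis image_subset_iff)
  have HA: "H (t, y) = y" if "y \<in> A" for t y using that by (simp add: H_def)
  \<comment> \<open>Outside the thickening \<open>r\<close> is the identity, because the homotopy relation compares functions
    at all points of the type.\<close>
  define r where "r = (\<lambda>y. if y \<in> ?M then H (1, y) else y)"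
  have hw: "homotopic_with (\<lambda>k. k ` A \<subseteq> A) ?XM ?XM id r"
    unfolding homotopic_with_def
  proof (intro exI conjI allI ballI)
    show "continuous_map (prod_topology ?I ?XM) ?XM (\<lambda>p. if snd p \<in> ?M then H p else snd p)"
      by (rule continuous_map_eq [OF contH]) auto
  qed (use H0 HA in \<open>auto simp: r_def\<close>)
  have "continuous_map ?XM ?XM r" using homotopic_with_imp_continuous_maps [OF hw] by blast
  then have "continuous_map ?XM (subtopology ?XM A) r"
    using H1 by (auto simp: continuous_map_in_subtopology r_def)
  then show ?thesis
    by (rule trivial_relative_homology_group_alt) (rule homotopic_with_symD [OF hw])
qed

theorem iso_hom_induced_attaches_cell:
  assumes "attaches_cell n X A f"
  shows "hom_induced p (disc n) (sphere_set n) X A f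
    \<in> iso (relative_homology_group p (disc n) (sphere_set n)) (relative_homology_group p X A)"
proof -
  note surj = attaches_cell_facts(2) [OF assms]
  have X: "closedin X A" "continuous_map (disc n) X f" "f ` sphere_set n \<subseteq> A"
     "homeomorphic_map (subtopology (disc n) (open_disc n)) (subtopology X (topspace X - A)) f"
    using assms by (auto simp: attaches_cell_def)
  have SN: "sphere_set n \<union> collar n = collar n" using sphere_subset_collar by blast
  have ND: "collar n \<subseteq> topspace (disc n)" by (auto simp: collar_def)
  show ?thesis
  proof (rule iso_hom_induced_relative_homeomorphism [where N = "collar n" and M = "A \<union> f ` collar n"])
    show "sphere_set n \<subseteq> disc n interior_of collar n"
      using collar_interior [OF attaches_cell_disc, of n] by (simp add: SN)
    show "trivial_group (relative_homology_group p (subtopology (disc n) (collar n)) (sphere_set n))" for p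
      using trivial_homology_collar [OF attaches_cell_disc, of p n] by (simp add: SN)
    show "trivial_group (relative_homology_group p (subtopology X (A \<union> f ` collar n)) A)" for p
      by (rule trivial_homology_collar [OF assms])
    show "A \<subseteq> X interior_of (A \<union> f ` collar n)" by (rule collar_interior [OF assms])
    have "f ` (collar n - sphere_set n) \<inter> A = {}" using surj ND by blast
    then show "f ` (collar n - sphere_set n) = A \<union> f ` collar n - A" using X(3) by blast
  qed (use X ND closedin_sphere_set sphere_subset_collar in auto)
qed

section \<open>Closure finiteness and closed families of cells\<close>

definition all_cells :: "('a, 'b) cell_complex_scheme \<Rightarrow> 'a set set" where
  "all_cells K = (\<Union>n. cells K n)"

definition closure_finite :: "('a, 'b) cell_complex_scheme \<Rightarrow> bool" where
  "closure_finite K \<longleftrightarrow>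
     (\<forall>n. \<forall>e\<in>cells K n. finite {f \<in> all_cells K. f \<inter> charmap K e ` sphere_set n \<noteq> {}})"

lemma
  assumes "is_cell_complex K"
  shows is_cell_complex_Hausdorff: "Hausdorff_space (carrier_top K)"
    and is_cell_complex_topspace: "topspace (carrier_top K) = (\<Union>n. \<Union>(cells K n))"
    and cell_disjoint: "\<And>m n e e'. e \<in> cells K m \<Longrightarrow> e' \<in> cells K n \<Longrightarrow> e \<inter> e' \<noteq> {} \<Longrightarrow> m = n \<and> e = e'"
    and is_cell_complex_charmap: "\<And>n e. e \<in> cells K n \<Longrightarrow>
        continuous_map (disc n) (carrier_top K) (charmap K e) \<and>
        homeomorphic_map (subtopology (disc n) (- sphere_set n))
          (subtopology (carrier_top K) e) (charmap K e) \<and>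
        charmap K e ` sphere_set n \<subseteq> (\<Union>m<n. \<Union>(cells K m))"
    and is_cell_complex_closedin: "\<And>A. A \<subseteq> topspace (carrier_top K) \<Longrightarrow>
        (\<And>n e. e \<in> cells K n \<Longrightarrow> closedin (disc n) {x \<in> topspace (disc n). charmap K e x \<in> A}) \<Longrightarrow>
        closedin (carrier_top K) A"
proof -
  note d = assms [unfolded is_cell_complex_def]
  show "Hausdorff_space (carrier_top K)" by (rule d [THEN conjunct1])
  show "topspace (carrier_top K) = (\<Union>n. \<Union>(cells K n))" by (rule d [THEN conjunct2, THEN conjunct1])
  show "m = n \<and> e = e'" if "e \<in> cells K m" "e' \<in> cells K n" "e \<inter> e' \<noteq> {}" for m n e e'
    using d [THEN conjunct2, THEN conjunct2, THEN conjunct1, rule_format, OF that] .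
  show "continuous_map (disc n) (carrier_top K) (charmap K e) \<and>
        homeomorphic_map (subtopology (disc n) (- sphere_set n))
          (subtopology (carrier_top K) e) (charmap K e) \<and>
        charmap K e ` sphere_set n \<subseteq> (\<Union>m<n. \<Union>(cells K m))" if "e \<in> cells K n" for n e
    using d [THEN conjunct2, THEN conjunct2, THEN conjunct2, THEN conjunct1] that by blast
  show "closedin (carrier_top K) A" if "A \<subseteq> topspace (carrier_top K)"
    "\<And>n e. e \<in> cells K n \<Longrightarrow> closedin (disc n) {x \<in> topspace (disc n). charmap K e x \<in> A}" for A
    using d [THEN conjunct2, THEN conjunct2, THEN conjunct2, THEN conjunct2] that by blast
qed

lemma
  assumes "is_cell_complex K" "e \<in> cells K n"
  shows cell_charmap: "continuous_map (disc n) (carrier_top K) (charmap K e)"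
    and cell_homeomorphic: "homeomorphic_map (subtopology (disc n) (open_disc n)) (subtopology (carrier_top K) e) (charmap K e)"
    and cell_sphere: "charmap K e ` sphere_set n \<subseteq> (\<Union>m<n. \<Union>(cells K m))"
    and cell_subset: "e \<subseteq> topspace (carrier_top K)"
    and cell_interior: "charmap K e ` (open_disc n) = e"
    and cell_nonempty: "e \<noteq> {}"
proof -
  note * = is_cell_complex_charmap [OF assms] and top = is_cell_complex_topspace [OF assms(1)]
  have "topspace (disc n) \<inter> - sphere_set n = topspace (disc n) \<inter> (open_disc n)" by blast
  then have eq: "subtopology (disc n) (- sphere_set n) = subtopology (disc n) (open_disc n)"
    by (metis subtopology_restrict)
  show "continuous_map (disc n) (carrier_top K) (charmap K e)" 
    and h: "homeomorphic_map (subtopology (disc n) (open_disc n)) (subtopology (carrier_top K) e) (charmap K e)"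
    and "charmap K e ` sphere_set n \<subseteq> (\<Union>m<n. \<Union>(cells K m))"
    using * eq by auto
  show sub: "e \<subseteq> topspace (carrier_top K)" using top assms(2) by blast
  show int: "charmap K e ` (open_disc n) = e"
    using homeomorphic_imp_surjective_map [OF h] sub by (simp add: Int_absorb1 Int_absorb2 Diff_subset)
  have "(\<lambda>i. 0) \<in> open_disc n" by (simp add: topspace_disc sphere_set_def)
  then show "e \<noteq> {}" using int by blast
qed

lemma cell_dim_unique:
  assumes "is_cell_complex K" "e \<in> cells K m" "e \<in> cells K n"
  shows "m = n"
  using cell_disjoint [OF assms] cell_nonempty [OF assms(1,2)] by simp

lemma all_cells_disjoint:
  assumes "is_cell_complex K" "e \<in> all_cells K" "e' \<in> all_cells K" "e \<inter> e' \<noteq> {}"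
  shows "e = e'"
  using assms(2-) cell_disjoint [OF assms(1)] unfolding all_cells_def by blast

lemma topspace_all_cells: "is_cell_complex K \<Longrightarrow> topspace (carrier_top K) = \<Union>(all_cells K)"
  unfolding all_cells_def using is_cell_complex_topspace [of K] by auto

lemma cell_disc_image:
  assumes "is_cell_complex K" "e \<in> cells K n"
  shows "charmap K e ` topspace (disc n) = e \<union> charmap K e ` sphere_set n"
  using cell_interior [OF assms] sphere_set_subset [of n] by blast

text \<open>Choose one point in every cell that meets the compact set \<open>A\<close>. A closed cell contains only finitely
  many chosen points, so by the weak topology every set of chosen points is closed. An infinite set
  of such points would therefore have no limit point in \<open>A\<close>.\<close>

lemma finite_cells_meeting_compact:
  assumes K: "is_cell_complex K" and cf: "closure_finite K" and A: "compactin (carrier_top K) A"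
  shows "finite {e \<in> all_cells K. e \<inter> A \<noteq> {}}"
proof (rule ccontr)
  let ?X = "carrier_top K"
  let ?M = "{e \<in> all_cells K. e \<inter> A \<noteq> {}}"
  assume inf: "infinite ?M"
  define p where "p = (\<lambda>e. SOME x. x \<in> e \<inter> A)"
  have p: "p e \<in> e \<inter> A" if "e \<in> ?M" for e
    unfolding p_def by (rule someI_ex) (use that in blast)
  have inj: "inj_on p ?M"
  proof (rule inj_onI)
    fix e f assume ef: "e \<in> ?M" "f \<in> ?M" "p e = p f"
    then have "e \<inter> f \<noteq> {}" using p [of e] p [of f] by auto
    then show "e = f" using all_cells_disjoint [OF K, of e f] ef by simp
  qed
  have HX: "Hausdorff_space ?X" by (rule is_cell_complex_Hausdorff [OF K])
  have top: "topspace ?X = \<Union>(all_cells K)" by (rule topspace_all_cells [OF K])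
  have AX: "A \<subseteq> topspace ?X" by (rule compactin_subset_topspace [OF A])
  have closed: "closedin ?X Q" if Q: "Q \<subseteq> p ` ?M" for Q
  proof -
    have QX: "Q \<subseteq> topspace ?X" using Q p AX by blast
    have "closedin (disc n) {x \<in> topspace (disc n). charmap K e x \<in> Q}" if e: "e \<in> cells K n" for n e
    proof -
      let ?C = "insert e {f \<in> all_cells K. f \<inter> charmap K e ` sphere_set n \<noteq> {}}"
      have finC: "finite ?C" using cf e by (simp add: closure_finite_def)
      have "Q \<inter> charmap K e ` topspace (disc n) \<subseteq> p ` ?C"
      proof
        fix y assume y: "y \<in> Q \<inter> charmap K e ` topspace (disc n)"
        then obtain f where f: "f \<in> ?M" "y = p f" using Q by blast
        then have yf: "y \<in> f" using p by blast
        have "y \<in> e \<or> y \<in> charmap K e ` sphere_set n"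
          using y cell_disc_image [OF K e] by blast
        moreover have "f = e" if "y \<in> e"
        proof -
          have "e \<in> all_cells K" using e by (auto simp: all_cells_def)
          then show ?thesis using all_cells_disjoint [OF K, of f e] f that yf by blast
        qed
        ultimately have "f \<in> ?C" using f yf by blast
        then show "y \<in> p ` ?C" using f by blast
      qed
      then have "finite (Q \<inter> charmap K e ` topspace (disc n))"
        using finC finite_subset by blast
      then have "closedin ?X (Q \<inter> charmap K e ` topspace (disc n))"
        using QX by (intro closedin_Hausdorff_finite [OF HX]) auto
      then have "closedin (disc n) {x \<in> topspace (disc n). charmap K e x \<in> Q \<inter> charmap K e ` topspace (disc n)}"
        by (rule closedin_continuous_map_preimage [OF cell_charmap [OF K e]])
      moreover have "{x \<in> topspace (disc n). charmap K e x \<in> Q \<inter> charmap K e ` topspace (disc n)}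
          = {x \<in> topspace (disc n). charmap K e x \<in> Q}" by blast
      ultimately show ?thesis by simp
    qed
    then show ?thesis by (rule is_cell_complex_closedin [OF K QX])
  qed
  have "infinite (p ` ?M)" using inf inj finite_image_iff by blast
  moreover have "p ` ?M \<subseteq> A" using p by blast
  ultimately have "A \<inter> ?X derived_set_of (p ` ?M) \<noteq> {}"
    using A compactin_imp_Bolzano_Weierstrass by blast
  then obtain x where x: "x \<in> A" "x \<in> ?X derived_set_of (p ` ?M)" by blast
  have "closedin ?X (p ` ?M - {x})" by (rule closed) blast
  then have "x \<in> topspace ?X - (p ` ?M - {x}) \<and> openin ?X (topspace ?X - (p ` ?M - {x}))"
    using x AX by blast
  from x(2) [unfolded in_derived_set_of, THEN conjunct2, rule_format, OF this]
  obtain y where "y \<noteq> x" "y \<in> p ` ?M" "y \<in> topspace ?X - (p ` ?M - {x})" by (elim exE conjE)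
  then show False by blast
qed

text \<open>The cell structure on the boundary sphere is finite by compactness, and the attaching map sends each
  of its cells onto a cell of the complex. Applied along the recursion that defines combinatorial
  complexes, this gives closure finiteness.\<close>

lemma closure_finite_if_attaching:
  assumes K: "is_cell_complex K"
    and att: "combinatorial_attaching (\<lambda>S. is_cell_complex S \<and> closure_finite S) K"
  shows "closure_finite K"
  unfolding closure_finite_def
proof (intro allI ballI)
  fix n e assume e: "e \<in> cells K n"
  let ?S = "sphere_set n"
  from att e obtain S :: "(nat \<Rightarrow> real) cell_complex" where S: "is_cell_complex S" "closure_finite S"
      "carrier_top S = subtopology (disc n) ?S" and comb: "combinatorial_map S K (charmap K e)"
    unfolding combinatorial_attaching_def by blast
  have topS: "topspace (carrier_top S) = ?S"
    using S(3) sphere_set_subset [of n] by auto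
  have "compactin (disc n) ?S"
    by (rule closedin_compact_space [OF compact_disc closedin_sphere_set])
  then have "compactin (carrier_top S) ?S"
    using S(3) by (simp add: compactin_subtopology)
  then have "finite {c \<in> all_cells S. c \<inter> ?S \<noteq> {}}"
    by (rule finite_cells_meeting_compact [OF S(1,2)])
  moreover have "c \<inter> ?S \<noteq> {}" if c: "c \<in> all_cells S" for c
  proof -
    obtain m where "c \<in> cells S m" using c by (auto simp: all_cells_def)
    then have "c \<noteq> {}" "c \<subseteq> ?S" using cell_nonempty [OF S(1)] cell_subset [OF S(1)] topS by auto
    then show ?thesis by blast
  qed
  ultimately have fin: "finite (all_cells S)" by (simp cong: conj_cong)
  have img: "charmap K e ` c \<in> all_cells K" if c: "c \<in> all_cells S" for c
  proof -
    obtain m where cm: "c \<in> cells S m" using c by (auto simp: all_cells_def)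
    then obtain k e' where e': "e' \<in> cells K k"
      and h: "homeomorphic_map (subtopology (carrier_top S) c) (subtopology (carrier_top K) e') (charmap K e)"
      using comb unfolding combinatorial_map_def by blast
    have "charmap K e ` c = e'"
      using homeomorphic_imp_surjective_map [OF h] cell_subset [OF S(1) cm] cell_subset [OF K e']
      by (simp add: Int_absorb1)
    then show ?thesis using e' by (auto simp: all_cells_def)
  qed
  have "{f \<in> all_cells K. f \<inter> charmap K e ` ?S \<noteq> {}} \<subseteq> (\<lambda>c. charmap K e ` c) ` all_cells S"
  proof
    fix f assume f: "f \<in> {f \<in> all_cells K. f \<inter> charmap K e ` ?S \<noteq> {}}"
    then obtain x where x: "x \<in> ?S" "charmap K e x \<in> f" by blast
    then obtain c where c: "c \<in> all_cells S" "x \<in> c" using topS topspace_all_cells [OF S(1)] by blast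
    then have ne: "charmap K e ` c \<inter> f \<noteq> {}" using x by blast
    have "f \<in> all_cells K" using f by simp
    then have "charmap K e ` c = f" by (rule all_cells_disjoint [OF K img [OF c(1)] _ ne])
    then show "f \<in> (\<lambda>c. charmap K e ` c) ` all_cells S" using c by blast
  qed
  then show "finite {f \<in> all_cells K. f \<inter> charmap K e ` ?S \<noteq> {}}"
    by (rule finite_surj [OF fin])
qed

lemma combinatorial_complex_real_closure_finite:
  "combinatorial_complex_real S \<Longrightarrow> is_cell_complex S \<and> closure_finite S"
proof (induction rule: combinatorial_complex_real.induct)
  case (1 K)
  have "combinatorial_attaching (\<lambda>S. is_cell_complex S \<and> closure_finite S) K"
    using 1(2) unfolding combinatorial_attaching_def by blast
  then show ?case using closure_finite_if_attaching 1(1) by blast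
qed

lemma combinatorial_complex_closure_finite:
  assumes "combinatorial_complex K"
  shows "is_cell_complex K" "closure_finite K"
proof -
  show 1: "is_cell_complex K" using assms by (simp add: combinatorial_complex_def)
  have "combinatorial_attaching (\<lambda>S. is_cell_complex S \<and> closure_finite S) K"
    using assms combinatorial_complex_real_closure_finite
    unfolding combinatorial_complex_def combinatorial_attaching_def by blast
  then show "closure_finite K" using closure_finite_if_attaching 1 by blast
qed

text \<open>Combinatorial complexes enter the homological arguments through closure finiteness and the weak
  topology, which make them CW complexes.\<close>

locale cw_complex =
  fixes K :: "('a, 'b) cell_complex_scheme"
  assumes cell_complex: "is_cell_complex K" and closure_finite: "closure_finite K"
begin

abbreviation "X \<equiv> carrier_top K"

text \<open>The inequality is strict, so that \<open>n = 0\<close> gives the empty skeleton of dimension \<open>-1\<close>, relative to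
  which vertices are attached.\<close>

definition cells_below :: "nat \<Rightarrow> 'a set set" where
  "cells_below n = (\<Union>m<n. cells K m)"

text \<open>Subcomplexes are handled as sets of cells, which makes it easy to remove a single cell.\<close>

definition closed_family :: "'a set set \<Rightarrow> bool" where
  "closed_family F \<longleftrightarrow> F \<subseteq> all_cells K \<and> (\<forall>n. \<forall>e\<in>F \<inter> cells K n. charmap K e ` sphere_set n \<subseteq> \<Union>F)"

lemmas charmap_continuous = cell_charmap [OF cell_complex]
  and charmap_homeomorphic = cell_homeomorphic [OF cell_complex]
  and charmap_sphere = cell_sphere [OF cell_complex]
  and cell_subset_X = cell_subset [OF cell_complex]
  and charmap_interior = cell_interior [OF cell_complex]
  and charmap_disc = cell_disc_image [OF cell_complex]
  and cell_not_empty = cell_nonempty [OF cell_complex]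
  and dim_unique = cell_dim_unique [OF cell_complex]
  and disjoint_cells = all_cells_disjoint [OF cell_complex]
  and topspace_X = topspace_all_cells [OF cell_complex]
  and finite_meeting = finite_cells_meeting_compact [OF cell_complex closure_finite]

lemma Hausdorff_X: "Hausdorff_space X"
  by (rule is_cell_complex_Hausdorff [OF cell_complex])

lemma cells_all_cells: "e \<in> cells K n \<Longrightarrow> e \<in> all_cells K"
  by (auto simp: all_cells_def)

lemma Union_family_Diff:
  assumes "F \<subseteq> all_cells K" "e \<in> all_cells K"
  shows "\<Union>(F - {e}) = \<Union>F - e"
proof -
  have "f \<inter> e = {}" if "f \<in> F" "f \<noteq> e" for f
    using that assms disjoint_cells [of f e] by (meson subsetD)
  then show ?thesis by blast
qed

lemma mem_family:
  assumes "F \<subseteq> all_cells K" "e \<in> all_cells K" "e \<inter> \<Union>F \<noteq> {}"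
  shows "e \<in> F"
proof -
  obtain f where f: "f \<in> F" "e \<inter> f \<noteq> {}" using assms(3) by blast
  then have "e = f" using assms disjoint_cells [of e f] by (meson subsetD)
  then show ?thesis using f by simp
qed

lemma closed_familyD: "closed_family F \<Longrightarrow> e \<in> F \<Longrightarrow> e \<in> cells K n \<Longrightarrow> charmap K e ` sphere_set n \<subseteq> \<Union>F"
  by (auto simp: closed_family_def)

lemma closed_family_subset: "closed_family F \<Longrightarrow> F \<subseteq> all_cells K"
  by (simp add: closed_family_def)

lemma closed_family_disc: "closed_family F \<Longrightarrow> e \<in> F \<Longrightarrow> e \<in> cells K n \<Longrightarrow> charmap K e ` topspace (disc n) \<subseteq> \<Union>F"
  using closed_familyD [of F e n] by (simp add: charmap_disc Union_upper)

text \<open>A closed cell meets finitely many cells. Those among them that belong to the family have compact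
  closures inside the union, and the finite union of these closures has the same preimage in the
  disc as the whole union.\<close>

lemma closedin_Union_closed_family:
  assumes F: "closed_family F"
  shows "closedin X (\<Union>F)"
proof -
  have FX: "\<Union>F \<subseteq> topspace X" using closed_family_subset [OF F] topspace_X by blast
  have "closedin (disc n) {x \<in> topspace (disc n). charmap K e x \<in> \<Union>F}" if e: "e \<in> cells K n" for n e
  proof -
    let ?I = "charmap K e ` topspace (disc n)"
    have cI: "compactin X ?I"
      using image_compactin [OF _ charmap_continuous [OF e]] compact_disc [of n] by (simp add: compact_space_def)
    define C where "C = {f \<in> all_cells K. f \<inter> ?I \<noteq> {}} \<inter> F"
    have finC: "finite C" unfolding C_def using finite_meeting [OF cI] by blast
    define B where "B = (\<Union>f\<in>C. charmap K f ` topspace (disc (SOME m. f \<in> cells K m)))"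
    have dim: "f \<in> cells K (SOME m. f \<in> cells K m)" if "f \<in> C" for f
    proof -
      have "\<exists>m. f \<in> cells K m" using that by (simp add: C_def all_cells_def)
      then show ?thesis by (rule someI_ex)
    qed
    have "closedin X (charmap K f ` topspace (disc (SOME m. f \<in> cells K m)))" if "f \<in> C" for f
      using compactin_imp_closedin [OF Hausdorff_X] image_compactin [OF _ charmap_continuous [OF dim [OF that]]]
        compact_disc by (simp add: compact_space_def)
    then have cB: "closedin X B" unfolding B_def using finC by (intro closedin_Union) auto
    have BF: "B \<subseteq> \<Union>F" unfolding B_def using closed_family_disc [OF F _ dim] by (auto simp: C_def)
    have IB: "?I \<inter> \<Union>F \<subseteq> B"
    proof
      fix y assume y: "y \<in> ?I \<inter> \<Union>F"
      then obtain f where f: "f \<in> F" "y \<in> f" by blast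
      then have fC: "f \<in> C" using y closed_family_subset [OF F] by (auto simp: C_def)
      then have "y \<in> charmap K f ` topspace (disc (SOME m. f \<in> cells K m))"
        using charmap_disc [OF dim [OF fC]] f by blast
      then show "y \<in> B" using fC by (auto simp: B_def)
    qed
    have "{x \<in> topspace (disc n). charmap K e x \<in> \<Union>F} = {x \<in> topspace (disc n). charmap K e x \<in> B}"
      using BF IB by blast
    then show ?thesis using closedin_continuous_map_preimage [OF charmap_continuous [OF e] cB] by simp
  qed
  then show ?thesis by (rule is_cell_complex_closedin [OF cell_complex FX])
qed

lemma closed_family_Union:
  assumes "\<And>F. F \<in> \<F> \<Longrightarrow> closed_family F" shows "closed_family (\<Union>\<F>)"
  using assms unfolding closed_family_def by fast

lemma closed_family_below:
  assumes "closed_family F" shows "closed_family (F \<inter> cells_below n)"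
  unfolding closed_family_def
proof (intro conjI allI ballI)
  show "F \<inter> cells_below n \<subseteq> all_cells K" using closed_family_subset [OF assms] by blast
  fix m e assume e: "e \<in> F \<inter> cells_below n \<inter> cells K m"
  then have mn: "m < n" using dim_unique by (auto simp: cells_below_def)
  have "charmap K e ` sphere_set m \<subseteq> \<Union>F" using closed_familyD [OF assms] e by blast
  moreover have "charmap K e ` sphere_set m \<subseteq> \<Union>(cells_below n)"
    using charmap_sphere [of e m] e mn unfolding cells_below_def by fastforce
  moreover have "y \<in> \<Union>(F \<inter> cells_below n)" if y: "y \<in> \<Union>F" "y \<in> \<Union>(cells_below n)" for y
  proof -
    obtain f g where fg: "f \<in> F" "y \<in> f" "g \<in> cells_below n" "y \<in> g" using y by blast
    then have "f = g" using disjoint_cells [of f g] closed_family_subset [OF assms]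
      by (auto simp: cells_below_def all_cells_def)
    then show ?thesis using fg by blast
  qed
  ultimately show "charmap K e ` sphere_set m \<subseteq> \<Union>(F \<inter> cells_below n)" by blast
qed

lemma closed_family_all_cells: "closed_family (all_cells K)"
  unfolding closed_family_def
proof (intro conjI allI ballI)
  fix n e assume "e \<in> all_cells K \<inter> cells K n"
  then show "charmap K e ` sphere_set n \<subseteq> \<Union>(all_cells K)"
    using charmap_sphere [of e n] by (auto simp: all_cells_def) blast
qed simp

lemma closed_family_cells_below: "closed_family (cells_below n)"
proof -
  have "all_cells K \<inter> cells_below n = cells_below n" by (auto simp: all_cells_def cells_below_def)
  then show ?thesis using closed_family_below [OF closed_family_all_cells, of n] by simp
qed

lemma skeleton_eq: "skeleton K n = \<Union>(cells_below (Suc n))"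
  unfolding skeleton_def cells_below_def lessThan_Suc_atMost by blast

text \<open>Boundary spheres of cells of dimension at most \<open>n\<close> lie in cells of dimension less than \<open>n\<close> and so
  avoid an \<open>n\<close>-cell.\<close>

lemma closed_family_remove_top:
  assumes F: "closed_family F" and e: "e \<in> cells K n" and top: "F \<subseteq> cells_below (Suc n)"
  shows "closed_family (F - {e})"
  unfolding closed_family_def
proof (intro conjI allI ballI)
  show "F - {e} \<subseteq> all_cells K" using closed_family_subset [OF F] by blast
  fix m f assume f: "f \<in> (F - {e}) \<inter> cells K m"
  then obtain k where "k < Suc n" "f \<in> cells K k" using top by (auto simp: cells_below_def)
  then have m: "m \<le> n" using dim_unique [of f k m] f by simp
  have "charmap K f ` sphere_set m \<inter> e = {}"
  proof (rule ccontr)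
    assume "charmap K f ` sphere_set m \<inter> e \<noteq> {}"
    then obtain y where y: "y \<in> charmap K f ` sphere_set m" "y \<in> e" by blast
    then obtain k g where "k < m" "g \<in> cells K k" "y \<in> g" using charmap_sphere [of f m] f by blast
    then show False using cell_disjoint [OF cell_complex, of e n g k] e y m by auto
  qed
  moreover have "charmap K f ` sphere_set m \<subseteq> \<Union>F" using closed_familyD [OF F] f by blast
  ultimately show "charmap K f ` sphere_set m \<subseteq> \<Union>(F - {e})"
    unfolding Union_family_Diff [OF closed_family_subset [OF F] cells_all_cells [OF e]]
    by (meson Diff_iff disjoint_iff subset_iff)
qed

lemma finite_closed_hull_cell: "e \<in> cells K n \<Longrightarrow> \<exists>F. finite F \<and> closed_family F \<and> e \<in> F"
proof (induction n arbitrary: e rule: less_induct)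
  case (less n)
  let ?C = "{f \<in> all_cells K. f \<inter> charmap K e ` sphere_set n \<noteq> {}}"
  have finC: "finite ?C" using closure_finite less.prems by (simp add: closure_finite_def)
  have ex: "\<exists>F. finite F \<and> closed_family F \<and> f \<in> F" if f: "f \<in> ?C" for f
  proof -
    obtain y where y: "y \<in> f" "y \<in> charmap K e ` sphere_set n" using f by blast
    then obtain m g where g: "m < n" "g \<in> cells K m" "y \<in> g" using charmap_sphere [OF less.prems] by blast
    then have "f = g" using disjoint_cells [of f g] f y cells_all_cells by blast
    then show ?thesis using less.IH g by blast
  qed
  define h where "h = (\<lambda>f. SOME F. finite F \<and> closed_family F \<and> f \<in> F)"
  have h: "finite (h f) \<and> closed_family (h f) \<and> f \<in> h f" if "f \<in> ?C" for f
    unfolding h_def by (rule someI_ex) (rule ex [OF that])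
  let ?U = "\<Union>(h ` ?C)"
  have cU: "closed_family ?U" using h by (intro closed_family_Union) blast
  have "charmap K e ` sphere_set n \<subseteq> \<Union>?U"
  proof
    fix y assume y: "y \<in> charmap K e ` sphere_set n"
    then obtain m g where g: "m < n" "g \<in> cells K m" "y \<in> g" using charmap_sphere [OF less.prems] by blast
    then have "g \<in> ?C" using y cells_all_cells by blast
    then show "y \<in> \<Union>?U" using h g by blast
  qed
  then have sub: "charmap K e ` sphere_set n \<subseteq> \<Union>(insert e ?U)" by auto
  have "closed_family (insert e ?U)"
    unfolding closed_family_def
  proof (intro conjI allI ballI)
    show "insert e ?U \<subseteq> all_cells K"
      using closed_family_subset [OF cU] cells_all_cells [OF less.prems] by simp
    fix m f assume f: "f \<in> insert e ?U \<inter> cells K m"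
    show "charmap K f ` sphere_set m \<subseteq> \<Union>(insert e ?U)"
    proof (cases "f = e")
      case True
      then have "m = n" using dim_unique [OF _ less.prems, of m] f by simp
      then show ?thesis using True sub by simp
    next
      case False
      then have "charmap K f ` sphere_set m \<subseteq> \<Union>?U" using closed_familyD [OF cU, of f m] f by simp
      then show ?thesis by auto
    qed
  qed
  moreover have "finite (insert e ?U)" using finC h by auto
  ultimately show ?case by blast
qed

lemma finite_closed_hull:
  assumes "finite E" "E \<subseteq> all_cells K"
  obtains F where "finite F" "closed_family F" "E \<subseteq> F"
proof -
  have "\<exists>F. finite F \<and> closed_family F \<and> e \<in> F" if "e \<in> E" for e
    using that assms(2) finite_closed_hull_cell unfolding all_cells_def by blast
  then obtain h where h: "\<And>e. e \<in> E \<Longrightarrow> finite (h e) \<and> closed_family (h e) \<and> e \<in> h e" by metis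
  show ?thesis
  proof (rule that)
    show "finite (\<Union>(h ` E))" using assms h by blast
    show "closed_family (\<Union>(h ` E))" using h by (intro closed_family_Union) blast
    show "E \<subseteq> \<Union>(h ` E)" using h by blast
  qed
qed

text \<open>The map \<open>f\<close> need not be the characteristic map of \<open>e\<close>; this is used for translates of characteristic
  maps.\<close>

lemma attaches_cell_family:
  assumes F: "closed_family F" "closed_family (F - {e})" "e \<in> F" "e \<in> cells K n"
    and f: "continuous_map (disc n) X f" "f ` sphere_set n \<subseteq> \<Union>F - e"
      "homeomorphic_map (subtopology (disc n) (open_disc n)) (subtopology X e) f"
  shows "attaches_cell n (subtopology X (\<Union>F)) (\<Union>F - e) f"
proof -
  have eF: "e \<subseteq> \<Union>F" using F by blast
  have FX: "\<Union>F \<subseteq> topspace X" using closed_family_subset [OF F(1)] topspace_X by blast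
  have fe: "f ` (open_disc n) = e"
    using homeomorphic_imp_surjective_map [OF f(3)] cell_subset_X [OF F(4)] by (simp add: Int_absorb1)
  have "f ` topspace (disc n) \<subseteq> \<Union>F" using fe f(2) eF by blast
  then have 1: "continuous_map (disc n) (subtopology X (\<Union>F)) f"
    using f(1) by (simp add: continuous_map_in_subtopology image_subset_iff_funcset)
  have "closedin X (\<Union>F - e)"
    using closedin_Union_closed_family [OF F(2)] Union_family_Diff [OF closed_family_subset [OF F(1)] cells_all_cells [OF F(4)]]
    by simp
  then have 2: "closedin (subtopology X (\<Union>F)) (\<Union>F - e)"
    by (rule closedin_subset_topspace) blast
  have "\<Union>F \<inter> (topspace (subtopology X (\<Union>F)) - (\<Union>F - e)) = e"
    using eF FX by auto
  then have "subtopology (subtopology X (\<Union>F)) (topspace (subtopology X (\<Union>F)) - (\<Union>F - e)) = subtopology X e"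
    by (simp add: subtopology_subtopology)
  then show ?thesis
    unfolding attaches_cell_def
    using 1 2 f Hausdorff_X by (simp add: Hausdorff_space_subtopology)
qed

lemma attaches_charmap:
  assumes F: "closed_family F" "closed_family (F - {e})" "e \<in> F" "e \<in> cells K n"
  shows "attaches_cell n (subtopology X (\<Union>F)) (\<Union>F - e) (charmap K e)"
proof (rule attaches_cell_family [OF F charmap_continuous [OF F(4)] _ charmap_homeomorphic [OF F(4)]])
  have sub: "charmap K e ` sphere_set n \<subseteq> \<Union>F" using closed_familyD [OF F(1,3,4)] .
  have disj: "charmap K e ` sphere_set n \<inter> e = {}"
  proof (rule ccontr)
    assume "charmap K e ` sphere_set n \<inter> e \<noteq> {}"
    then obtain y where y: "y \<in> charmap K e ` sphere_set n" "y \<in> e" by blast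
    then obtain k g where "k < n" "g \<in> cells K k" "y \<in> g" using charmap_sphere [OF F(4)] by blast
    then show False using cell_disjoint [OF cell_complex, of e n g k] F y by auto
  qed
  show "charmap K e ` sphere_set n \<subseteq> \<Union>F - e" using sub disj by (meson Diff_iff disjoint_iff subset_iff)
qed

end

section \<open>Homology of closed families of cells\<close>

lemma group_hom_hom_induced:
  "group_hom (relative_homology_group p X S) (relative_homology_group p Y T) (hom_induced p X S Y T f)"
  by (simp add: group_hom_def group_hom_axioms_def hom_induced_hom)

lemma group_hom_hom_boundary:
  "group_hom (relative_homology_group p X S) (homology_group (p - 1) (subtopology X S)) (hom_boundary p X S)"
  by (simp add: group_hom_def group_hom_axioms_def hom_boundary_hom)

lemma hom_induced_one: "hom_induced p X S Y T f \<one>\<^bsub>relative_homology_group p X S\<^esub> = \<one>\<^bsub>relative_homology_group p Y T\<^esub>"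
  by (rule group_hom.hom_one [OF group_hom_hom_induced])

lemma hom_boundary_one: "hom_boundary p X S \<one>\<^bsub>relative_homology_group p X S\<^esub> = \<one>\<^bsub>homology_group (p - 1) (subtopology X S)\<^esub>"
  by (rule group_hom.hom_one [OF group_hom_hom_boundary])

lemma trivial_groupD: "trivial_group G \<Longrightarrow> x \<in> carrier G \<Longrightarrow> x = \<one>\<^bsub>G\<^esub>"
  by (auto simp: trivial_group_def)

lemma iso_eq_oneD:
  assumes "group G" "group H" "h \<in> iso G H" "x \<in> carrier G" "h x = \<one>\<^bsub>H\<^esub>"
  shows "x = \<one>\<^bsub>G\<^esub>"
proof -
  interpret group_hom G H h
    using assms by (simp add: group_hom_def group_hom_axioms_def iso_def)
  have "inj_on h (carrier G)" using assms(3) by (simp add: iso_def bij_betw_def)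
  then show ?thesis using assms(4,5) by (metis G.one_closed hom_one inj_onD)
qed

lemma hom_induced_into_subset:
  assumes f: "continuous_map X Y f" "f ` topspace X \<subseteq> T" and S: "S \<subseteq> topspace X"
  shows "hom_induced p X S Y T f c = \<one>\<^bsub>relative_homology_group p Y T\<^esub>"
proof -
  let ?Z = "subtopology Y T"
  have cf: "continuous_map X ?Z f"
    using f by (simp add: continuous_map_in_subtopology image_subset_iff_funcset)
  have "topspace ?Z \<inter> T = topspace ?Z" by auto
  then have "trivial_group (relative_homology_group p ?Z T)"
    using trivial_relative_homology_group_topspace [of p ?Z] relative_homology_group_restrict [of p ?Z T] by metis
  then have "hom_induced p X S ?Z T f c = \<one>\<^bsub>relative_homology_group p ?Z T\<^esub>"
    using hom_induced_carrier by (rule trivial_groupD)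
  moreover have "hom_induced p ?Z T Y T id (hom_induced p X S ?Z T f c) = hom_induced p X S Y T (id \<circ> f) c"
    using f S cf by (intro hom_induced_compose') (auto simp: continuous_map_from_subtopology)
  ultimately show ?thesis using hom_induced_one [of p ?Z T Y T id] by simp
qed

lemma kernel_relativization:
  assumes "z \<in> carrier (homology_group p X)" "hom_induced p X {} X S id z = \<one>\<^bsub>relative_homology_group p X S\<^esub>"
  obtains y where "y \<in> carrier (homology_group p (subtopology X S))" "z = hom_induced p (subtopology X S) {} X {} id y"
proof -
  have "z \<in> kernel (homology_group p X) (relative_homology_group p X S) (hom_induced p X {} X S id)"
    using assms by (simp add: kernel_def)
  also have "\<dots> = hom_induced p (subtopology X S) {} X {} id ` carrier (homology_group p (subtopology X S))"
    using homology_exactness_axiom_3 [of p X S] by auto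
  finally show ?thesis using that by blast
qed

lemma kernel_inclusion:
  assumes "z \<in> carrier (homology_group (p - 1) (subtopology X S))"
    "hom_induced (p - 1) (subtopology X S) {} X {} id z = \<one>\<^bsub>homology_group (p - 1) X\<^esub>"
  obtains y where "y \<in> carrier (relative_homology_group p X S)" "z = hom_boundary p X S y"
proof -
  have "z \<in> kernel (homology_group (p - 1) (subtopology X S)) (homology_group (p - 1) X) (hom_induced (p - 1) (subtopology X S) {} X {} id)"
    using assms by (simp add: kernel_def)
  also have "\<dots> = hom_boundary p X S ` carrier (relative_homology_group p X S)"
    using homology_exactness_axiom_2 [of p X S] by auto
  finally show ?thesis using that by blast
qed

lemma kernel_hom_boundary:
  assumes "z \<in> carrier (relative_homology_group p X S)"
    "hom_boundary p X S z = \<one>\<^bsub>homology_group (p - 1) (subtopology X S)\<^esub>"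
  obtains y where "y \<in> carrier (homology_group p X)" "z = hom_induced p X {} X S id y"
proof -
  have "z \<in> kernel (relative_homology_group p X S) (homology_group (p - 1) (subtopology X S)) (hom_boundary p X S)"
    using assms by (simp add: kernel_def)
  also have "\<dots> = hom_induced p X {} X S id ` carrier (homology_group p X)"
    using homology_exactness_axiom_1 [of p X S] by auto
  finally show ?thesis using that by blast
qed

lemma continuous_map_id_subtopologies:
  "A \<subseteq> B \<Longrightarrow> continuous_map (subtopology X A) (subtopology X B) id"
  by (auto simp: continuous_map_in_subtopology continuous_map_from_subtopology)

text \<open>A singular chain bounding a representative of \<open>z\<close> consists of finitely many simplices, and \<open>C\<close> is the
  union of their images.\<close>

lemma compact_support_of_null_homology:
  assumes z: "z \<in> carrier (homology_group (int d) (subtopology X A))"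
    and null: "hom_induced (int d) (subtopology X A) {} X {} id z = \<one>\<^bsub>homology_group (int d) X\<^esub>"
  obtains C where "compactin X C"
    "\<And>B. A \<subseteq> B \<Longrightarrow> C \<subseteq> B \<Longrightarrow> hom_induced (int d) (subtopology X A) {} (subtopology X B) {} id z
         = \<one>\<^bsub>homology_group (int d) (subtopology X B)\<^esub>"
proof -
  obtain c where c: "singular_relcycle d (subtopology X A) {} c" and zc: "z = homologous_rel_set d (subtopology X A) {} c"
    using z by (auto simp: carrier_relative_homology_group)
  have cA: "singular_chain d (subtopology X A) c" using c by (simp add: singular_cycle)
  then have cid: "chain_map d id c = c" by (rule chain_map_ident)
  have map: "hom_induced (int d) (subtopology X A) {} Y {} id z = homologous_rel_set d Y {} c"
    if "continuous_map (subtopology X A) Y id" for Y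
    using hom_induced_chain_map [OF that _ c, of "{}"] zc cid by simp
  have "homologous_rel_set d X {} c = singular_relboundary_set d X {}"
    using null map [of X] by (simp add: continuous_map_from_subtopology)
  then have "singular_relboundary d X {} c" using homologous_rel_set_eq_relboundary by blast
  then obtain b where b: "singular_chain (Suc d) X b" "chain_boundary (Suc d) b = c"
    by (auto simp: singular_boundary)
  define C where "C = (\<Union>f\<in>supp b. f ` standard_simplex (Suc d))"
  have "compactin X (f ` standard_simplex (Suc d))" if f: "f \<in> supp b" for f
  proof -
    have "singular_simplex (Suc d) X f" using b(1) f by (auto simp: singular_chain_def)
    then have "continuous_map (subtopology (powertop_real UNIV) (standard_simplex (Suc d))) X f"
      by (simp add: singular_simplex_def)
    moreover have "compactin (subtopology (powertop_real UNIV) (standard_simplex (Suc d))) (standard_simplex (Suc d))"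
      by (simp add: compactin_subtopology compactin_standard_simplex)
    ultimately show ?thesis by (meson image_compactin)
  qed
  then have cC: "compactin X C" unfolding C_def by (intro compactin_Union) auto
  show ?thesis
  proof (rule that [OF cC])
    fix B assume B: "A \<subseteq> B" "C \<subseteq> B"
    have "singular_chain (Suc d) (subtopology X B) b"
      using b(1) B(2) by (auto simp: singular_chain_subtopology C_def)
    then have "singular_relboundary d (subtopology X B) {} c"
      using b(2) by (auto simp: singular_boundary)
    then have "homologous_rel_set d (subtopology X B) {} c = singular_relboundary_set d (subtopology X B) {}"
      using homologous_rel_set_eq_relboundary by blast
    moreover have "continuous_map (subtopology X A) (subtopology X B) id"
      by (rule continuous_map_id_subtopologies [OF B(1)])
    ultimately show "hom_induced (int d) (subtopology X A) {} (subtopology X B) {} id z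
         = \<one>\<^bsub>homology_group (int d) (subtopology X B)\<^esub>"
      using map by simp
  qed
qed

context cw_complex
begin

abbreviation family_space :: "'a set set \<Rightarrow> 'a topology" where
  "family_space F \<equiv> subtopology X (\<Union>F)"

lemma continuous_inclusion: "\<Union>F \<subseteq> \<Union>F' \<Longrightarrow> continuous_map (family_space F) (family_space F') id"
  by (rule continuous_map_id_subtopologies)

lemma family_space_remove:
  assumes "closed_family F" "e \<in> cells K n"
  shows "subtopology (family_space F) (\<Union>F - e) = family_space (F - {e})"
  using Union_family_Diff [OF closed_family_subset [OF assms(1)] cells_all_cells [OF assms(2)]]
  by (simp add: subtopology_subtopology Int_absorb1 Diff_subset)

lemma iso_charmap:
  assumes "closed_family F" "closed_family (F - {e})" "e \<in> F" "e \<in> cells K n"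
  shows "hom_induced p (disc n) (sphere_set n) (family_space F) (\<Union>F - e) (charmap K e)
    \<in> iso (relative_homology_group p (disc n) (sphere_set n)) (relative_homology_group p (family_space F) (\<Union>F - e))"
  by (rule iso_hom_induced_attaches_cell [OF attaches_charmap [OF assms]])

lemma charmap_into_family:
  assumes "closed_family F" "e \<in> F" "e \<in> cells K n"
  shows "continuous_map (disc n) (family_space F) (charmap K e)"
  using charmap_continuous [OF assms(3)] closed_family_disc [OF assms]
  by (simp add: continuous_map_in_subtopology image_subset_iff_funcset)

lemma trivial_family_homology_off_dimension:
  assumes "closed_family F" "closed_family (F - {e})" "e \<in> F" "e \<in> cells K n" "p \<noteq> int n"
  shows "trivial_group (relative_homology_group p (family_space F) (\<Union>F - e))"
  using iso_charmap [OF assms(1-4), of p] trivial_group_disc_homology [OF assms(5)]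
    isomorphic_group_triviality1 group_relative_homology_group unfolding is_iso_def by blast

lemma top_cell_exists:
  assumes "finite F" "F \<subseteq> all_cells K" "F \<noteq> {}"
  obtains e n where "e \<in> F" "e \<in> cells K n" "F \<subseteq> cells_below (Suc n)"
proof -
  define dm where "dm = (\<lambda>e. SOME n. e \<in> cells K n)"
  have dm: "e \<in> cells K (dm e)" if "e \<in> F" for e
  proof -
    have "\<exists>n. e \<in> cells K n" using that assms(2) by (auto simp: all_cells_def)
    then show ?thesis unfolding dm_def by (rule someI_ex)
  qed
  have "Max (dm ` F) \<in> dm ` F" using assms by (intro Max_in) auto
  then obtain e where e: "e \<in> F" "dm e = Max (dm ` F)" by auto
  have "F \<subseteq> cells_below (Suc (dm e))"
  proof
    fix f assume f: "f \<in> F"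
    then have "dm f \<le> dm e" using e(2) assms(1) by simp
    then show "f \<in> cells_below (Suc (dm e))" using dm [OF f] by (auto simp: cells_below_def)
  qed
  then show ?thesis using that e(1) dm by blast
qed

lemma closed_family_induct [consumes 2, case_names empty remove]:
  assumes "finite F" "closed_family F"
    and "P {}"
    and "\<And>F e n. finite F \<Longrightarrow> closed_family F \<Longrightarrow> e \<in> F \<Longrightarrow> e \<in> cells K n \<Longrightarrow> F \<subseteq> cells_below (Suc n)
           \<Longrightarrow> closed_family (F - {e}) \<Longrightarrow> P (F - {e}) \<Longrightarrow> P F"
  shows "P F"
  using assms(1,2)
proof (induction "card F" arbitrary: F rule: less_induct)
  case less
  show ?case
  proof (cases "F = {}")
    case False
    then obtain e n where e: "e \<in> F" "e \<in> cells K n" "F \<subseteq> cells_below (Suc n)"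
      using top_cell_exists [OF less.prems(1) closed_family_subset [OF less.prems(2)]] by blast
    have cl: "closed_family (F - {e})" by (rule closed_family_remove_top [OF less.prems(2) e(2,3)])
    have "P (F - {e})"
      using less.hyps [OF _ _ cl] less.prems(1) card_Diff1_less [OF less.prems(1) e(1)] by simp
    then show ?thesis using assms(4) [OF less.prems e cl] by blast
  qed (use assms(3) in simp)
qed

lemma cells_below_dim: "e \<in> cells K m \<Longrightarrow> e \<in> cells_below n \<longleftrightarrow> m < n"
proof (rule iffI)
  assume e: "e \<in> cells K m" and "e \<in> cells_below n"
  then obtain k where "k < n" "e \<in> cells K k" by (auto simp: cells_below_def)
  then show "m < n" using dim_unique [OF e] by simp
qed (auto simp: cells_below_def)

lemma cells_below_disjoint:
  assumes "f \<in> cells K n" "F \<subseteq> cells_below n"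
  shows "\<Union>F \<inter> f = {}"
proof (rule ccontr)
  assume "\<Union>F \<inter> f \<noteq> {}"
  then obtain x g where g: "g \<in> cells_below n" "x \<in> g" "x \<in> f" using assms(2) by blast
  then obtain k where "k < n" "g \<in> cells K k" by (auto simp: cells_below_def)
  then show False using cell_disjoint [OF cell_complex, of g k f n] assms(1) g by auto
qed

lemma sphere_subset_below:
  assumes F: "closed_family F" and e: "e \<in> F" "e \<in> cells K n"
  shows "charmap K e ` sphere_set n \<subseteq> \<Union>(F \<inter> cells_below n)"
proof
  fix x assume x: "x \<in> charmap K e ` sphere_set n"
  then obtain k g where kg: "k < n" "g \<in> cells K k" "x \<in> g" using charmap_sphere [OF e(2)] by blast
  have "x \<in> \<Union>F" using x closed_familyD [OF F e] by blast
  then have "g \<in> F" using mem_family [OF closed_family_subset [OF F] cells_all_cells [OF kg(2)]] kg(3) by blast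
  then show "x \<in> \<Union>(F \<inter> cells_below n)" using kg cells_below_dim [OF kg(2), of n] by blast
qed

text \<open>Induction on the number of cells with the exact sequence of the pair obtained by removing a top cell
  of dimension \<open>m < n \<le> p\<close>: its relative group is that of an \<open>m\<close>-disc modulo its boundary and vanishes
  in degree \<open>p\<close>.\<close>

lemma trivial_homology_low_dimension:
  assumes "finite F" "closed_family F" "F \<subseteq> cells_below n" "int n \<le> p"
  shows "trivial_group (homology_group p (family_space F))"
  using assms
proof (induction rule: closed_family_induct)
  case empty
  then show ?case by (intro trivial_homology_group_empty) simp
next
  case (remove F e m)
  let ?S = "\<Union>F - e"
  have "m < n" using cells_below_dim [OF remove(4)] subsetD [OF remove.prems(1) remove(3)] by simp
  then have rel: "trivial_group (relative_homology_group p (family_space F) ?S)"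
    using trivial_family_homology_off_dimension [OF remove(2,6,3,4), of p] remove.prems by simp
  have IH: "trivial_group (homology_group p (family_space (F - {e})))"
    using remove.IH remove.prems by blast
  have "z = \<one>\<^bsub>homology_group p (family_space F)\<^esub>" if z: "z \<in> carrier (homology_group p (family_space F))" for z
  proof -
    have "hom_induced p (family_space F) {} (family_space F) ?S id z = \<one>\<^bsub>relative_homology_group p (family_space F) ?S\<^esub>"
      by (rule trivial_groupD [OF rel hom_induced_carrier])
    with z obtain y where y: "y \<in> carrier (homology_group p (family_space (F - {e})))"
        "z = hom_induced p (family_space (F - {e})) {} (family_space F) {} id y"
      using kernel_relativization [of z p "family_space F" ?S] unfolding family_space_remove [OF remove(2,4)] by blast
    then show ?thesis using trivial_groupD [OF IH] hom_induced_one by metis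
  qed
  then show ?case
    using group.trivial_group_subset [OF group_relative_homology_group] by blast
qed

abbreviation skeleton_space :: "nat \<Rightarrow> 'a topology" where
  "skeleton_space n \<equiv> subtopology X (skeleton K n)"

lemma skeleton_closed_families:
  assumes "f \<in> cells K n"
  shows "closed_family (cells_below (Suc n))" "closed_family (cells_below (Suc n) - {f})" "f \<in> cells_below (Suc n)"
  using assms closed_family_cells_below closed_family_remove_top [of "cells_below (Suc n)" f n]
  by (auto simp: cells_below_dim)

lemma iso_charmap_skeleton:
  assumes "f \<in> cells K n"
  shows "hom_induced p (disc n) (sphere_set n) (skeleton_space n) (skeleton K n - f) (charmap K f)
    \<in> iso (relative_homology_group p (disc n) (sphere_set n)) (relative_homology_group p (skeleton_space n) (skeleton K n - f))"
  using iso_charmap [OF skeleton_closed_families [OF assms] assms] by (simp add: skeleton_eq)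

lemma free_generator_cell_class:
  assumes "f \<in> cells K n"
  shows "free_generator (local_homology_group K n f) (cell_class K n f)"
  unfolding cell_class_def
  using free_generator_iso [OF _ _ free_generator_disc_class iso_charmap_skeleton [OF assms]] by simp

lemma Union_subset_skeleton: "F \<subseteq> cells_below (Suc n) \<Longrightarrow> \<Union>F \<subseteq> skeleton K n"
  by (auto simp: skeleton_eq)

lemma continuous_inclusion_skeleton: "F \<subseteq> cells_below (Suc n) \<Longrightarrow> continuous_map (family_space F) (skeleton_space n) id"
  unfolding skeleton_eq by (rule continuous_inclusion) blast

text \<open>Both groups are identified with the homology of the disc modulo its sphere by the same
  characteristic map.\<close>

lemma iso_local_inclusion:
  assumes F: "closed_family F" "F \<subseteq> cells_below (Suc n)" "f \<in> F" "f \<in> cells K n"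
  shows "hom_induced p (family_space F) (\<Union>F - f) (skeleton_space n) (skeleton K n - f) id
    \<in> iso (relative_homology_group p (family_space F) (\<Union>F - f)) (relative_homology_group p (skeleton_space n) (skeleton K n - f))"
proof -
  have att: "attaches_cell n (family_space F) (\<Union>F - f) (charmap K f)"
    by (rule attaches_charmap [OF F(1) closed_family_remove_top [OF F(1,4,2)] F(3,4)])
  show ?thesis
  proof (rule iso_cancel_right [OF hom_induced_hom iso_hom_induced_attaches_cell [OF att] iso_charmap_skeleton [OF F(4)]])
    fix x
    have 1: "continuous_map (disc n) (family_space F) (charmap K f)"
      and img: "charmap K f ` sphere_set n \<subseteq> \<Union>F - f"
      using att by (simp_all add: attaches_cell_def)
    have 2: "charmap K f \<in> sphere_set n \<rightarrow> \<Union>F - f"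
      by (rule image_subset_iff_funcset [THEN iffD1, OF img])
    have 3: "id \<in> \<Union>F - f \<rightarrow> skeleton K n - f"
    proof (rule Pi_I)
      fix x assume "x \<in> \<Union>F - f"
      then show "id x \<in> skeleton K n - f"
        using subsetD [OF Union_subset_skeleton [OF F(2)], of x] by simp
    qed
    have "hom_induced p (family_space F) (\<Union>F - f) (skeleton_space n) (skeleton K n - f) id
       (hom_induced p (disc n) (sphere_set n) (family_space F) (\<Union>F - f) (charmap K f) x)
       = hom_induced p (disc n) (sphere_set n) (skeleton_space n) (skeleton K n - f) (id \<circ> charmap K f) x"
      by (rule hom_induced_compose' [OF 1 2 continuous_inclusion_skeleton [OF F(2)] 3])
    then show "hom_induced p (family_space F) (\<Union>F - f) (skeleton_space n) (skeleton K n - f) id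
       (hom_induced p (disc n) (sphere_set n) (family_space F) (\<Union>F - f) (charmap K f) x)
       = hom_induced p (disc n) (sphere_set n) (skeleton_space n) (skeleton K n - f) (charmap K f) x" by simp
  qed
qed

abbreviation local_map :: "nat \<Rightarrow> 'a set set \<Rightarrow> 'a set \<Rightarrow> 'a set \<Rightarrow> 'a chain set \<Rightarrow> 'a chain set" where
  "local_map n F T f \<equiv> hom_induced (int n) (family_space F) T (skeleton_space n) (skeleton K n - f) id"

abbreviation inclusion_map :: "int \<Rightarrow> 'a set set \<Rightarrow> 'a set set \<Rightarrow> 'a chain set \<Rightarrow> 'a chain set" where
  "inclusion_map p F F' \<equiv> hom_induced p (family_space F) {} (family_space F') {} id"

abbreviation family_homology :: "int \<Rightarrow> 'a set set \<Rightarrow> 'a chain set monoid" where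
  "family_homology p F \<equiv> homology_group p (family_space F)"

text \<open>This replaces the injectivity of \<open>H\<^sub>n(X\<^sup>n) \<rightarrow> H\<^sub>n(X\<^sup>n, X\<^sup>n\<^sup>-\<^sup>1)\<close> together with the splitting of the target
  over the \<open>n\<close>-cells. Vanishing at one \<open>n\<close>-cell \<open>e\<close> lets the class be pulled back to the family without
  \<open>e\<close>; its local images there are the same, so induction applies until no \<open>n\<close>-cell is left.\<close>

lemma top_homology_detected_locally:
  assumes "finite F" "closed_family F" "F \<subseteq> cells_below (Suc n)"
    and "z \<in> carrier (family_homology (int n) F)"
    and "\<And>f. f \<in> F \<Longrightarrow> f \<in> cells K n \<Longrightarrow>
      local_map n F {} f z = \<one>\<^bsub>local_homology_group K n f\<^esub>"
  shows "z = \<one>\<^bsub>family_homology (int n) F\<^esub>"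
  using assms
proof (induction arbitrary: z rule: closed_family_induct)
  case empty
  have "trivial_group (family_homology (int n) {})"
    by (intro trivial_homology_group_empty) simp
  then show ?case using empty(2) by (rule trivial_groupD)
next
  case (remove F e m)
  let ?S = "\<Union>F - e" and ?p = "int n"
  have m: "m < Suc n" using cells_below_dim [OF remove(4)] subsetD [OF remove.prems(1) remove(3)] by simp
  show ?case
  proof (cases "m = n")
    case False
    have "F \<subseteq> cells_below n"
      using remove(5) False m by (fastforce simp: cells_below_def)
    then have "trivial_group (family_homology (int n) F)"
      using trivial_homology_low_dimension [OF remove(1,2), of n "int n"] by simp
    then show ?thesis using remove.prems(2) by (rule trivial_groupD)
  next
    case True
    have e: "e \<in> cells K n" using True remove(4) by simp
    let ?w = "hom_induced ?p (family_space F) {} (family_space F) ?S id z"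
    let ?i = "hom_induced ?p (family_space F) ?S (skeleton_space n) (skeleton K n - e) id"
    have iso: "?i \<in> iso (relative_homology_group ?p (family_space F) ?S) (local_homology_group K n e)"
      by (rule iso_local_inclusion [OF remove(2) remove.prems(1) remove(3) e])
    have "?i ?w = hom_induced ?p (family_space F) {} (skeleton_space n) (skeleton K n - e) (id \<circ> id) z"
      using Union_subset_skeleton [OF remove.prems(1)] continuous_inclusion_skeleton [OF remove.prems(1)]
      by (intro hom_induced_compose') auto
    then have "?i ?w = \<one>\<^bsub>local_homology_group K n e\<^esub>"
      using remove.prems(3) [OF remove(3) e] by simp
    then have "?w = \<one>\<^bsub>relative_homology_group ?p (family_space F) ?S\<^esub>"
      by (rule iso_eq_oneD [OF group_relative_homology_group group_relative_homology_group iso hom_induced_carrier])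
    with remove.prems(2) obtain y where y: "y \<in> carrier (family_homology ?p (F - {e}))"
        "z = hom_induced ?p (family_space (F - {e})) {} (family_space F) {} id y"
      using kernel_relativization [of z ?p "family_space F" ?S] unfolding family_space_remove [OF remove(2,4)] by blast
    have "y = \<one>\<^bsub>family_homology ?p (F - {e})\<^esub>"
    proof (rule remove.IH [OF _ y(1)])
      show "F - {e} \<subseteq> cells_below (Suc n)" using remove.prems(1) by blast
      fix f assume f: "f \<in> F - {e}" "f \<in> cells K n"
      have "hom_induced ?p (family_space F) {} (skeleton_space n) (skeleton K n - f) id z
        = hom_induced ?p (family_space (F - {e})) {} (skeleton_space n) (skeleton K n - f) (id \<circ> id) y"
        unfolding y(2) using continuous_inclusion_skeleton [OF remove.prems(1)]
        by (intro hom_induced_compose' continuous_inclusion) auto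
      then have eq: "hom_induced ?p (family_space (F - {e})) {} (skeleton_space n) (skeleton K n - f) id y
        = hom_induced ?p (family_space F) {} (skeleton_space n) (skeleton K n - f) id z"
        by (simp only: comp_id)
      show "hom_induced ?p (family_space (F - {e})) {} (skeleton_space n) (skeleton K n - f) id y = \<one>\<^bsub>local_homology_group K n f\<^esub>"
        unfolding eq by (rule remove.prems(3)) (use f in auto)
    qed
    then show ?thesis using y(2) hom_induced_one by metis
  qed
qed

end

section \<open>Cellular cycles in an acyclic complex are cellular boundaries\<close>

text \<open>The image of the fundamental class of the sphere under the attaching map of the \<open>(n+1)\<close>-cell \<open>e\<close>.\<close>

definition attaching_class :: "('a, 'b) cell_complex_scheme \<Rightarrow> nat \<Rightarrow> 'a topology \<Rightarrow> 'a set \<Rightarrow> 'a set \<Rightarrow> 'a chain set" where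
  "attaching_class K n Y T e =
     hom_induced (int n) (sphere_space n) {} Y T (charmap K e)
       (sphere_class n)"

lemma attaching_class_carrier: "attaching_class K n Y T e \<in> carrier (relative_homology_group (int n) Y T)"
  unfolding attaching_class_def by (rule hom_induced_carrier)

lemma hom_induced_attaching_class:
  assumes "continuous_map (sphere_space n) Y (charmap K e)"
    and "continuous_map Y Y' id" "T \<subseteq> T'" "T = {}"
  shows "hom_induced (int n) Y T Y' T' id (attaching_class K n Y T e) = attaching_class K n Y' T' e"
proof -
  have "hom_induced (int n) Y T Y' T' id (hom_induced (int n) (sphere_space n) {} Y T (charmap K e) x)
    = hom_induced (int n) (sphere_space n) {} Y' T' (id \<circ> charmap K e) x" for x
    using assms by (intro hom_induced_compose') auto
  then show ?thesis unfolding attaching_class_def by simp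
qed

lemma hom_boundary_attaching_class:
  assumes "continuous_map (disc (Suc n)) Y (charmap K e)" "charmap K e ` sphere_set (Suc n) \<subseteq> S"
  shows "hom_boundary (int (Suc n)) Y S (disc_map (Suc n) Y S (charmap K e) (disc_class (Suc n)))
    = attaching_class K n (subtopology Y S) {} e"
proof -
  have "charmap K e \<in> sphere_set (Suc n) \<rightarrow> S" by (rule image_subset_iff_funcset [THEN iffD1, OF assms(2)])
  from fun_cong [OF naturality_hom_induced [OF assms(1) this, of "int (Suc n)"], of "disc_class (Suc n)"]
  show ?thesis unfolding attaching_class_def by simp
qed

text \<open>A choice operator takes the place of finite products in the multiplicatively written homology groups;
  the universal property of free Abelian groups makes the choice possible.\<close>

definition linear_extension :: "'c set \<Rightarrow> ('d, 'm) monoid_scheme \<Rightarrow> ('c \<Rightarrow> 'd) \<Rightarrow> ('c \<Rightarrow>\<^sub>0 int) \<Rightarrow> 'd" where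
  "linear_extension S H b = (SOME h. h \<in> hom (free_Abelian_group S) H \<and> (\<forall>x\<in>S. h (frag_of x) = b x))"

lemma linear_extension:
  assumes "comm_group H" "b ` S \<subseteq> carrier H"
  shows "linear_extension S H b \<in> hom (free_Abelian_group S) H"
    and "x \<in> S \<Longrightarrow> linear_extension S H b (frag_of x) = b x"
proof -
  obtain h where "h \<in> hom (free_Abelian_group S) H" "\<And>x. x \<in> S \<Longrightarrow> h (frag_of x) = b x"
    using comm_group.free_Abelian_group_universal [OF assms] by blast
  then have "\<exists>h. h \<in> hom (free_Abelian_group S) H \<and> (\<forall>x\<in>S. h (frag_of x) = b x)" by blast
  then have *: "linear_extension S H b \<in> hom (free_Abelian_group S) H \<and> (\<forall>x\<in>S. linear_extension S H b (frag_of x) = b x)"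
    unfolding linear_extension_def by (rule someI_ex)
  show "linear_extension S H b \<in> hom (free_Abelian_group S) H" using * by blast
  show "x \<in> S \<Longrightarrow> linear_extension S H b (frag_of x) = b x" using * by blast
qed

lemma hom_power_additive:
  assumes "group H" "a \<in> carrier H" "\<And>x y. l (x + y) = l x + (l y :: int)"
  shows "(\<lambda>c. a [^]\<^bsub>H\<^esub> l c) \<in> hom (free_Abelian_group S) H"
proof -
  interpret group H by fact
  show ?thesis using assms by (auto simp: hom_def int_pow_mult)
qed

lemma hom_compose_apply:
  assumes "h \<in> hom G H" "i \<in> hom H I"
  shows "(\<lambda>c. i (h c)) \<in> hom G I"
  using hom_compose [OF assms] by (simp add: comp_def)

lemma hom_free_cmul:
  assumes "group H" "h \<in> hom (free_Abelian_group S) H" "x \<in> S"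
  shows "h (frag_cmul k (frag_of x)) = h (frag_of x) [^]\<^bsub>H\<^esub> (k::int)"
proof -
  interpret group_hom "free_Abelian_group S" H h
    using assms by (simp add: group_hom_def group_hom_axioms_def)
  show ?thesis
    using hom_int_pow [of "frag_of x" k] assms(3) by simp
qed

context cw_complex
begin

lemma charmap_sphere_into_family:
  assumes "closed_family F" "charmap K e ` sphere_set (Suc n) \<subseteq> \<Union>F" "e \<in> cells K (Suc n)"
  shows "continuous_map (sphere_space n) (family_space F) (charmap K e)"
  using charmap_continuous [OF assms(3)] assms(2) sphere_set_subset [of "Suc n"]
  by (simp add: continuous_map_in_subtopology continuous_map_from_subtopology flip: image_subset_iff_funcset) blast

text \<open>Remove the cells of \<open>F' - F\<close> one by one from the top. Removing a cell of dimension above \<open>d + 1\<close> does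
  not affect the vanishing of \<open>z\<close>. Removing a \<open>(d+1)\<close>-cell \<open>e\<close> may turn the image of \<open>z\<close> into the
  boundary of a relative class, that is, into a multiple of the attaching class of \<open>e\<close>; subtracting
  this multiple from \<open>z\<close> restores the hypothesis for the smaller family.\<close>

lemma boundary_expresses_null_homologous_cycles:
  assumes "finite F'" "closed_family F'" "F = F' \<inter> cells_below (Suc d)"
    and "z \<in> carrier (family_homology (int d) F)"
    and "inclusion_map (int d) F F' z = \<one>\<^bsub>family_homology (int d) F'\<^esub>"
    and h: "h \<in> hom (free_Abelian_group S) (family_homology (int d) F)"
    and "\<And>e. e \<in> F' \<Longrightarrow> e \<in> cells K (Suc d) \<Longrightarrow> e \<in> S \<and> h (frag_of e) = attaching_class K d (family_space F) {} e"
  shows "\<exists>c. supp c \<subseteq> F' \<inter> cells K (Suc d) \<and> h c = z"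
  using assms(1-5,7)
proof (induction arbitrary: z rule: closed_family_induct)
  case empty
  have "trivial_group (family_homology (int d) F)"
    using empty(1) by (intro trivial_homology_group_empty) simp
  then have "z = \<one>\<^bsub>family_homology (int d) F\<^esub>"
    using empty(2) by (rule trivial_groupD)
  moreover have "h 0 = \<one>\<^bsub>family_homology (int d) F\<^esub>"
    using group_hom.hom_one [of "free_Abelian_group S" "family_homology (int d) F" h] h
    by (simp add: group_hom_def group_hom_axioms_def)
  ultimately have "z = h 0" by simp
  then show ?case by (intro exI [of _ 0]) simp
next
  case (remove F' e m)
  let ?H = "family_homology (int d) F"
  let ?G = "F' - {e}"
  interpret h: group_hom "free_Abelian_group S" ?H h
    using h by (simp add: group_hom_def group_hom_axioms_def)
  show ?case
  proof (cases "m \<le> d")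
    case True
    then have "F' \<subseteq> cells_below (Suc d)" using remove(5) by (fastforce simp: cells_below_def)
    then have FF: "F = F'" using remove.prems(1) by blast
    have "z = \<one>\<^bsub>?H\<^esub>"
      using remove.prems(3) [folded FF] hom_induced_id [OF remove.prems(2)] by argo
    moreover have "h 0 = \<one>\<^bsub>?H\<^esub>" using h.hom_one by (simp only: one_free_Abelian_group)
    ultimately have "z = h 0" by (simp only:)
    then show ?thesis by (intro exI [of _ 0]) simp
  next
    case False
    have "e \<notin> cells_below (Suc d)" using cells_below_dim [OF remove(4), of "Suc d"] False by simp
    then have FG: "F = ?G \<inter> cells_below (Suc d)" using remove.prems(1) by blast
    then have sFG: "\<Union>F \<subseteq> \<Union>?G" by blast
    have clF: "closed_family F" unfolding FG by (rule closed_family_below [OF remove(6)])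
    let ?i = "inclusion_map (int d) F ?G"
    interpret i: group_hom ?H "family_homology (int d) ?G" ?i
      by (rule group_hom_hom_induced)
    have "inclusion_map (int d) ?G F' (?i z)
        = hom_induced (int d) (family_space F) {} (family_space F') {} (id \<circ> id) z"
      by (intro hom_induced_compose' continuous_inclusion sFG) auto
    then have null: "hom_induced (int (Suc d) - 1) (subtopology (family_space F') (\<Union>F' - e)) {} (family_space F') {} id (?i z)
        = \<one>\<^bsub>homology_group (int (Suc d) - 1) (family_space F')\<^esub>"
      unfolding family_space_remove [OF remove(2,4)] using remove.prems(3) by (simp only: comp_id) simp
    have "?i z \<in> carrier (homology_group (int (Suc d) - 1) (subtopology (family_space F') (\<Union>F' - e)))"
      unfolding family_space_remove [OF remove(2,4)] by (simp add: hom_induced_carrier)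
    then obtain y where y: "y \<in> carrier (relative_homology_group (int (Suc d)) (family_space F') (\<Union>F' - e))"
        "?i z = hom_boundary (int (Suc d)) (family_space F') (\<Union>F' - e) y"
      using kernel_inclusion [OF _ null] by blast
    show ?thesis
    proof (cases "m = Suc d")
      case False
      then have "trivial_group (relative_homology_group (int (Suc d)) (family_space F') (\<Union>F' - e))"
        by (intro trivial_family_homology_off_dimension [OF remove(2,6,3,4)]) simp
      then have "y = \<one>\<^bsub>relative_homology_group (int (Suc d)) (family_space F') (\<Union>F' - e)\<^esub>"
        using y(1) by (rule trivial_groupD)
      then have "?i z = \<one>\<^bsub>family_homology (int d) ?G\<^esub>"
        using y(2) hom_boundary_one [of "int (Suc d)" "family_space F'" "\<Union>F' - e"]
        unfolding family_space_remove [OF remove(2,4)] by simp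
      then obtain c where "supp c \<subseteq> ?G \<inter> cells K (Suc d)" "h c = z"
        using remove.IH [OF FG remove.prems(2)] remove.prems(4) by blast
      then show ?thesis by blast
    next
      case True
      have e: "e \<in> cells K (Suc d)" using True remove(4) by simp
      let ?D = "relative_homology_group (int (Suc d)) (disc (Suc d)) (sphere_set (Suc d))"
      let ?R = "relative_homology_group (int (Suc d)) (family_space F') (\<Union>F' - e)"
      let ?\<Phi> = "disc_map (Suc d) (family_space F') (\<Union>F' - e) (charmap K e)"
      have gen: "free_generator ?R (?\<Phi> (disc_class (Suc d)))"
        by (rule free_generator_iso [OF group_relative_homology_group group_relative_homology_group free_generator_disc_class
              iso_charmap [OF remove(2,6,3) e]])
      obtain k :: int where k: "y = ?\<Phi> (disc_class (Suc d)) [^]\<^bsub>?R\<^esub> k"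
        by (rule free_generatorE [OF gen y(1)])
      have att: "attaches_cell (Suc d) (family_space F') (\<Union>F' - e) (charmap K e)"
        by (rule attaches_charmap [OF remove(2,6,3) e])
      have sph: "charmap K e ` sphere_set (Suc d) \<subseteq> \<Union>F' - e"
        and cont: "continuous_map (disc (Suc d)) (family_space F') (charmap K e)"
        using att by (simp_all add: attaches_cell_def)
      have sphF: "charmap K e ` sphere_set (Suc d) \<subseteq> \<Union>F"
        unfolding remove.prems(1) by (rule sphere_subset_below [OF remove(2,3) e])
      interpret b: group_hom ?R "family_homology (int d) ?G" "hom_boundary (int (Suc d)) (family_space F') (\<Union>F' - e)"
        using group_hom_hom_boundary [of "int (Suc d)" "family_space F'" "\<Union>F' - e"]
        unfolding family_space_remove [OF remove(2,4)] by simp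
      have b: "hom_boundary (int (Suc d)) (family_space F') (\<Union>F' - e) (?\<Phi> (disc_class (Suc d)))
          = attaching_class K d (family_space ?G) {} e"
        using hom_boundary_attaching_class [OF cont sph] unfolding family_space_remove [OF remove(2,4)] .
      have iz: "?i z = attaching_class K d (family_space ?G) {} e [^]\<^bsub>family_homology (int d) ?G\<^esub> k"
        unfolding y(2) k using b.hom_int_pow [of "?\<Phi> (disc_class (Suc d))" k] b hom_induced_carrier by metis
      have eS: "e \<in> S" and he: "h (frag_of e) = attaching_class K d (family_space F) {} e"
        using remove.prems(4) [OF remove(3) e] by auto
      have ia: "?i (h (frag_of e)) = attaching_class K d (family_space ?G) {} e"
        unfolding he
        by (rule hom_induced_attaching_class [OF charmap_sphere_into_family [OF clF sphF e] continuous_inclusion [OF sFG]]) auto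
      let ?k = "frag_cmul k (frag_of e)"
      have kS: "?k \<in> carrier (free_Abelian_group S)"
        using eS keys_cmul [of k "frag_of e"] by auto
      have hk: "h ?k = h (frag_of e) [^]\<^bsub>?H\<^esub> k" by (rule hom_free_cmul [OF group_relative_homology_group h eS])
      have hkc: "h ?k \<in> carrier ?H" using kS by simp
      have ihk: "?i (h ?k) = ?i z"
        unfolding hk iz ia [symmetric] using eS by (intro i.hom_int_pow) simp
      \<comment> \<open>The class \<open>z\<close> corrected by the multiple of the attaching class of \<open>e\<close> found above.\<close>
      let ?z = "z \<otimes>\<^bsub>?H\<^esub> inv\<^bsub>?H\<^esub> h ?k"
      have zc: "?z \<in> carrier ?H" using remove.prems(2) hkc by simp
      have "?i ?z = ?i z \<otimes>\<^bsub>family_homology (int d) ?G\<^esub> inv\<^bsub>family_homology (int d) ?G\<^esub> ?i (h ?k)"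
        using remove.prems(2) hkc i.hom_mult i.hom_inv h.H.inv_closed by metis
      then have "?i ?z = \<one>\<^bsub>family_homology (int d) ?G\<^esub>"
        unfolding ihk using i.H.r_inv [OF hom_induced_carrier] by simp
      then obtain c where c: "supp c \<subseteq> ?G \<inter> cells K (Suc d)" "h c = ?z"
        using remove.IH [OF FG zc] remove.prems(4) by blast
      have cS: "c \<in> carrier (free_Abelian_group S)" using c(1) remove.prems(4) by auto
      have "h (c + ?k) = h c \<otimes>\<^bsub>?H\<^esub> h ?k" using h.hom_mult [OF cS kS] by simp
      also have "\<dots> = z" unfolding c(2) using remove.prems(2) hkc h.H.inv_solve_right' by (metis h.H.inv_closed h.H.l_inv h.H.m_assoc h.H.r_one)
      finally have "h (c + ?k) = z" .
      moreover have "supp (c + ?k) \<subseteq> F' \<inter> cells K (Suc d)"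
        using keys_add [of c ?k] keys_cmul [of k "frag_of e"] c(1) remove(3) e by auto
      ultimately show ?thesis by blast
    qed
  qed
qed

abbreviation class_power :: "nat \<Rightarrow> 'a set \<Rightarrow> int \<Rightarrow> 'a chain set" where
  "class_power n f k \<equiv> cell_class K n f [^]\<^bsub>local_homology_group K n f\<^esub> k"

lemma incidence_eqI:
  assumes "f \<in> cells K n"
    and "attaching_class K n (skeleton_space n) (skeleton K n - f) e = class_power n f (k::int)"
  shows "incidence K n e f = k"
  unfolding incidence_def attaching_class_def [symmetric]
  using assms(2) free_generator_pow_eq_iff [OF group_relative_homology_group free_generator_cell_class [OF assms(1)]]
  by (intro the_equality) auto

lemma attaching_class_incidence:
  assumes "f \<in> cells K n"
  shows "attaching_class K n (skeleton_space n) (skeleton K n - f) e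
    = class_power n f (incidence K n e f)"
proof -
  obtain k :: int where k: "attaching_class K n (skeleton_space n) (skeleton K n - f) e = class_power n f k"
    by (rule free_generatorE [OF free_generator_cell_class [OF assms] attaching_class_carrier])
  show ?thesis unfolding incidence_eqI [OF assms k] by (rule k)
qed

lemma sphere_into_skeleton:
  assumes "e \<in> cells K (Suc n)"
  shows "charmap K e ` sphere_set (Suc n) \<subseteq> skeleton K n"
  using charmap_sphere [OF assms] unfolding skeleton_def lessThan_Suc_atMost by blast

text \<open>Otherwise the attaching map factors through the complement of \<open>f\<close>.\<close>

lemma incidence_nonzero_meets:
  assumes "e \<in> cells K (Suc n)" "f \<in> cells K n" "incidence K n e f \<noteq> 0"
  shows "f \<inter> charmap K e ` sphere_set (Suc n) \<noteq> {}"
proof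
  assume disj: "f \<inter> charmap K e ` sphere_set (Suc n) = {}"
  let ?S = "sphere_space n"
  have sub: "charmap K e ` sphere_set (Suc n) \<subseteq> skeleton K n - f"
    using sphere_into_skeleton [OF assms(1)] disj by blast
  have top: "topspace ?S = sphere_set (Suc n)" using sphere_set_subset [of "Suc n"] by auto
  have "continuous_map ?S (skeleton_space n) (charmap K e)"
    unfolding skeleton_eq using charmap_sphere_into_family [OF closed_family_cells_below _ assms(1)] sphere_into_skeleton [OF assms(1)]
    by (simp add: skeleton_eq)
  then have "attaching_class K n (skeleton_space n) (skeleton K n - f) e = \<one>\<^bsub>local_homology_group K n f\<^esub>"
    unfolding attaching_class_def using sub top by (intro hom_induced_into_subset) auto
  then have "attaching_class K n (skeleton_space n) (skeleton K n - f) e = class_power n f (0::int)"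
    by (simp only: int_pow_0)
  then show False using incidence_eqI [OF assms(2)] assms(3) by blast
qed

lemma finite_incident_faces:
  assumes "e \<in> cells K (Suc n)"
  shows "finite {f. f \<in> cells K n \<and> incidence K n e f \<noteq> 0}"
proof (rule finite_subset)
  show "{f. f \<in> cells K n \<and> incidence K n e f \<noteq> 0} \<subseteq> {f \<in> all_cells K. f \<inter> charmap K e ` sphere_set (Suc n) \<noteq> {}}"
    using incidence_nonzero_meets [OF assms] cells_all_cells by blast
  show "finite {f \<in> all_cells K. f \<inter> charmap K e ` sphere_set (Suc n) \<noteq> {}}"
    using closure_finite assms by (simp add: closure_finite_def)
qed

lemma lookup_boundary_frag_of:
  assumes "e \<in> cells K (Suc n)"
  shows "coef (boundary K (Suc n) (frag_of e)) f = (if f \<in> cells K n then incidence K n e f else 0)"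
proof -
  let ?I = "{f. f \<in> cells K n \<and> incidence K n e f \<noteq> 0}"
  have "coef (boundary K (Suc n) (frag_of e)) f
     = (\<Sum>g\<in>?I. incidence K n e g * (if g = f then 1 else 0))"
    by (auto simp: lookup_sum when_def intro!: sum.cong)
  also have "\<dots> = (\<Sum>g\<in>?I. if g = f then incidence K n e f else 0)"
    by (intro sum.cong) auto
  also have "\<dots> = (if f \<in> cells K n then incidence K n e f else 0)"
    using finite_incident_faces [OF assms] by (simp add: sum.delta)
  finally show ?thesis .
qed

lemma lookup_boundary_add:
  "coef (boundary K (Suc n) (c + c')) f
    = coef (boundary K (Suc n) c) f + coef (boundary K (Suc n) c') f"
  by (simp add: frag_extend_add lookup_add)

text \<open>The incidence numbers describe the local behaviour of single attaching classes by definition; both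
  sides are additive in the chain.\<close>

lemma local_degree_of_attached_chain:
  assumes F: "closed_family F" "F \<subseteq> cells_below (Suc n)"
    and S: "S \<subseteq> cells K (Suc n)" "\<And>e. e \<in> S \<Longrightarrow> charmap K e ` sphere_set (Suc n) \<subseteq> \<Union>F"
    and h: "h \<in> hom (free_Abelian_group S) (family_homology (int n) F)"
      "\<And>e. e \<in> S \<Longrightarrow> h (frag_of e) = attaching_class K n (family_space F) {} e"
    and c: "supp c \<subseteq> S" and f: "f \<in> cells K n"
  shows "local_map n F {} f (h c)
    = class_power n f (coef (boundary K (Suc n) c) f)"
proof (rule hom_free_Abelian_group_eqI [OF group_relative_homology_group _ _ _ c])
  show "(\<lambda>c. local_map n F {} f (h c))
      \<in> hom (free_Abelian_group S) (local_homology_group K n f)"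
    by (rule hom_compose_apply [OF h(1) hom_induced_hom])
  show "(\<lambda>c. class_power n f (coef (boundary K (Suc n) c) f))
      \<in> hom (free_Abelian_group S) (local_homology_group K n f)"
    using free_generator_cell_class [OF f]
    by (intro hom_power_additive lookup_boundary_add) (simp_all add: free_generator_def)
  fix e assume e: "e \<in> S"
  have eK: "e \<in> cells K (Suc n)" using e S(1) by blast
  have "local_map n F {} f (h (frag_of e))
     = attaching_class K n (skeleton_space n) (skeleton K n - f) e"
    unfolding h(2) [OF e]
    by (rule hom_induced_attaching_class [OF charmap_sphere_into_family [OF F(1) S(2) [OF e] eK] continuous_inclusion_skeleton [OF F(2)]]) auto
  also have "\<dots> = class_power n f (incidence K n e f)"
    by (rule attaching_class_incidence [OF f])
  finally show "local_map n F {} f (h (frag_of e))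
     = class_power n f (coef (boundary K (Suc n) (frag_of e)) f)"
    unfolding lookup_boundary_frag_of [OF eK] using f by (simp only: if_True)
qed

text \<open>A characteristic map of a \<open>d\<close>-cell other than \<open>f\<close> has image in the complement of \<open>f\<close>, so only the
  coefficient of \<open>f\<close> survives.\<close>

lemma local_degree_of_relative_chain:
  assumes A: "closed_family A" "A \<subseteq> cells_below (Suc d)" "T = \<Union>(A \<inter> cells_below d)"
    and h: "h \<in> hom (free_Abelian_group (A \<inter> cells K d)) (relative_homology_group (int d) (family_space A) T)"
      "\<And>e. e \<in> A \<Longrightarrow> e \<in> cells K d \<Longrightarrow>
         h (frag_of e) = disc_map d (family_space A) T (charmap K e) (disc_class d)"
    and c: "supp c \<subseteq> A \<inter> cells K d" and f: "f \<in> cells K d"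
  shows "local_map d A T f (h c)
    = class_power d f (coef c f)"
proof (rule hom_free_Abelian_group_eqI [OF group_relative_homology_group _ _ _ c])
  show "(\<lambda>c. local_map d A T f (h c))
      \<in> hom (free_Abelian_group (A \<inter> cells K d)) (local_homology_group K d f)"
    by (rule hom_compose_apply [OF h(1) hom_induced_hom])
  have ccc: "cell_class K d f \<in> carrier (local_homology_group K d f)"
    using free_generator_cell_class [OF f] by (simp add: free_generator_def)
  then show "(\<lambda>c. class_power d f (coef c f))
      \<in> hom (free_Abelian_group (A \<inter> cells K d)) (local_homology_group K d f)"
    by (intro hom_power_additive) (simp_all add: lookup_add)
  fix e assume e: "e \<in> A \<inter> cells K d"
  have disj: "T \<inter> f = {}"
    unfolding A(3) by (rule cells_below_disjoint [OF f]) blast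
  have TA: "T \<subseteq> skeleton K d - f"
    using disj Union_subset_skeleton [OF A(2)] A(3) by blast
  have sphT: "charmap K e ` sphere_set d \<subseteq> T"
    unfolding A(3) using e by (intro sphere_subset_below [OF A(1)]) auto
  have cont: "continuous_map (disc d) (family_space A) (charmap K e)"
    using e by (intro charmap_into_family [OF A(1)]) auto
  have img: "charmap K e \<in> sphere_set d \<rightarrow> T" by (rule image_subset_iff_funcset [THEN iffD1, OF sphT])
  have idT: "id \<in> T \<rightarrow> skeleton K d - f" using TA by (auto simp: Pi_iff)
  have "local_map d A T f (h (frag_of e))
     = disc_map d (skeleton_space d) (skeleton K d - f) (id \<circ> charmap K e) (disc_class d)"
    using e h(2) [of e] hom_induced_compose' [OF cont img continuous_inclusion_skeleton [OF A(2)] idT] by simp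
  also have "\<dots> = disc_map d (skeleton_space d) (skeleton K d - f) (charmap K e) (disc_class d)"
    by simp
  also have "\<dots> = class_power d f (coef (frag_of e) f)"
  proof (cases "e = f")
    case True
    interpret L: group "local_homology_group K d f" by simp
    show ?thesis using True ccc by (simp add: cell_class_def)
  next
    case False
    have "continuous_map (disc d) (skeleton_space d) (charmap K e)"
      using continuous_map_compose [OF cont continuous_inclusion_skeleton [OF A(2)]] by simp
    moreover have "charmap K e ` topspace (disc d) \<subseteq> skeleton K d - f"
    proof -
      have "e \<inter> f = {}" using disjoint_cells [of e f] False e f cells_all_cells by blast
      moreover have "e \<subseteq> skeleton K d" using e A(2) Union_subset_skeleton [OF A(2)] by blast
      ultimately show ?thesis using charmap_disc [of e d] e sphT TA by blast
    qed
    ultimately have "disc_map d (skeleton_space d) (skeleton K d - f) (charmap K e) (disc_class d)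
      = \<one>\<^bsub>local_homology_group K d f\<^esub>"
      using sphere_set_subset by (rule hom_induced_into_subset)
    moreover have "coef (frag_of e) f = 0" using False by simp
    ultimately show ?thesis by (simp only: int_pow_0)
  qed
  finally show "local_map d A T f (h (frag_of e))
    = class_power d f (coef (frag_of e) f)" .
qed

lemma keys_boundary: "supp (boundary K (Suc n) c) \<subseteq> cells K n"
proof -
  have "supp (\<Sum>f | f \<in> cells K n \<and> incidence K n e f \<noteq> 0. frag_cmul (incidence K n e f) (frag_of f)) \<subseteq> cells K n" for e
  proof -
    have "supp (\<Sum>f | f \<in> cells K n \<and> incidence K n e f \<noteq> 0. frag_cmul (incidence K n e f) (frag_of f))
       \<subseteq> (\<Union>f\<in>{f. f \<in> cells K n \<and> incidence K n e f \<noteq> 0}. supp (frag_cmul (incidence K n e f) (frag_of f)))"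
      by (rule keys_sum)
    also have "\<dots> \<subseteq> cells K n"
      using keys_cmul by (fastforce split: if_splits)
    finally show ?thesis .
  qed
  then show ?thesis
    using keys_frag_extend by (fastforce simp only: boundary.simps)
qed

text \<open>A cellular cycle is first realised by a singular homology class of a finite family of cells: the
  boundary of the corresponding relative class is locally trivial since the cellular boundary
  vanishes, hence trivial. The singular class dies in \<open>X\<close>, therefore already in a finite family \<open>F'\<close>,
  and is then a combination of attaching classes of cells one dimension higher. That combination is
  the filling: its boundary and the cycle have the same local images at every \<open>(n+1)\<close>-cell.\<close>

theorem cellular_cycle_is_boundary:
  assumes acyclic: "trivial_group (homology_group (int (Suc n)) X)" and \<gamma>: "\<gamma> \<in> cycles K (Suc n)"
  shows "\<exists>\<mu>\<in>chains K (Suc (Suc n)). boundary K (Suc (Suc n)) \<mu> = \<gamma>"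
proof -
  let ?d = "Suc n"
  have \<gamma>c: "supp \<gamma> \<subseteq> cells K ?d" and \<gamma>0: "boundary K ?d \<gamma> = 0"
    using \<gamma> by (auto simp: cycles_def chains_def)
  have "supp \<gamma> \<subseteq> all_cells K" using \<gamma>c cells_all_cells by blast
  then obtain A0 where A0: "finite A0" "closed_family A0" "supp \<gamma> \<subseteq> A0"
    using finite_closed_hull finite_keys by metis
  define A where "A = A0 \<inter> cells_below (Suc ?d)"
  define B where "B = A \<inter> cells_below ?d"
  have A: "finite A" "closed_family A" "A \<subseteq> cells_below (Suc ?d)"
    unfolding A_def using A0 closed_family_below by auto
  have B: "finite B" "closed_family B" "B \<subseteq> cells_below ?d"
    unfolding B_def using A closed_family_below by auto
  let ?S = "A \<inter> cells K ?d"
  have \<gamma>S: "supp \<gamma> \<subseteq> ?S"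
    using \<gamma>c A0(3) by (auto simp: A_def cells_below_def)
  let ?R = "relative_homology_group (int ?d) (family_space A) (\<Union>B)"
  let ?b = "\<lambda>e. disc_map ?d (family_space A) (\<Union>B) (charmap K e) (disc_class ?d)"
  define h where "h = linear_extension ?S ?R ?b"
  have bR: "?b ` ?S \<subseteq> carrier ?R" using hom_induced_carrier by blast
  have h: "h \<in> hom (free_Abelian_group ?S) ?R" "\<And>e. e \<in> ?S \<Longrightarrow> h (frag_of e) = ?b e"
    unfolding h_def using linear_extension [OF abelian_relative_homology_group bR] by auto
  have sph: "charmap K e ` sphere_set ?d \<subseteq> \<Union>B" if e: "e \<in> ?S" for e
    unfolding B_def using e by (intro sphere_subset_below [OF A(2)]) auto
  have BA: "\<Union>B \<subseteq> \<Union>A" by (auto simp: B_def)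
  have subB: "subtopology (family_space A) (\<Union>B) = family_space B"
    using BA by (simp add: subtopology_subtopology Int_absorb1)
  have hb: "(\<lambda>c. hom_boundary (int ?d) (family_space A) (\<Union>B) (h c)) \<in> hom (free_Abelian_group ?S) (family_homology (int n) B)"
    using hom_compose_apply [OF h(1) hom_boundary_hom] unfolding subB by simp
  have hbe: "hom_boundary (int ?d) (family_space A) (\<Union>B) (h (frag_of e)) = attaching_class K n (family_space B) {} e"
    if e: "e \<in> ?S" for e
    unfolding h(2) [OF e] using e hom_boundary_attaching_class [OF charmap_into_family [OF A(2)] sph [OF e]] by (simp add: subB)
  \<comment> \<open>The boundary of the relative class is detected at the \<open>n\<close>-cells, where it has the coefficients of
    the cellular boundary.\<close>
  have hb1: "hom_boundary (int ?d) (family_space A) (\<Union>B) (h \<gamma>) = \<one>\<^bsub>family_homology (int n) B\<^esub>"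
  proof (rule top_homology_detected_locally [OF B])
    show "hom_boundary (int ?d) (family_space A) (\<Union>B) (h \<gamma>) \<in> carrier (family_homology (int n) B)"
      using hom_boundary_carrier [of "int ?d" "family_space A" "\<Union>B" "h \<gamma>"] unfolding subB by simp
    fix f assume f: "f \<in> B" "f \<in> cells K n"
    have "local_map n B {} f
          (hom_boundary (int ?d) (family_space A) (\<Union>B) (h \<gamma>))
       = class_power n f (coef (boundary K (Suc n) \<gamma>) f)"
      by (rule local_degree_of_attached_chain [OF B(2,3) _ sph hb hbe \<gamma>S f(2)]) auto
    also have "\<dots> = \<one>\<^bsub>local_homology_group K n f\<^esub>"
      unfolding \<gamma>0 by (simp only: lookup_zero int_pow_0)
    finally show "local_map n B {} f
          (hom_boundary (int ?d) (family_space A) (\<Union>B) (h \<gamma>)) = \<one>\<^bsub>local_homology_group K n f\<^esub>" .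
  qed
  have h\<gamma>: "h \<gamma> \<in> carrier ?R"
    using hom_in_carrier [OF h(1)] \<gamma>S by simp
  \<comment> \<open>Exactness turns the relative class into an absolute one.\<close>
  obtain z where z: "z \<in> carrier (family_homology (int ?d) A)"
      "h \<gamma> = hom_induced (int ?d) (family_space A) {} (family_space A) (\<Union>B) id z"
  proof (rule kernel_hom_boundary [OF h\<gamma>])
    show "hom_boundary (int ?d) (family_space A) (\<Union>B) (h \<gamma>)
      = \<one>\<^bsub>homology_group (int ?d - 1) (subtopology (family_space A) (\<Union>B))\<^esub>"
      unfolding subB using hb1 by simp
  qed
  have zloc: "local_map ?d A {} f z
      = class_power ?d f (coef \<gamma> f)" if f: "f \<in> cells K ?d" for f
  proof -
    have disj: "\<Union>B \<inter> f = {}" by (rule cells_below_disjoint [OF f B(3)])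
    have idB: "id \<in> \<Union>B \<rightarrow> skeleton K ?d - f"
    proof (rule Pi_I)
      fix x assume "x \<in> \<Union>B"
      then show "id x \<in> skeleton K ?d - f"
        using disj BA Union_subset_skeleton [OF A(3)] by auto
    qed
    have "local_map ?d A (\<Union>B) f (h \<gamma>)
       = hom_induced (int ?d) (family_space A) {} (skeleton_space ?d) (skeleton K ?d - f) (id \<circ> id) z"
      unfolding z(2) by (rule hom_induced_compose' [OF _ _ continuous_inclusion_skeleton [OF A(3)] idB]) auto
    then show ?thesis
      using local_degree_of_relative_chain [OF A(2,3) _ h(1) _ \<gamma>S f] h(2) by (simp add: B_def)
  qed
  have "hom_induced (int ?d) (family_space A) {} X {} id z = \<one>\<^bsub>homology_group (int ?d) X\<^esub>"
    by (rule trivial_groupD [OF acyclic hom_induced_carrier])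
  then obtain C where C: "compactin X C"
    "\<And>D. \<Union>A \<subseteq> D \<Longrightarrow> C \<subseteq> D \<Longrightarrow> hom_induced (int ?d) (family_space A) {} (subtopology X D) {} id z
         = \<one>\<^bsub>homology_group (int ?d) (subtopology X D)\<^esub>"
    using compact_support_of_null_homology [OF z(1)] by blast
  have finC: "finite (A \<union> {e \<in> all_cells K. e \<inter> C \<noteq> {}})" using A(1) finite_meeting [OF C(1)] by simp
  have subC: "A \<union> {e \<in> all_cells K. e \<inter> C \<noteq> {}} \<subseteq> all_cells K" using closed_family_subset [OF A(2)] by auto
  obtain F' where F': "finite F'" "closed_family F'" "A \<union> {e \<in> all_cells K. e \<inter> C \<noteq> {}} \<subseteq> F'"
    by (rule finite_closed_hull [OF finC subC])
  have AF': "\<Union>A \<subseteq> \<Union>F'" using F'(3) by blast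
  have CF': "C \<subseteq> \<Union>F'"
  proof
    fix x assume x: "x \<in> C"
    then have "x \<in> \<Union>(all_cells K)" using compactin_subset_topspace [OF C(1)] topspace_X by blast
    then obtain e where "e \<in> all_cells K" "x \<in> e" by blast
    then show "x \<in> \<Union>F'" using F'(3) x by blast
  qed
  have null: "inclusion_map (int ?d) A F' z = \<one>\<^bsub>family_homology (int ?d) F'\<^esub>"
    by (rule C(2) [OF AF' CF'])
  \<comment> \<open>Boundary spheres of \<open>(d+1)\<close>-cells of \<open>F'\<close> lie in the cells of \<open>F'\<close> of dimension at most \<open>d\<close>, so
    attaching classes are defined there.\<close>
  define F where "F = F' \<inter> cells_below (Suc ?d)"
  have F: "closed_family F" "F \<subseteq> cells_below (Suc ?d)"
    unfolding F_def using closed_family_below [OF F'(2)] by auto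
  have AF: "\<Union>A \<subseteq> \<Union>F" unfolding F_def using F'(3) A(3) by blast
  have FF': "\<Union>F \<subseteq> \<Union>F'" unfolding F_def by blast
  let ?zF = "inclusion_map (int ?d) A F z"
  have nullF: "inclusion_map (int ?d) F F' ?zF = \<one>\<^bsub>family_homology (int ?d) F'\<^esub>"
  proof -
    have "inclusion_map (int ?d) F F' ?zF
       = hom_induced (int ?d) (family_space A) {} (family_space F') {} (id \<circ> id) z"
      by (intro hom_induced_compose' continuous_inclusion AF FF') auto
    then show ?thesis using null by (simp only: comp_id)
  qed
  let ?T = "F' \<inter> cells K (Suc ?d)"
  have sphF: "charmap K e ` sphere_set (Suc ?d) \<subseteq> \<Union>F" if e: "e \<in> ?T" for e
    unfolding F_def using e by (intro sphere_subset_below [OF F'(2)]) auto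
  define k where "k = linear_extension ?T (family_homology (int ?d) F) (attaching_class K ?d (family_space F) {})"
  have "attaching_class K ?d (family_space F) {} ` ?T \<subseteq> carrier (family_homology (int ?d) F)"
    using attaching_class_carrier by blast
  note k_lin = linear_extension [OF abelian_relative_homology_group this]
  have k: "k \<in> hom (free_Abelian_group ?T) (family_homology (int ?d) F)"
      "\<And>e. e \<in> ?T \<Longrightarrow> k (frag_of e) = attaching_class K ?d (family_space F) {} e"
    unfolding k_def by (rule k_lin, rule k_lin)
  obtain \<mu> where \<mu>: "supp \<mu> \<subseteq> ?T" "k \<mu> = ?zF"
    using boundary_expresses_null_homologous_cycles [OF F'(1,2) F_def hom_induced_carrier nullF k(1)] k(2) by blast
  have "coef (boundary K (Suc ?d) \<mu>) f = coef \<gamma> f" for f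
  proof (cases "f \<in> cells K ?d")
    case True
    have "class_power ?d f (coef (boundary K (Suc ?d) \<mu>) f)
       = local_map ?d F {} f (k \<mu>)"
      by (rule local_degree_of_attached_chain [OF F _ sphF k \<mu>(1) True, symmetric]) auto
    also have "\<dots> = hom_induced (int ?d) (family_space A) {} (skeleton_space ?d) (skeleton K ?d - f) (id \<circ> id) z"
      unfolding \<mu>(2) by (intro hom_induced_compose' continuous_inclusion AF continuous_inclusion_skeleton F) auto
    also have "\<dots> = class_power ?d f (coef \<gamma> f)"
      using zloc [OF True] by (simp only: comp_id)
    finally show ?thesis
      using free_generator_pow_eq_iff [OF group_relative_homology_group free_generator_cell_class [OF True]] by blast
  next
    case False
    then have "f \<notin> supp (boundary K (Suc ?d) \<mu>)" "f \<notin> supp \<gamma>"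
      using keys_boundary \<gamma>c by blast+
    then show ?thesis by (simp only: not_in_keys_iff_lookup_eq_zero)
  qed
  then have "boundary K (Suc ?d) \<mu> = \<gamma>" by (rule poly_mapping_eqI)
  moreover have "\<mu> \<in> chains K (Suc ?d)" using \<mu>(1) by (simp add: chains_def)
  ultimately show ?thesis by blast
qed

end

section \<open>Cellular automorphisms acting on cellular chains\<close>

lemma open_disc_eq: "subtopology (disc n) (open_disc n) = subtopology (Euclidean_space n) {x. radius_sq n x < 1}"
proof -
  have "{x. (\<forall>i\<ge>n. x i = 0) \<and> (\<Sum>i<n. (x i)\<^sup>2) \<le> 1} \<inter> (open_disc n)
      = {x::nat\<Rightarrow>real. \<forall>i\<ge>n. x i = 0} \<inter> {x. radius_sq n x < 1}"
    by (auto simp: topspace_disc sphere_set_eq radius_sq_def)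
  then show ?thesis
    unfolding disc_eq_top_of_set Euclidean_space_def euclidean_product_topology
    by (simp add: subtopology_subtopology)
qed

lemma openin_open_disc: "openin (Euclidean_space n) (topspace (Euclidean_space n) \<inter> {x. radius_sq n x < 1})"
proof -
  have "open {x. radius_sq n x < 1}"
    by (intro open_Collect_less continuous_on_const continuous_on_radius_sq)
  then show ?thesis
    unfolding Euclidean_space_def euclidean_product_topology by (simp add: openin_open_Int)
qed

text \<open>If \<open>m < n\<close>, invariance of domain would make the image open in \<open>n\<close>-space although it lies in the
  coordinate subspace of dimension \<open>m\<close>.\<close>

lemma open_disc_dimension_le:
  assumes h: "homeomorphic_map (subtopology (disc n) (open_disc n))
      (subtopology (disc m) (open_disc m)) f"
  shows "n \<le> m"
proof (rule ccontr)
  assume "\<not> n \<le> m"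
  then have mn: "m < n" by simp
  let ?U = "topspace (Euclidean_space n) \<inter> {x. radius_sq n x < 1}"
  have subU: "subtopology (Euclidean_space n) ?U = subtopology (disc n) (open_disc n)"
    unfolding open_disc_eq by (metis subtopology_restrict)
  have cm: "continuous_map (subtopology (Euclidean_space n) ?U) (Euclidean_space m) f"
    using homeomorphic_imp_continuous_map [OF h] unfolding subU open_disc_eq [of m]
    by (simp add: continuous_map_in_subtopology)
  have "continuous_map (Euclidean_space m) (Euclidean_space n) id"
    using mn by (auto simp: Euclidean_space_def continuous_map_in_subtopology continuous_map_from_subtopology)
  then have cn: "continuous_map (subtopology (Euclidean_space n) ?U) (Euclidean_space n) f"
    using continuous_map_compose [OF cm] by fastforce
  have "inj_on f (topspace (subtopology (Euclidean_space n) ?U))"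
    using homeomorphic_imp_injective_map [OF h] unfolding subU .
  then have inj: "inj_on f ?U" by (simp add: Int_absorb1)
  have op: "openin (Euclidean_space n) (f ` ?U)"
    by (rule invariance_of_domain_Euclidean_space [OF openin_open_disc cn inj])
  have fm: "f ` ?U \<subseteq> topspace (Euclidean_space m)"
    using continuous_map_image_subset_topspace [OF cm] by (simp add: Int_absorb1)
  define y where "y = f (\<lambda>i. 0)"
  have "(\<lambda>i. 0) \<in> ?U" by (simp add: topspace_Euclidean_space radius_sq_def)
  then have y: "y \<in> f ` ?U" unfolding y_def by (rule imageI)
  \<comment> \<open>A line through \<open>y\<close> that leaves the subspace immediately: it moves the coordinate with index \<open>m\<close>,
    which vanishes on the subspace.\<close>
  define p where "p = (\<lambda>t::real. \<lambda>i. if i < n then (if i = m then t else y i) else 0)"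
  have cp: "continuous_map euclideanreal (Euclidean_space n) p"
    unfolding p_def continuous_map_componentwise_Euclidean_space by auto
  have yE: "\<forall>i\<ge>m. y i = 0" using y fm by (auto simp: topspace_Euclidean_space)
  have "p 0 = y" unfolding p_def using yE mn by (auto simp: fun_eq_iff)
  moreover have "t = 0" if "p t \<in> f ` ?U" for t
  proof -
    have "p t m = 0" using that fm by (auto simp: topspace_Euclidean_space)
    then show "t = 0" using mn by (simp add: p_def)
  qed
  ultimately have "{t \<in> topspace euclideanreal. p t \<in> f ` ?U} = {0}" using y by auto
  moreover have "openin euclideanreal {t \<in> topspace euclideanreal. p t \<in> f ` ?U}"
    by (rule openin_continuous_map_preimage [OF cp op])
  ultimately show False using not_open_singleton [of "0::real"] by simp
qed

definition signed_relabel :: "('c \<Rightarrow> int) \<Rightarrow> ('c \<Rightarrow> 'd) \<Rightarrow> ('c \<Rightarrow>\<^sub>0 int) \<Rightarrow> ('d \<Rightarrow>\<^sub>0 int)" where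
  "signed_relabel s b = frag_extend (\<lambda>e. frag_cmul (s e) (frag_of (b e)))"

lemma keys_signed_relabel: "supp (signed_relabel s b c) \<subseteq> b ` supp c"
proof -
  have "supp (frag_cmul (s e) (frag_of (b e))) \<subseteq> {b e}" for e
    using keys_cmul [of "s e" "frag_of (b e)"] by simp
  then show ?thesis
    unfolding signed_relabel_def using keys_frag_extend [of "\<lambda>e. frag_cmul (s e) (frag_of (b e))" c] by blast
qed

lemma lookup_signed_relabel:
  assumes "inj_on b S" "supp c \<subseteq> S" "e \<in> S"
  shows "coef (signed_relabel s b c) (b e) = s e * coef c e"
  using assms(2)
proof (induction c rule: frag_induction)
  case (one x)
  have "b x = b e \<longleftrightarrow> x = e" "b e = b x \<longleftrightarrow> e = x"
    using inj_on_eq_iff [OF assms(1)] one assms(3) by auto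
  then show ?case by (auto simp: signed_relabel_def)
next
  case (diff a c)
  then show ?case by (simp add: signed_relabel_def frag_extend_diff lookup_minus right_diff_distrib)
qed (simp add: signed_relabel_def)

lemma l1_norm_signed_relabel:
  assumes inj: "inj_on b (supp c)" and s: "\<And>e. e \<in> supp c \<Longrightarrow> s e = 1 \<or> s e = -1"
  shows "l1_norm (signed_relabel s b c) = l1_norm c"
proof -
  let ?k = "supp c"
  have l: "coef (signed_relabel s b c) (b e) = s e * coef c e" if "e \<in> ?k" for e
    by (rule lookup_signed_relabel [OF inj order_refl that])
  have k: "supp (signed_relabel s b c) = b ` ?k"
  proof (rule equalityI [OF keys_signed_relabel subsetI])
    fix y assume "y \<in> b ` ?k"
    then obtain e where e: "e \<in> ?k" "y = b e" by blast
    then have "coef (signed_relabel s b c) y \<noteq> 0"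
      using l [OF e(1)] s [OF e(1)] by (auto simp: in_keys_iff)
    then show "y \<in> supp (signed_relabel s b c)" by (simp add: in_keys_iff)
  qed
  have "l1_norm (signed_relabel s b c) = (\<Sum>e\<in>?k. nat \<bar>coef (signed_relabel s b c) (b e)\<bar>)"
    unfolding l1_norm_def k by (simp add: sum.reindex [OF inj])
  also have "\<dots> = l1_norm c"
    unfolding l1_norm_def
  proof (rule sum.cong [OF refl])
    fix e assume "e \<in> ?k"
    then show "nat \<bar>coef (signed_relabel s b c) (b e)\<bar> = nat \<bar>coef c e\<bar>"
      using l [of e] s [of e] by auto
  qed
  finally show ?thesis .
qed

text \<open>One group element together with its inverse. Working with a single pair of maps keeps the homological
  part free of group theory.\<close>

locale cellular_automorphism = cw_complex K for K :: "('a, 'b) cell_complex_scheme" +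
  fixes \<alpha> \<beta> :: "'a \<Rightarrow> 'a"
  assumes combinatorial: "combinatorial_map K K \<alpha>" "combinatorial_map K K \<beta>"
    and inverse: "\<And>x. x \<in> topspace X \<Longrightarrow> \<beta> (\<alpha> x) = x" "\<And>x. x \<in> topspace X \<Longrightarrow> \<alpha> (\<beta> x) = x"
begin

lemma continuous_map_\<alpha>: "continuous_map X X \<alpha>"
  using combinatorial(1) by (simp add: combinatorial_map_def)

lemma inj_\<alpha>: "inj_on \<alpha> (topspace X)"
  using inverse(1) by (rule inj_on_inverseI)

lemma \<beta>_\<alpha>_image: "A \<subseteq> topspace X \<Longrightarrow> \<beta> ` \<alpha> ` A = A"
  using inverse(1) by (force simp: image_image subset_iff)

lemma cell_image_exists:
  assumes e: "e \<in> cells K n"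
  obtains m where "\<alpha> ` e \<in> cells K m" "homeomorphic_map (subtopology X e) (subtopology X (\<alpha> ` e)) \<alpha>"
proof -
  obtain m e' where e': "e' \<in> cells K m" "homeomorphic_map (subtopology X e) (subtopology X e') \<alpha>"
    using combinatorial(1) e unfolding combinatorial_map_def by blast
  have "\<alpha> ` e = e'"
    using homeomorphic_imp_surjective_map [OF e'(2)] cell_subset_X [OF e] cell_subset_X [OF e'(1)]
    by (simp add: Int_absorb1)
  then show ?thesis using that e' by blast
qed

text \<open>A combinatorial map sends a cell to some cell; that the dimension is preserved is invariance of
  dimension.\<close>

lemma cell_image:
  assumes e: "e \<in> cells K n"
  shows "\<alpha> ` e \<in> cells K n" and "homeomorphic_map (subtopology X e) (subtopology X (\<alpha> ` e)) \<alpha>"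
proof -
  obtain m where m: "\<alpha> ` e \<in> cells K m" and h: "homeomorphic_map (subtopology X e) (subtopology X (\<alpha> ` e)) \<alpha>"
    using cell_image_exists [OF e] by blast
  let ?D = "\<lambda>n. subtopology (disc n) (open_disc n)"
  have "?D n homeomorphic_space subtopology X e"
    using charmap_homeomorphic [OF e] by (rule homeomorphic_map_imp_homeomorphic_space)
  also have "subtopology X e homeomorphic_space subtopology X (\<alpha> ` e)"
    using h by (rule homeomorphic_map_imp_homeomorphic_space)
  also have "subtopology X (\<alpha> ` e) homeomorphic_space ?D m"
    using homeomorphic_map_imp_homeomorphic_space [OF charmap_homeomorphic [OF m]] homeomorphic_space_sym by blast
  finally have hs: "?D n homeomorphic_space ?D m" .
  then have hs': "?D m homeomorphic_space ?D n" using homeomorphic_space_sym by blast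
  have "n \<le> m" using hs open_disc_dimension_le unfolding homeomorphic_space by blast
  moreover have "m \<le> n" using hs' open_disc_dimension_le unfolding homeomorphic_space by blast
  ultimately show "\<alpha> ` e \<in> cells K n" using m by simp
  show "homeomorphic_map (subtopology X e) (subtopology X (\<alpha> ` e)) \<alpha>" by (rule h)
qed

lemma Union_cells_below_image: "\<alpha> ` \<Union>(cells_below n) \<subseteq> \<Union>(cells_below n)"
proof
  fix y assume "y \<in> \<alpha> ` \<Union>(cells_below n)"
  then obtain m e x where "m < n" "e \<in> cells K m" "x \<in> e" "y = \<alpha> x" by (auto simp: cells_below_def)
  then have "\<alpha> ` e \<in> cells_below n" "y \<in> \<alpha> ` e" using cell_image(1) by (auto simp: cells_below_def)
  then show "y \<in> \<Union>(cells_below n)" by blast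
qed

lemma skeleton_image: "\<alpha> ` skeleton K n \<subseteq> skeleton K n"
  unfolding skeleton_eq by (rule Union_cells_below_image)

lemma continuous_map_skeleton: "continuous_map (skeleton_space n) (skeleton_space n) \<alpha>"
  using continuous_map_\<alpha> skeleton_image [of n]
  by (auto simp: continuous_map_in_subtopology continuous_map_from_subtopology)

lemma skeleton_complement_image:
  assumes f: "f \<in> cells K n"
  shows "\<alpha> \<in> skeleton K n - f \<rightarrow> skeleton K n - \<alpha> ` f"
proof -
  have fX: "f \<subseteq> topspace X" by (rule cell_subset_X [OF f])
  have skX: "skeleton K n \<subseteq> topspace X" unfolding skeleton_eq using topspace_X by (auto simp: cells_below_def all_cells_def)
  have "\<alpha> ` (skeleton K n - f) \<inter> \<alpha> ` f = {}" using inj_\<alpha> fX skX by (auto simp: inj_on_def)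
  then show ?thesis using skeleton_image [of n] by blast
qed

text \<open>The cell \<open>e\<close> attached to the skeleton below its dimension. Orientations are compared in this space
  because its relative group maps to the local homology group at \<open>e\<close> and, by the connecting
  homomorphism, to the homology of the skeleton below; so one sign serves for \<open>e\<close> both as a face and
  as a cell whose boundary is taken.\<close>

definition bottom_family :: "nat \<Rightarrow> 'a set \<Rightarrow> 'a set set" where
  "bottom_family n e = insert e (cells_below n)"

lemma bottom_family:
  assumes e: "e \<in> cells K n"
  shows "closed_family (bottom_family n e)" "closed_family (bottom_family n e - {e})" "e \<in> bottom_family n e"
    "bottom_family n e - {e} = cells_below n" "\<Union>(bottom_family n e) - e = \<Union>(cells_below n)"
    "bottom_family n e \<subseteq> cells_below (Suc n)"
proof -
  have ne: "e \<notin> cells_below n" using cells_below_dim [OF e, of n] by simp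
  show rem: "bottom_family n e - {e} = cells_below n" using ne by (auto simp: bottom_family_def)
  show "closed_family (bottom_family n e - {e})" unfolding rem by (rule closed_family_cells_below)
  show bt: "bottom_family n e \<subseteq> cells_below (Suc n)"
  proof -
    have "cells_below n \<subseteq> cells_below (Suc n)" unfolding cells_below_def by (rule UN_mono) auto
    then show ?thesis using cells_below_dim [OF e, of "Suc n"] by (simp add: bottom_family_def)
  qed
  show mem: "e \<in> bottom_family n e" by (simp add: bottom_family_def)
  show cl: "closed_family (bottom_family n e)"
    unfolding closed_family_def
  proof (intro conjI allI ballI)
    show "bottom_family n e \<subseteq> all_cells K" using bt by (auto simp: cells_below_def all_cells_def)
    fix m f assume f: "f \<in> bottom_family n e \<inter> cells K m"
    then have "m \<le> n" using bt cells_below_dim [of f m "Suc n"] by auto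
    then have "charmap K f ` sphere_set m \<subseteq> \<Union>(cells_below n)"
      using charmap_sphere [of f m] f by (fastforce simp: cells_below_def)
    then show "charmap K f ` sphere_set m \<subseteq> \<Union>(bottom_family n e)" by (auto simp: bottom_family_def)
  qed
  show "\<Union>(bottom_family n e) - e = \<Union>(cells_below n)"
    using Union_family_Diff [OF closed_family_subset [OF cl] cells_all_cells [OF e]] rem by simp
qed

abbreviation bottom_space :: "nat \<Rightarrow> 'a set \<Rightarrow> 'a topology" where
  "bottom_space n e \<equiv> family_space (bottom_family n e)"

abbreviation bottom_group :: "nat \<Rightarrow> 'a set \<Rightarrow> 'a chain set monoid" where
  "bottom_group n e \<equiv> relative_homology_group (int n) (bottom_space n e) (\<Union>(cells_below n))"

definition transported_class :: "nat \<Rightarrow> 'a set \<Rightarrow> 'a chain set" where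
  "transported_class n e = disc_map n (bottom_space n (\<alpha> ` e)) (\<Union>(cells_below n))
     (\<alpha> \<circ> charmap K e) (disc_class n)"

definition bottom_class :: "nat \<Rightarrow> 'a set \<Rightarrow> 'a chain set" where
  "bottom_class n e = disc_map n (bottom_space n e) (\<Union>(cells_below n)) (charmap K e) (disc_class n)"

lemma attaches_bottom:
  assumes e: "e \<in> cells K n"
  shows "attaches_cell n (bottom_space n e) (\<Union>(cells_below n)) (charmap K e)"
  using attaches_charmap [OF bottom_family(1-3) [OF e] e] unfolding bottom_family(5) [OF e] .

lemma transported_sphere:
  assumes e: "e \<in> cells K n"
  shows "(\<alpha> \<circ> charmap K e) ` sphere_set n \<subseteq> \<Union>(cells_below n)"
proof -
  have sub: "charmap K e ` sphere_set n \<subseteq> \<Union>(cells_below n)"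
    using charmap_sphere [OF e] unfolding cells_below_def by blast
  have "(\<alpha> \<circ> charmap K e) ` sphere_set n = \<alpha> ` charmap K e ` sphere_set n" by (rule image_comp [symmetric])
  also have "\<dots> \<subseteq> \<alpha> ` \<Union>(cells_below n)" by (rule image_mono [OF sub])
  also have "\<dots> \<subseteq> \<Union>(cells_below n)" by (rule Union_cells_below_image)
  finally show ?thesis .
qed

lemma attaches_transported:
  assumes e: "e \<in> cells K n"
  shows "attaches_cell n (bottom_space n (\<alpha> ` e)) (\<Union>(cells_below n)) (\<alpha> \<circ> charmap K e)"
proof -
  have e': "\<alpha> ` e \<in> cells K n" by (rule cell_image(1) [OF e])
  have "attaches_cell n (bottom_space n (\<alpha> ` e)) (\<Union>(bottom_family n (\<alpha> ` e)) - \<alpha> ` e) (\<alpha> \<circ> charmap K e)"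
  proof (rule attaches_cell_family [OF bottom_family(1-3) [OF e'] e'])
    show "continuous_map (disc n) X (\<alpha> \<circ> charmap K e)"
      by (rule continuous_map_compose [OF charmap_continuous [OF e] continuous_map_\<alpha>])
    show "(\<alpha> \<circ> charmap K e) ` sphere_set n \<subseteq> \<Union>(bottom_family n (\<alpha> ` e)) - \<alpha> ` e"
      unfolding bottom_family(5) [OF e'] by (rule transported_sphere [OF e])
    show "homeomorphic_map (subtopology (disc n) (open_disc n)) (subtopology X (\<alpha> ` e)) (\<alpha> \<circ> charmap K e)"
      by (rule homeomorphic_map_compose [OF charmap_homeomorphic [OF e] cell_image(2) [OF e]])
  qed
  then show ?thesis unfolding bottom_family(5) [OF e'] .
qed

definition orientation_sign :: "nat \<Rightarrow> 'a set \<Rightarrow> int" where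
  "orientation_sign n e = (SOME s. (s = 1 \<or> s = -1) \<and>
     transported_class n e = bottom_class n (\<alpha> ` e) [^]\<^bsub>bottom_group n (\<alpha> ` e)\<^esub> s)"

text \<open>Both characteristic maps attach the cell \<open>\<alpha> e\<close>, so both classes generate the same infinite cyclic
  group.\<close>

lemma orientation_sign:
  assumes e: "e \<in> cells K n"
  shows "orientation_sign n e = 1 \<or> orientation_sign n e = -1"
    and "transported_class n e = bottom_class n (\<alpha> ` e) [^]\<^bsub>bottom_group n (\<alpha> ` e)\<^esub> orientation_sign n e"
proof -
  have "free_generator (bottom_group n (\<alpha> ` e)) (bottom_class n (\<alpha> ` e))"
    unfolding bottom_class_def
    by (rule free_generator_iso [OF group_relative_homology_group group_relative_homology_group free_generator_disc_class
          iso_hom_induced_attaches_cell [OF attaches_bottom [OF cell_image(1) [OF e]]]])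
  moreover have "free_generator (bottom_group n (\<alpha> ` e)) (transported_class n e)"
    unfolding transported_class_def
    by (rule free_generator_iso [OF group_relative_homology_group group_relative_homology_group free_generator_disc_class
          iso_hom_induced_attaches_cell [OF attaches_transported [OF e]]])
  ultimately have "\<exists>s::int. (s = 1 \<or> s = -1) \<and>
     transported_class n e = bottom_class n (\<alpha> ` e) [^]\<^bsub>bottom_group n (\<alpha> ` e)\<^esub> s"
    using free_generator_unique_up_to_sign [OF group_relative_homology_group] by metis
  then have *: "(orientation_sign n e = 1 \<or> orientation_sign n e = -1) \<and>
     transported_class n e = bottom_class n (\<alpha> ` e) [^]\<^bsub>bottom_group n (\<alpha> ` e)\<^esub> orientation_sign n e"
    unfolding orientation_sign_def by (rule someI_ex)
  show "orientation_sign n e = 1 \<or> orientation_sign n e = -1" using * by (rule conjunct1)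
  show "transported_class n e = bottom_class n (\<alpha> ` e) [^]\<^bsub>bottom_group n (\<alpha> ` e)\<^esub> orientation_sign n e"
    using * by (rule conjunct2)
qed

text \<open>The sign of a cell \<open>f\<close> in its role as a face.\<close>

lemma hom_induced_cell_class:
  assumes f: "f \<in> cells K n"
  shows "hom_induced (int n) (skeleton_space n) (skeleton K n - f) (skeleton_space n) (skeleton K n - \<alpha> ` f) \<alpha> (cell_class K n f)
    = class_power n (\<alpha> ` f) (orientation_sign n f)"
proof -
  let ?f = "\<alpha> ` f"
  have f': "?f \<in> cells K n" by (rule cell_image(1) [OF f])
  note cs = continuous_map_skeleton [of n] and sk = skeleton_complement_image [OF f]
  have att: "attaches_cell n (skeleton_space n) (skeleton K n - f) (charmap K f)"
    using attaches_charmap [OF skeleton_closed_families [OF f] f] by (simp add: skeleton_eq)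
  have ca: "continuous_map (disc n) (skeleton_space n) (charmap K f)" "charmap K f ` sphere_set n \<subseteq> skeleton K n - f"
    using att by (simp_all add: attaches_cell_def)
  have im: "charmap K f \<in> sphere_set n \<rightarrow> skeleton K n - f" by (rule image_subset_iff_funcset [THEN iffD1, OF ca(2)])
  have lhs: "hom_induced (int n) (skeleton_space n) (skeleton K n - f) (skeleton_space n) (skeleton K n - ?f) \<alpha> (cell_class K n f)
     = disc_map n (skeleton_space n) (skeleton K n - ?f) (\<alpha> \<circ> charmap K f) (disc_class n)"
    unfolding cell_class_def by (rule hom_induced_compose' [OF ca(1) im cs sk])
  let ?i = "hom_induced (int n) (bottom_space n ?f) (\<Union>(cells_below n)) (skeleton_space n) (skeleton K n - ?f) id"
  have ci: "continuous_map (bottom_space n ?f) (skeleton_space n) id"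
    by (rule continuous_inclusion_skeleton [OF bottom_family(6) [OF f']])
  have "\<Union>(cells_below n) \<subseteq> skeleton K n - ?f"
    using bottom_family(5) [OF f'] Union_subset_skeleton [OF bottom_family(6) [OF f']] by blast
  then have ii: "id \<in> \<Union>(cells_below n) \<rightarrow> skeleton K n - ?f" by (auto simp: Pi_iff)
  have t: "continuous_map (disc n) (bottom_space n ?f) (\<alpha> \<circ> charmap K f)"
    using attaches_transported [OF f] by (simp add: attaches_cell_def)
  have ti: "\<alpha> \<circ> charmap K f \<in> sphere_set n \<rightarrow> \<Union>(cells_below n)"
    by (rule image_subset_iff_funcset [THEN iffD1, OF transported_sphere [OF f]])
  have it: "?i (transported_class n f)
     = disc_map n (skeleton_space n) (skeleton K n - ?f) (\<alpha> \<circ> charmap K f) (disc_class n)"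
    using hom_induced_compose' [OF t ti ci ii] unfolding transported_class_def id_comp .
  have b: "continuous_map (disc n) (bottom_space n ?f) (charmap K ?f)" "charmap K ?f ` sphere_set n \<subseteq> \<Union>(cells_below n)"
    using attaches_bottom [OF f'] by (simp_all add: attaches_cell_def)
  have bi: "charmap K ?f \<in> sphere_set n \<rightarrow> \<Union>(cells_below n)"
    by (rule image_subset_iff_funcset [THEN iffD1, OF b(2)])
  have ib: "?i (bottom_class n ?f) = cell_class K n ?f"
    using hom_induced_compose' [OF b(1) bi ci ii] unfolding bottom_class_def cell_class_def id_comp .
  interpret i: group_hom "bottom_group n ?f" "local_homology_group K n ?f" ?i by (rule group_hom_hom_induced)
  have bc: "bottom_class n ?f \<in> carrier (bottom_group n ?f)" unfolding bottom_class_def by (rule hom_induced_carrier)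
  show ?thesis
    unfolding lhs it [symmetric] orientation_sign(2) [OF f] ib [symmetric]
    by (rule i.hom_int_pow [OF bc])
qed

text \<open>The sign of a cell \<open>e\<close> in its role as a cell with a boundary, by naturality of the connecting
  homomorphism.\<close>

lemma transported_attaching_class:
  assumes e: "e \<in> cells K (Suc n)"
  shows "hom_induced (int n) (sphere_space n) {} (skeleton_space n) T (\<alpha> \<circ> charmap K e)
       (sphere_class n)
    = attaching_class K n (skeleton_space n) T (\<alpha> ` e) [^]\<^bsub>relative_homology_group (int n) (skeleton_space n) T\<^esub> orientation_sign (Suc n) e"
proof -
  let ?S = "sphere_space n" and ?e = "\<alpha> ` e"
  let ?b = "sphere_class n"
  let ?B = "hom_boundary (int (Suc n)) (bottom_space (Suc n) ?e) (\<Union>(cells_below (Suc n)))"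
  let ?H = "homology_group (int n) (skeleton_space n)"
  have e': "?e \<in> cells K (Suc n)" by (rule cell_image(1) [OF e])
  have "\<Union>(cells_below (Suc n)) \<subseteq> \<Union>(bottom_family (Suc n) ?e)" by (auto simp: bottom_family_def)
  then have sub: "subtopology (bottom_space (Suc n) ?e) (\<Union>(cells_below (Suc n))) = skeleton_space n"
    by (simp add: subtopology_subtopology Int_absorb1 skeleton_eq)
  interpret B: group_hom "bottom_group (Suc n) ?e" ?H ?B
    using group_hom_hom_boundary [of "int (Suc n)" "bottom_space (Suc n) ?e" "\<Union>(cells_below (Suc n))"]
    unfolding sub by simp
  have t: "continuous_map (disc (Suc n)) (bottom_space (Suc n) ?e) (\<alpha> \<circ> charmap K e)"
    using attaches_transported [OF e] by (simp add: attaches_cell_def)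
  have ti: "\<alpha> \<circ> charmap K e \<in> sphere_set (Suc n) \<rightarrow> \<Union>(cells_below (Suc n))"
    by (rule image_subset_iff_funcset [THEN iffD1, OF transported_sphere [OF e]])
  have Bt: "?B (transported_class (Suc n) e) = hom_induced (int n) ?S {} (skeleton_space n) {} (\<alpha> \<circ> charmap K e) ?b"
    using fun_cong [OF naturality_hom_induced [OF t ti, of "int (Suc n)"], of "disc_class (Suc n)"]
    unfolding sub transported_class_def by simp
  have b: "continuous_map (disc (Suc n)) (bottom_space (Suc n) ?e) (charmap K ?e)" "charmap K ?e ` sphere_set (Suc n) \<subseteq> \<Union>(cells_below (Suc n))"
    using attaches_bottom [OF e'] by (simp_all add: attaches_cell_def)
  have Bb: "?B (bottom_class (Suc n) ?e) = attaching_class K n (skeleton_space n) {} ?e"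
    using hom_boundary_attaching_class [OF b] unfolding sub bottom_class_def .
  have bc: "bottom_class (Suc n) ?e \<in> carrier (bottom_group (Suc n) ?e)" unfolding bottom_class_def by (rule hom_induced_carrier)
  have 1: "hom_induced (int n) ?S {} (skeleton_space n) {} (\<alpha> \<circ> charmap K e) ?b
     = attaching_class K n (skeleton_space n) {} ?e [^]\<^bsub>?H\<^esub> orientation_sign (Suc n) e"
    unfolding Bt [symmetric] Bb [symmetric] orientation_sign(2) [OF e] by (rule B.hom_int_pow [OF bc])
  let ?j = "hom_induced (int n) (skeleton_space n) {} (skeleton_space n) T id"
  interpret j: group_hom ?H "relative_homology_group (int n) (skeleton_space n) T" ?j by (rule group_hom_hom_induced)
  have cid: "continuous_map (skeleton_space n) (skeleton_space n) id" by simp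
  have cS: "continuous_map ?S (skeleton_space n) (charmap K ?e)"
    unfolding skeleton_eq
    by (rule charmap_sphere_into_family [OF closed_family_cells_below b(2) e'])
  have ja: "?j (attaching_class K n (skeleton_space n) {} ?e) = attaching_class K n (skeleton_space n) T ?e"
    by (rule hom_induced_attaching_class [OF cS cid]) auto
  have cT: "continuous_map ?S (skeleton_space n) (\<alpha> \<circ> charmap K e)"
  proof -
    have "topspace ?S = sphere_set (Suc n)" using sphere_set_subset [of "Suc n"] by auto
    moreover have "continuous_map ?S X (\<alpha> \<circ> charmap K e)"
      by (intro continuous_map_from_subtopology continuous_map_compose [OF charmap_continuous [OF e] continuous_map_\<alpha>])
    ultimately show ?thesis
      using transported_sphere [OF e] unfolding skeleton_eq continuous_map_in_subtopology
      by (simp only: image_subset_iff_funcset)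
  qed
  have "?j (hom_induced (int n) ?S {} (skeleton_space n) {} (\<alpha> \<circ> charmap K e) ?b)
     = hom_induced (int n) ?S {} (skeleton_space n) T (id \<circ> (\<alpha> \<circ> charmap K e)) ?b"
    by (rule hom_induced_compose' [OF cT _ cid]) auto
  then have "hom_induced (int n) ?S {} (skeleton_space n) T (\<alpha> \<circ> charmap K e) ?b
     = ?j (attaching_class K n (skeleton_space n) {} ?e [^]\<^bsub>?H\<^esub> orientation_sign (Suc n) e)"
    unfolding 1 id_comp by (rule sym)
  also have "\<dots> = attaching_class K n (skeleton_space n) T ?e [^]\<^bsub>relative_homology_group (int n) (skeleton_space n) T\<^esub> orientation_sign (Suc n) e"
    unfolding ja [symmetric] by (rule j.hom_int_pow [OF attaching_class_carrier])
  finally show ?thesis .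
qed

text \<open>Transport the attaching class of \<open>e\<close> to the local group at \<open>\<alpha> f\<close> in two ways and compare exponents.\<close>

lemma incidence_image:
  assumes e: "e \<in> cells K (Suc n)" and f: "f \<in> cells K n"
  shows "orientation_sign (Suc n) e * incidence K n (\<alpha> ` e) (\<alpha> ` f) = orientation_sign n f * incidence K n e f"
proof -
  let ?S = "sphere_space n" and ?e = "\<alpha> ` e" and ?f = "\<alpha> ` f"
  let ?b = "sphere_class n"
  let ?L = "local_homology_group K n f" and ?L' = "local_homology_group K n ?f"
  let ?a = "hom_induced (int n) (skeleton_space n) (skeleton K n - f) (skeleton_space n) (skeleton K n - ?f) \<alpha>"
  have f': "?f \<in> cells K n" by (rule cell_image(1) [OF f])
  note cs = continuous_map_skeleton [of n] and sk = skeleton_complement_image [OF f]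
  interpret a: group_hom ?L ?L' ?a by (rule group_hom_hom_induced)
  have gf: "free_generator ?L (cell_class K n f)" "free_generator ?L' (cell_class K n ?f)"
    by (rule free_generator_cell_class [OF f], rule free_generator_cell_class [OF f'])
  have cc: "cell_class K n f \<in> carrier ?L" "cell_class K n ?f \<in> carrier ?L'"
    using gf by (simp_all add: free_generator_def)
  have cS: "continuous_map ?S (skeleton_space n) (charmap K e)"
    unfolding skeleton_eq
    by (rule charmap_sphere_into_family [OF closed_family_cells_below sphere_into_skeleton [OF e, unfolded skeleton_eq] e])
  have "?a (attaching_class K n (skeleton_space n) (skeleton K n - f) e)
     = hom_induced (int n) ?S {} (skeleton_space n) (skeleton K n - ?f) (\<alpha> \<circ> charmap K e) ?b"
    unfolding attaching_class_def by (rule hom_induced_compose' [OF cS _ cs sk]) auto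
  also have "\<dots> = attaching_class K n (skeleton_space n) (skeleton K n - ?f) ?e [^]\<^bsub>?L'\<^esub> orientation_sign (Suc n) e"
    by (rule transported_attaching_class [OF e])
  also have "\<dots> = class_power n ?f (incidence K n ?e ?f * orientation_sign (Suc n) e)"
    unfolding attaching_class_incidence [OF f'] by (rule a.H.int_pow_pow [OF cc(2)])
  finally have 1: "?a (attaching_class K n (skeleton_space n) (skeleton K n - f) e) = \<dots>" .
  have "?a (attaching_class K n (skeleton_space n) (skeleton K n - f) e) = ?a (cell_class K n f) [^]\<^bsub>?L'\<^esub> incidence K n e f"
    unfolding attaching_class_incidence [OF f] by (rule a.hom_int_pow [OF cc(1)])
  also have "\<dots> = class_power n ?f (orientation_sign n f * incidence K n e f)"
    unfolding hom_induced_cell_class [OF f] by (rule a.H.int_pow_pow [OF cc(2)])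
  finally have "orientation_sign n f * incidence K n e f = incidence K n ?e ?f * orientation_sign (Suc n) e"
    unfolding 1 free_generator_pow_eq_iff [OF group_relative_homology_group gf(2)] by (rule sym)
  then show ?thesis by (simp add: mult.commute)
qed

lemma inverse_automorphism: "cellular_automorphism K \<beta> \<alpha>"
  using combinatorial inverse by unfold_locales

lemma \<beta>_cell: "e \<in> cells K n \<Longrightarrow> \<beta> ` e \<in> cells K n"
  by (rule cellular_automorphism.cell_image(1) [OF inverse_automorphism])

lemma \<alpha>_\<beta>_image: "A \<subseteq> topspace X \<Longrightarrow> \<alpha> ` \<beta> ` A = A"
  by (rule cellular_automorphism.\<beta>_\<alpha>_image [OF inverse_automorphism])

lemma inj_on_cell_image: "inj_on (image \<alpha>) (cells K n)"
  by (rule inj_on_inverseI [of _ "image \<beta>"]) (rule \<beta>_\<alpha>_image [OF cell_subset_X])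

text \<open>The induced map on cellular chains.\<close>

definition push_chain :: "nat \<Rightarrow> ('a set \<Rightarrow>\<^sub>0 int) \<Rightarrow> ('a set \<Rightarrow>\<^sub>0 int)" where
  "push_chain n = signed_relabel (orientation_sign n) (image \<alpha>)"

lemma lookup_push_chain:
  assumes "supp c \<subseteq> cells K n" "e \<in> cells K n"
  shows "coef (push_chain n c) (\<alpha> ` e) = orientation_sign n e * coef c e"
  unfolding push_chain_def by (rule lookup_signed_relabel [OF inj_on_cell_image assms])

lemma keys_push_chain: "supp c \<subseteq> cells K n \<Longrightarrow> supp (push_chain n c) \<subseteq> cells K n"
  using keys_signed_relabel [of "orientation_sign n" "image \<alpha>" c] cell_image(1) unfolding push_chain_def by blast

lemma l1_norm_push_chain: "supp c \<subseteq> cells K n \<Longrightarrow> l1_norm (push_chain n c) = l1_norm c"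
  unfolding push_chain_def
  by (intro l1_norm_signed_relabel inj_on_subset [OF inj_on_cell_image] orientation_sign(1)) auto

lemma push_chain_diff: "push_chain n (a - c) = push_chain n a - push_chain n c"
  by (simp add: push_chain_def signed_relabel_def frag_extend_diff)

lemma chain_eqI_image:
  assumes "supp a \<subseteq> cells K n" "supp c \<subseteq> cells K n"
    and "\<And>e. e \<in> cells K n \<Longrightarrow> coef a (\<alpha> ` e) = coef c (\<alpha> ` e)"
  shows "a = c"
proof (rule poly_mapping_eqI)
  fix f
  show "coef a f = coef c f"
  proof (cases "f \<in> cells K n")
    case True
    have "\<alpha> ` \<beta> ` f = f" by (rule \<alpha>_\<beta>_image [OF cell_subset_X [OF True]])
    then show ?thesis using assms(3) [OF \<beta>_cell [OF True]] by simp
  next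
    case False
    then have "f \<notin> supp a" "f \<notin> supp c" using assms(1,2) by auto
    then show ?thesis by (simp only: not_in_keys_iff_lookup_eq_zero)
  qed
qed

lemma boundary_push_chain:
  assumes "supp c \<subseteq> cells K (Suc n)"
  shows "boundary K (Suc n) (push_chain (Suc n) c) = push_chain n (boundary K (Suc n) c)"
  using assms
proof (induction c rule: frag_induction)
  case zero
  then show ?case by (simp add: push_chain_def signed_relabel_def)
next
  case (one e)
  show ?case
  proof (rule chain_eqI_image [OF keys_boundary keys_push_chain [OF keys_boundary]])
    fix f assume f: "f \<in> cells K n"
    have "push_chain (Suc n) (frag_of e) = frag_cmul (orientation_sign (Suc n) e) (frag_of (\<alpha> ` e))"
      by (simp add: push_chain_def signed_relabel_def)
    then have "boundary K (Suc n) (push_chain (Suc n) (frag_of e))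
       = frag_cmul (orientation_sign (Suc n) e) (boundary K (Suc n) (frag_of (\<alpha> ` e)))"
      by (simp only: boundary.simps frag_extend_cmul)
    then have "coef (boundary K (Suc n) (push_chain (Suc n) (frag_of e))) (\<alpha> ` f)
       = orientation_sign (Suc n) e * incidence K n (\<alpha> ` e) (\<alpha> ` f)"
      using lookup_boundary_frag_of [OF cell_image(1) [OF one], of "\<alpha> ` f"] cell_image(1) [OF f]
      by (simp only: lookup_frag_cmul if_True)
    also have "\<dots> = orientation_sign n f * incidence K n e f" by (rule incidence_image [OF one f])
    also have "\<dots> = coef (push_chain n (boundary K (Suc n) (frag_of e))) (\<alpha> ` f)"
      unfolding lookup_push_chain [OF keys_boundary f] lookup_boundary_frag_of [OF one] using f by (simp only: if_True)
    finally show "coef (boundary K (Suc n) (push_chain (Suc n) (frag_of e))) (\<alpha> ` f)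
       = coef (push_chain n (boundary K (Suc n) (frag_of e))) (\<alpha> ` f)" .
  qed
next
  case (diff a c)
  have "boundary K (Suc n) (x - y) = boundary K (Suc n) x - boundary K (Suc n) y" for x y
    by (simp add: frag_extend_diff)
  then show ?case using diff by (simp only: push_chain_diff)
qed

lemma push_chain_inj:
  assumes "supp a \<subseteq> cells K n" "supp c \<subseteq> cells K n" "push_chain n a = push_chain n c"
  shows "a = c"
proof (rule poly_mapping_eqI)
  fix e
  show "coef a e = coef c e"
  proof (cases "e \<in> cells K n")
    case True
    have "orientation_sign n e * coef a e = orientation_sign n e * coef c e"
      by (rule trans [OF lookup_push_chain [OF assms(1) True, symmetric, unfolded assms(3)]
            lookup_push_chain [OF assms(2) True]])
    then show ?thesis using orientation_sign(1) [OF True] by auto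
  next
    case False
    then have "e \<notin> supp a" "e \<notin> supp c" using assms(1,2) by auto
    then show ?thesis by (simp only: not_in_keys_iff_lookup_eq_zero)
  qed
qed

text \<open>The preimage is built with the signs of \<open>\<alpha>\<close> itself, each of which is its own inverse.\<close>

lemma push_chain_surj:
  assumes \<mu>: "supp \<mu> \<subseteq> cells K n"
  obtains \<nu> where "supp \<nu> \<subseteq> cells K n" "push_chain n \<nu> = \<mu>"
proof -
  let ?\<nu> = "signed_relabel (\<lambda>e. orientation_sign n (\<beta> ` e)) (image \<beta>) \<mu>"
  have k: "supp ?\<nu> \<subseteq> cells K n"
    using keys_signed_relabel [of "\<lambda>e. orientation_sign n (\<beta> ` e)" "image \<beta>" \<mu>] \<mu> \<beta>_cell by blast
  have "push_chain n ?\<nu> = \<mu>"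
  proof (rule chain_eqI_image [OF keys_push_chain [OF k] \<mu>])
    fix e assume e: "e \<in> cells K n"
    have be: "\<beta> ` \<alpha> ` e = e" by (rule \<beta>_\<alpha>_image [OF cell_subset_X [OF e]])
    have "coef ?\<nu> (\<beta> ` \<alpha> ` e) = orientation_sign n (\<beta> ` \<alpha> ` e) * coef \<mu> (\<alpha> ` e)"
      by (rule lookup_signed_relabel [OF cellular_automorphism.inj_on_cell_image [OF inverse_automorphism] \<mu> cell_image(1) [OF e]])
    then have "coef ?\<nu> e = orientation_sign n e * coef \<mu> (\<alpha> ` e)" unfolding be .
    then show "coef (push_chain n ?\<nu>) (\<alpha> ` e) = coef \<mu> (\<alpha> ` e)"
      using lookup_push_chain [OF k e] orientation_sign(1) [OF e] by auto
  qed
  then show ?thesis using that k by blast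
qed

text \<open>It suffices to fill translates of a cycle, and the translated filling has the same norm.\<close>

lemma filling_pullback:
  assumes \<gamma>: "\<gamma> \<in> chains K n" and \<mu>: "\<mu> \<in> chains K (Suc n)" "boundary K (Suc n) \<mu> = push_chain n \<gamma>"
  obtains \<nu> where "\<nu> \<in> chains K (Suc n)" "boundary K (Suc n) \<nu> = \<gamma>" "l1_norm \<nu> = l1_norm \<mu>"
proof -
  have k: "supp \<gamma> \<subseteq> cells K n" "supp \<mu> \<subseteq> cells K (Suc n)"
    using \<gamma> \<mu>(1) by (simp_all add: chains_def)
  obtain \<nu> where \<nu>: "supp \<nu> \<subseteq> cells K (Suc n)" "push_chain (Suc n) \<nu> = \<mu>"
    using push_chain_surj [OF k(2)] .
  have "push_chain n (boundary K (Suc n) \<nu>) = push_chain n \<gamma>"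
    using boundary_push_chain [OF \<nu>(1)] \<nu>(2) \<mu>(2) by simp
  then have "boundary K (Suc n) \<nu> = \<gamma>" by (rule push_chain_inj [OF keys_boundary k(1)])
  moreover have "\<nu> \<in> chains K (Suc n)" using \<nu>(1) by (simp add: chains_def)
  moreover have "l1_norm \<nu> = l1_norm \<mu>" using l1_norm_push_chain [OF \<nu>(1)] \<nu>(2) by simp
  ultimately show ?thesis using that by blast
qed

lemma push_cycle:
  assumes "\<gamma> \<in> cycles K (Suc n)"
  shows "push_chain (Suc n) \<gamma> \<in> cycles K (Suc n)"
proof -
  have k: "supp \<gamma> \<subseteq> cells K (Suc n)" and b: "boundary K (Suc n) \<gamma> = 0"
    using assms by (auto simp: cycles_def chains_def)
  have "boundary K (Suc n) (push_chain (Suc n) \<gamma>) = push_chain n 0"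
    unfolding boundary_push_chain [OF k] b ..
  also have "\<dots> = 0" by (simp add: push_chain_def signed_relabel_def)
  finally show ?thesis
    using keys_push_chain [OF k] by (simp only: cycles_def chains_def mem_Collect_eq carrier_free_Abelian_group_iff simp_thms)
qed

end

section \<open>Norms, restrictions and fillings of chains\<close>

lemma l1_norm_superset:
  assumes "finite S" "supp c \<subseteq> S"
  shows "l1_norm c = (\<Sum>e\<in>S. nat \<bar>coef c e\<bar>)"
  unfolding l1_norm_def
  by (rule sum.mono_neutral_left [OF assms]) (simp add: in_keys_iff)

lemma l1_norm_add_le: "l1_norm (a + b) \<le> l1_norm a + l1_norm b"
proof -
  let ?S = "supp a \<union> supp b"
  have "l1_norm (a + b) = (\<Sum>e\<in>?S. nat \<bar>coef (a + b) e\<bar>)"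
    by (rule l1_norm_superset) (use keys_add [of a b] in auto)
  also have "\<dots> \<le> (\<Sum>e\<in>?S. nat \<bar>coef a e\<bar> + nat \<bar>coef b e\<bar>)"
    by (rule sum_mono) (simp add: lookup_add)
  also have "\<dots> = l1_norm a + l1_norm b"
    by (simp add: sum.distrib l1_norm_superset [of ?S a] l1_norm_superset [of ?S b])
  finally show ?thesis .
qed

lemma lookup_le_l1_norm: "nat \<bar>coef c e\<bar> \<le> l1_norm c"
proof (cases "e \<in> supp c")
  case True
  then show ?thesis unfolding l1_norm_def by (intro member_le_sum) auto
qed (simp add: in_keys_iff)

lemma card_keys_le_l1_norm: "card (supp c) \<le> l1_norm c"
proof -
  have "card (supp c) = (\<Sum>e\<in>supp c. 1)" by simp
  also have "\<dots> \<le> l1_norm c"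
    unfolding l1_norm_def by (rule sum_mono) (simp add: in_keys_iff)
  finally show ?thesis .
qed

lemma finite_bounded_chains:
  assumes "finite B"
  shows "finite {c. supp c \<subseteq> B \<and> l1_norm c \<le> m}" (is "finite ?P")
proof -
  let ?F = "{f. \<forall>x. (x \<in> B \<longrightarrow> f x \<in> {- int m..int m}) \<and> (x \<notin> B \<longrightarrow> f x = 0)}"
  have "coef ` ?P \<subseteq> ?F"
  proof (rule image_subsetI)
    fix c assume c: "c \<in> ?P"
    have "coef c x \<in> {- int m..int m}" for x
      using lookup_le_l1_norm [of c x] c by auto
    moreover have "coef c x = 0" if "x \<notin> B" for x
      using c that by (auto simp: in_keys_iff)
    ultimately show "coef c \<in> ?F" by blast
  qed
  then have "finite (coef ` ?P)"
    using finite_set_of_finite_funs [OF assms, of "{- int m..int m}" 0] finite_subset by blast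
  moreover have "inj_on coef ?P" by (rule inj_onI) (simp add: poly_mapping_eqI)
  ultimately show ?thesis by (rule finite_imageD)
qed

definition restrict_chain :: "'c set \<Rightarrow> ('c \<Rightarrow>\<^sub>0 int) \<Rightarrow> ('c \<Rightarrow>\<^sub>0 int)" where
  "restrict_chain C = frag_extend (\<lambda>e. if e \<in> C then frag_of e else 0)"

lemma lookup_restrict_chain:
  "coef (restrict_chain C c) e = (if e \<in> C then coef c e else 0)"
  using subset_UNIV [of "supp c"]
proof (induction c rule: frag_induction)
  case (diff a c)
  then show ?case by (simp add: restrict_chain_def frag_extend_diff lookup_minus)
qed (auto simp: restrict_chain_def)

lemma keys_restrict_chain: "supp (restrict_chain C c) = supp c \<inter> C"
  by (auto simp: in_keys_iff lookup_restrict_chain split: if_splits)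

lemma l1_norm_restrict_chain: "l1_norm c = l1_norm (restrict_chain C c) + l1_norm (c - restrict_chain C c)"
proof -
  let ?k = "supp c"
  have k: "supp (c - restrict_chain C c) \<subseteq> ?k"
    using keys_diff [of c "restrict_chain C c"] keys_restrict_chain [of C c] by auto
  have "l1_norm (restrict_chain C c) + l1_norm (c - restrict_chain C c)
     = (\<Sum>e\<in>?k. nat \<bar>coef (restrict_chain C c) e\<bar> + nat \<bar>coef (c - restrict_chain C c) e\<bar>)"
    using k keys_restrict_chain [of C c]
    by (simp add: sum.distrib l1_norm_superset [of ?k "restrict_chain C c"] l1_norm_superset [of ?k "c - restrict_chain C c"])
  also have "\<dots> = l1_norm c"
    unfolding l1_norm_def by (rule sum.cong) (auto simp: lookup_restrict_chain lookup_minus)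
  finally show ?thesis by (rule sym)
qed

lemma relpow_subset:
  fixes R S :: "('c \<times> 'c) set"
  shows "R \<subseteq> S \<Longrightarrow> R ^^ k \<subseteq> S ^^ k"
  by (induction k) (simp_all add: relcomp_mono)

definition fillable :: "('a, 'b) cell_complex_scheme \<Rightarrow> nat \<Rightarrow> ('a set \<Rightarrow>\<^sub>0 int) \<Rightarrow> nat \<Rightarrow> bool" where
  "fillable K n \<gamma> M \<longleftrightarrow> (\<exists>\<mu>\<in>chains K (Suc n). boundary K (Suc n) \<mu> = \<gamma> \<and> l1_norm \<mu> \<le> M)"

lemma fillable_mono: "fillable K n \<gamma> M \<Longrightarrow> M \<le> M' \<Longrightarrow> fillable K n \<gamma> M'"
  unfolding fillable_def using order_trans by blast

lemma fillable_add:
  assumes "fillable K n \<gamma> M" "fillable K n \<gamma>' M'"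
  shows "fillable K n (\<gamma> + \<gamma>') (M + M')"
proof -
  obtain \<mu> \<mu>' where \<mu>: "\<mu> \<in> chains K (Suc n)" "boundary K (Suc n) \<mu> = \<gamma>" "l1_norm \<mu> \<le> M"
    and \<mu>': "\<mu>' \<in> chains K (Suc n)" "boundary K (Suc n) \<mu>' = \<gamma>'" "l1_norm \<mu>' \<le> M'"
    using assms unfolding fillable_def by blast
  have "\<mu> + \<mu>' \<in> chains K (Suc n)" using \<mu>(1) \<mu>'(1) keys_add [of \<mu> \<mu>'] by (auto simp: chains_def)
  moreover have "boundary K (Suc n) (\<mu> + \<mu>') = \<gamma> + \<gamma>'" using \<mu>(2) \<mu>'(2) by (simp add: frag_extend_add)
  moreover have "l1_norm (\<mu> + \<mu>') \<le> M + M'" using l1_norm_add_le [of \<mu> \<mu>'] \<mu>(3) \<mu>'(3) by simp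
  ultimately show ?thesis unfolding fillable_def by blast
qed

lemma finite_uniform_fillable:
  assumes "finite P" "\<And>c. c \<in> P \<Longrightarrow> \<exists>M. fillable K n c M"
  shows "\<exists>M. \<forall>c\<in>P. fillable K n c M"
  using assms
proof (induction P)
  case (insert c P)
  obtain M where M: "\<forall>c\<in>P. fillable K n c M" using insert by blast
  obtain M' where M': "fillable K n c M'" using insert by blast
  have "\<forall>c\<in>insert c P. fillable K n c (M + M')"
    using M M' fillable_mono [of K n _ _ "M + M'"] by auto
  then show ?case by blast
qed simp

context cw_complex
begin

section \<open>Connected components of a cycle\<close>

definition adjacent :: "nat \<Rightarrow> ('a set \<times> 'a set) set" where
  "adjacent n = {(e, e'). e \<in> cells K (Suc n) \<and> e' \<in> cells K (Suc n) \<and>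
     (\<exists>f\<in>cells K n. incidence K n e f \<noteq> 0 \<and> incidence K n e' f \<noteq> 0)}"

lemma lookup_boundary:
  assumes c: "supp c \<subseteq> cells K (Suc n)" and f: "f \<in> cells K n"
  shows "coef (boundary K (Suc n) c) f = (\<Sum>e\<in>supp c. coef c e * incidence K n e f)"
proof -
  have "boundary K (Suc n) c
     = (\<Sum>e\<in>supp c. frag_cmul (coef c e) (boundary K (Suc n) (frag_of e)))"
    by (simp only: boundary.simps frag_extend_of) (simp only: frag_extend_def)
  then have "coef (boundary K (Suc n) c) f
     = (\<Sum>e\<in>supp c. coef c e * coef (boundary K (Suc n) (frag_of e)) f)"
    by (simp only: lookup_sum lookup_frag_cmul)
  also have "\<dots> = (\<Sum>e\<in>supp c. coef c e * incidence K n e f)"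
  proof (rule sum.cong [OF refl])
    fix e assume "e \<in> supp c"
    then have e: "e \<in> cells K (Suc n)" using c by blast
    show "coef c e * coef (boundary K (Suc n) (frag_of e)) f = coef c e * incidence K n e f"
      unfolding lookup_boundary_frag_of [OF e] using f by (simp only: if_True)
  qed
  finally show ?thesis .
qed

text \<open>All cells of the support that are incident to a common \<open>n\<close>-cell are pairwise adjacent, so they lie
  in \<open>C\<close> together or not at all; the coefficient of the boundary at that cell is then either the
  one for the whole cycle or an empty sum.\<close>

lemma component_cycle:
  assumes \<gamma>: "\<gamma> \<in> cycles K (Suc n)"
    and R: "R = adjacent n \<inter> (supp \<gamma> \<times> supp \<gamma>)"
    and C: "C = R\<^sup>* `` {x}"
  shows "restrict_chain C \<gamma> \<in> cycles K (Suc n)"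
proof -
  let ?k = "supp \<gamma>"
  have k: "?k \<subseteq> cells K (Suc n)" and b: "boundary K (Suc n) \<gamma> = 0"
    using \<gamma> by (auto simp: cycles_def chains_def)
  have kr: "supp (restrict_chain C \<gamma>) \<subseteq> cells K (Suc n)" using k keys_restrict_chain [of C \<gamma>] by auto
  have "coef (boundary K (Suc n) (restrict_chain C \<gamma>)) f = 0" for f
  proof (cases "f \<in> cells K n")
    case False
    then have "f \<notin> supp (boundary K (Suc n) (restrict_chain C \<gamma>))" using keys_boundary by blast
    then show ?thesis by (simp only: not_in_keys_iff_lookup_eq_zero)
  next
    case f: True
    have eq: "coef (boundary K (Suc n) (restrict_chain C \<gamma>)) f
       = (\<Sum>e\<in>?k \<inter> C. coef \<gamma> e * incidence K n e f)"
      unfolding lookup_boundary [OF kr f] keys_restrict_chain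
      by (rule sum.cong) (simp_all add: lookup_restrict_chain)
    show ?thesis
    proof (cases "\<exists>e\<in>?k \<inter> C. incidence K n e f \<noteq> 0")
      case False
      then show ?thesis unfolding eq by (intro sum.neutral) simp
    next
      case True
      then obtain e where e: "e \<in> ?k" "e \<in> C" "incidence K n e f \<noteq> 0" by blast
      have "incidence K n e' f = 0" if e': "e' \<in> ?k - ?k \<inter> C" for e'
      proof (rule ccontr)
        assume "incidence K n e' f \<noteq> 0"
        then have "(e, e') \<in> R" using e e' k f by (auto simp: R adjacent_def)
        moreover have "(x, e) \<in> R\<^sup>*" using e(2) by (simp add: C)
        ultimately have "(x, e') \<in> R\<^sup>*" by (rule rtrancl_into_rtrancl [rotated])
        then show False using e' by (simp add: C)
      qed
      then have "(\<Sum>e\<in>?k \<inter> C. coef \<gamma> e * incidence K n e f) = (\<Sum>e\<in>?k. coef \<gamma> e * incidence K n e f)"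
        by (intro sum.mono_neutral_left) auto
      also have "\<dots> = 0" using lookup_boundary [OF k f] b by simp
      finally show ?thesis unfolding eq .
    qed
  qed
  then have "boundary K (Suc n) (restrict_chain C \<gamma>) = 0" by (intro poly_mapping_eqI) (simp only: lookup_zero)
  then show ?thesis using kr by (simp only: cycles_def chains_def mem_Collect_eq carrier_free_Abelian_group_iff simp_thms)
qed

lemma compactin_finite_family:
  assumes F: "finite F" "closed_family F"
  shows "compactin X (\<Union>F)"
proof -
  define dm where "dm = (\<lambda>e. SOME n. e \<in> cells K n)"
  have dm: "e \<in> cells K (dm e)" if "e \<in> F" for e
  proof -
    have "\<exists>n. e \<in> cells K n" using that closed_family_subset [OF F(2)] by (auto simp: all_cells_def)
    then show ?thesis unfolding dm_def by (rule someI_ex)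
  qed
  have "compactin X (charmap K e ` topspace (disc (dm e)))" if e: "e \<in> F" for e
    using image_compactin [OF _ charmap_continuous [OF dm [OF e]]] compact_disc by (simp add: compact_space_def)
  then have "compactin X (\<Union>e\<in>F. charmap K e ` topspace (disc (dm e)))"
    using F(1) by (intro compactin_Union) auto
  moreover have "(\<Union>e\<in>F. charmap K e ` topspace (disc (dm e))) = \<Union>F"
  proof (rule equalityI)
    show "(\<Union>e\<in>F. charmap K e ` topspace (disc (dm e))) \<subseteq> \<Union>F"
      using closed_family_disc [OF F(2) _ dm] by (intro UN_least) auto
    have "e \<subseteq> charmap K e ` topspace (disc (dm e))" if "e \<in> F" for e
      using charmap_disc [OF dm [OF that]] by simp
    then show "\<Union>F \<subseteq> (\<Union>e\<in>F. charmap K e ` topspace (disc (dm e)))" by fast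
  qed
  ultimately show ?thesis by simp
qed

lemma subcomplex_closed_family:
  assumes "closed_family F" shows "subcomplex K (\<Union>F)"
  unfolding subcomplex_def
proof (intro conjI allI ballI impI)
  show "closedin X (\<Union>F)" by (rule closedin_Union_closed_family [OF assms])
  fix n e assume "e \<in> cells K n" "e \<inter> \<Union>F \<noteq> {}"
  then show "e \<subseteq> \<Union>F" using mem_family [OF closed_family_subset [OF assms] cells_all_cells] by blast
qed

end

section \<open>Proper cocompact actions\<close>

locale geometric_action = cw_complex K for K :: "('a, 'b) cell_complex_scheme" +
  fixes G :: "('g, 'm) monoid_scheme" and \<phi> :: "'g \<Rightarrow> 'a \<Rightarrow> 'a"
  assumes group: "group G" and cellular: "cellular_action G K \<phi>"
    and proper: "proper_action G K \<phi>" and cocompact: "cocompact_action G K \<phi>"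
begin

sublocale act: group_action G "topspace X" \<phi>
  using cellular by (simp add: cellular_action_def)

sublocale group G by (rule group)

lemma automorphism:
  assumes g: "g \<in> carrier G"
  shows "cellular_automorphism K (\<phi> g) (\<phi> (inv\<^bsub>G\<^esub> g))"
proof unfold_locales
  have ig: "inv\<^bsub>G\<^esub> g \<in> carrier G" using g by (rule inv_closed)
  show "combinatorial_map K K (\<phi> g)" using cellular g by (simp add: cellular_action_def)
  show "combinatorial_map K K (\<phi> (inv\<^bsub>G\<^esub> g))" using cellular ig by (simp add: cellular_action_def)
  show "\<phi> (inv\<^bsub>G\<^esub> g) (\<phi> g x) = x" if "x \<in> topspace X" for x
    by (rule act.orbit_sym_aux [OF g that refl])
  show "\<phi> g (\<phi> (inv\<^bsub>G\<^esub> g) x) = x" if "x \<in> topspace X" for x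
    using act.orbit_sym_aux [OF ig that refl] g by simp
qed

lemma cell_translate: "g \<in> carrier G \<Longrightarrow> e \<in> cells K n \<Longrightarrow> \<phi> g ` e \<in> cells K n"
  by (rule cellular_automorphism.cell_image(1) [OF automorphism])

lemma translate_inv: "g \<in> carrier G \<Longrightarrow> A \<subseteq> topspace X \<Longrightarrow> \<phi> (inv\<^bsub>G\<^esub> g) ` \<phi> g ` A = A"
  by (rule cellular_automorphism.\<beta>_\<alpha>_image [OF automorphism])

lemma incidence_translate:
  assumes g: "g \<in> carrier G" and e: "e \<in> cells K (Suc n)" and f: "f \<in> cells K n"
  shows "incidence K n (\<phi> g ` e) (\<phi> g ` f) \<noteq> 0 \<longleftrightarrow> incidence K n e f \<noteq> 0"
proof -
  interpret a: cellular_automorphism K "\<phi> g" "\<phi> (inv\<^bsub>G\<^esub> g)" by (rule automorphism [OF g])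
  show ?thesis
    using a.incidence_image [OF e f] a.orientation_sign(1) [OF e] a.orientation_sign(1) [OF f] by auto
qed

lemma finitely_many_orbits_of_cells:
  obtains E where "finite E" "E \<subseteq> cells K n" "\<And>e. e \<in> cells K n \<Longrightarrow> \<exists>g\<in>carrier G. \<phi> g ` e \<in> E"
proof -
  obtain A where A: "compactin X A" "(\<Union>g\<in>carrier G. \<phi> g ` A) = topspace X"
    using cocompact unfolding cocompact_action_def by blast
  have AX: "A \<subseteq> topspace X" by (rule compactin_subset_topspace [OF A(1)])
  let ?E = "{e \<in> cells K n. e \<inter> A \<noteq> {}}"
  show ?thesis
  proof (rule that)
    show "finite ?E"
      by (rule finite_subset [OF _ finite_meeting [OF A(1)]]) (auto intro: cells_all_cells)
    show "?E \<subseteq> cells K n" by blast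
    fix e assume e: "e \<in> cells K n"
    obtain x where x: "x \<in> e" using cell_not_empty [OF e] by blast
    then have "x \<in> topspace X" using cell_subset_X [OF e] by blast
    then obtain g a where g: "g \<in> carrier G" "a \<in> A" "x = \<phi> g a" using A(2) by blast
    have "a \<in> topspace X" using g(2) AX by blast
    then have "\<phi> (inv\<^bsub>G\<^esub> g) x = a" using act.orbit_sym_aux [OF g(1)] g(3) by simp
    then have "a \<in> \<phi> (inv\<^bsub>G\<^esub> g) ` e" using x by blast
    then have "\<phi> (inv\<^bsub>G\<^esub> g) ` e \<in> ?E"
      using cell_translate [OF inv_closed [OF g(1)] e] g(2) by blast
    then show "\<exists>g\<in>carrier G. \<phi> g ` e \<in> ?E" using inv_closed [OF g(1)] by blast
  qed
qed

text \<open>Translate a coface of \<open>f\<close> into the finite set \<open>E\<close> of orbit representatives. Then \<open>f\<close> is carried into the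
  finite set \<open>F0\<close> of faces of cells of \<open>E\<close>, hence into a fixed compact subcomplex \<open>L\<close>. By properness only
  finitely many group elements carry \<open>f\<close> into \<open>L\<close>.\<close>

lemma finite_incident_cofaces:
  assumes f: "f \<in> cells K n"
  shows "finite {e \<in> cells K (Suc n). incidence K n e f \<noteq> 0}"
proof -
  obtain E where E: "finite E" "E \<subseteq> cells K (Suc n)"
    "\<And>e. e \<in> cells K (Suc n) \<Longrightarrow> \<exists>g\<in>carrier G. \<phi> g ` e \<in> E"
    using finitely_many_orbits_of_cells [of "Suc n"] by blast
  define F0 where "F0 = (\<Union>e\<in>E. {f. f \<in> cells K n \<and> incidence K n e f \<noteq> 0})"
  have F0: "finite F0" "F0 \<subseteq> all_cells K"
    unfolding F0_def using E(1,2) finite_incident_faces by (auto intro: cells_all_cells)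
  obtain F where F: "finite F" "closed_family F" "F0 \<subseteq> F" by (rule finite_closed_hull [OF F0])
  let ?L = "\<Union>F"
  have LX: "?L \<subseteq> topspace X" by (rule compactin_subset_topspace [OF compactin_finite_family [OF F(1,2)]])
  have finL: "finite {g \<in> carrier G. ?L \<inter> \<phi> g ` ?L \<noteq> {}}"
    using proper subcomplex_closed_family [OF F(2)] compactin_finite_family [OF F(1,2)]
    unfolding proper_action_def by blast
  let ?Gs = "{g \<in> carrier G. \<phi> g ` f \<subseteq> ?L}"
  have "finite ?Gs"
  proof (cases "?Gs = {}")
    case False
    then obtain g1 where g1: "g1 \<in> carrier G" "\<phi> g1 ` f \<subseteq> ?L" by blast
    obtain x where x: "x \<in> f" using cell_not_empty [OF f] by blast
    have xX: "x \<in> topspace X" using x cell_subset_X [OF f] by blast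
    \<comment> \<open>If \<open>g\<close> and \<open>g1\<close> both carry \<open>f\<close> into \<open>L\<close>, the element \<open>g g1\<^sup>-\<^sup>1\<close> moves a point of \<open>L\<close> into \<open>L\<close>.\<close>
    have "(\<lambda>g. g \<otimes>\<^bsub>G\<^esub> inv\<^bsub>G\<^esub> g1) ` ?Gs \<subseteq> {g \<in> carrier G. ?L \<inter> \<phi> g ` ?L \<noteq> {}}"
    proof (rule image_subsetI)
      fix g assume g: "g \<in> ?Gs"
      have y: "\<phi> g1 x \<in> ?L" "\<phi> g x \<in> ?L" using g g1 x by blast+
      have "\<phi> (g \<otimes>\<^bsub>G\<^esub> inv\<^bsub>G\<^esub> g1) (\<phi> g1 x) = \<phi> g (\<phi> (inv\<^bsub>G\<^esub> g1) (\<phi> g1 x))"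
        using act.composition_rule [of "\<phi> g1 x" g "inv\<^bsub>G\<^esub> g1"] y(1) LX g g1 by blast
      also have "\<dots> = \<phi> g x" using act.orbit_sym_aux [OF g1(1) xX refl] by simp
      finally have "\<phi> g x \<in> ?L \<inter> \<phi> (g \<otimes>\<^bsub>G\<^esub> inv\<^bsub>G\<^esub> g1) ` ?L"
        using y by (intro IntI rev_image_eqI [of "\<phi> g1 x"]) simp_all
      then have "?L \<inter> \<phi> (g \<otimes>\<^bsub>G\<^esub> inv\<^bsub>G\<^esub> g1) ` ?L \<noteq> {}" by blast
      moreover have "g \<otimes>\<^bsub>G\<^esub> inv\<^bsub>G\<^esub> g1 \<in> carrier G" using g g1(1) by simp
      ultimately show "g \<otimes>\<^bsub>G\<^esub> inv\<^bsub>G\<^esub> g1 \<in> {g \<in> carrier G. ?L \<inter> \<phi> g ` ?L \<noteq> {}}" by blast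
    qed
    then have "finite ((\<lambda>g. g \<otimes>\<^bsub>G\<^esub> inv\<^bsub>G\<^esub> g1) ` ?Gs)" using finL by (rule finite_subset)
    moreover have "inj_on (\<lambda>g. g \<otimes>\<^bsub>G\<^esub> inv\<^bsub>G\<^esub> g1) ?Gs" using g1(1) by (intro inj_onI) simp
    ultimately show ?thesis by (rule finite_imageD)
  next
    case True
    then show ?thesis by (simp only: finite.emptyI)
  qed
  have "{e \<in> cells K (Suc n). incidence K n e f \<noteq> 0} \<subseteq> (\<lambda>(g, e). \<phi> (inv\<^bsub>G\<^esub> g) ` e) ` (?Gs \<times> E)"
  proof
    fix e assume "e \<in> {e \<in> cells K (Suc n). incidence K n e f \<noteq> 0}"
    then have e: "e \<in> cells K (Suc n)" "incidence K n e f \<noteq> 0" by auto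
    obtain g where g: "g \<in> carrier G" "\<phi> g ` e \<in> E" using E(3) [OF e(1)] by blast
    have "incidence K n (\<phi> g ` e) (\<phi> g ` f) \<noteq> 0" using incidence_translate [OF g(1) e(1) f] e(2) by simp
    then have "\<phi> g ` f \<in> F0" using g(2) cell_translate [OF g(1) f] unfolding F0_def by blast
    then have "g \<in> ?Gs" using F(3) g(1) by blast
    moreover have "e = \<phi> (inv\<^bsub>G\<^esub> g) ` \<phi> g ` e" using translate_inv [OF g(1) cell_subset_X [OF e(1)]] by simp
    ultimately show "e \<in> (\<lambda>(g, e). \<phi> (inv\<^bsub>G\<^esub> g) ` e) ` (?Gs \<times> E)" using g(2) by (intro rev_image_eqI [of "(g, \<phi> g ` e)"]) auto
  qed
  then show ?thesis by (rule finite_subset) (use \<open>finite ?Gs\<close> E(1) in blast)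
qed

lemma finite_adjacent: "finite (adjacent n `` {e})"
proof (cases "e \<in> cells K (Suc n)")
  case True
  have "adjacent n `` {e} \<subseteq> (\<Union>f\<in>{f. f \<in> cells K n \<and> incidence K n e f \<noteq> 0}. {e' \<in> cells K (Suc n). incidence K n e' f \<noteq> 0})"
    by (auto simp: adjacent_def)
  moreover have "finite (\<Union>f\<in>{f. f \<in> cells K n \<and> incidence K n e f \<noteq> 0}. {e' \<in> cells K (Suc n). incidence K n e' f \<noteq> 0})"
    using finite_incident_faces [OF True] finite_incident_cofaces by blast
  ultimately show ?thesis by (rule finite_subset)
next
  case False
  then have "adjacent n `` {e} = {}" by (auto simp: adjacent_def)
  then show ?thesis by simp
qed

lemma finite_adjacent_power: "finite ((adjacent n ^^ k) `` {e})"
proof (induction k)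
  case (Suc k)
  have "(adjacent n ^^ Suc k) `` {e} = (\<Union>e'\<in>(adjacent n ^^ k) `` {e}. adjacent n `` {e'})" by auto
  then show ?case using Suc finite_adjacent by simp
qed auto

lemma adjacent_translate:
  assumes g: "g \<in> carrier G" and a: "(e, e') \<in> adjacent n"
  shows "(\<phi> g ` e, \<phi> g ` e') \<in> adjacent n"
proof -
  obtain f where f: "e \<in> cells K (Suc n)" "e' \<in> cells K (Suc n)" "f \<in> cells K n"
      "incidence K n e f \<noteq> 0" "incidence K n e' f \<noteq> 0"
    using a by (auto simp: adjacent_def)
  then show ?thesis
    using incidence_translate [OF g _ f(3)] cell_translate [OF g] unfolding adjacent_def by blast
qed

lemma adjacent_power_translate:
  assumes g: "g \<in> carrier G"
  shows "(e, e') \<in> adjacent n ^^ k \<Longrightarrow> (\<phi> g ` e, \<phi> g ` e') \<in> adjacent n ^^ k"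
proof (induction k arbitrary: e')
  case (Suc k)
  then obtain e1 where "(e, e1) \<in> adjacent n ^^ k" "(e1, e') \<in> adjacent n" by auto
  then show ?case using relcompI [OF Suc.IH adjacent_translate [OF g]] by simp
qed simp

section \<open>Uniform filling of cycles of bounded norm\<close>

text \<open>The constant \<open>M\<close> bounds fillings of the finitely many cycles of norm at most \<open>m\<close> supported in the
  finite set \<open>B\<close>. For a general cycle split off one component, translate it into \<open>B\<close>, fill it at
  cost \<open>M\<close> and proceed with the remainder, whose norm is smaller by at least one.\<close>

theorem linear_filling_bound:
  assumes fill: "\<And>\<gamma>. \<gamma> \<in> cycles K (Suc n) \<Longrightarrow> \<exists>\<mu>\<in>chains K (Suc (Suc n)). boundary K (Suc (Suc n)) \<mu> = \<gamma>"
  shows "\<exists>M. \<forall>\<gamma>\<in>cycles K (Suc n). l1_norm \<gamma> \<le> m \<longrightarrow> fillable K (Suc n) \<gamma> (M * l1_norm \<gamma>)"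
proof -
  obtain E where E: "finite E" "E \<subseteq> cells K (Suc n)"
    "\<And>e. e \<in> cells K (Suc n) \<Longrightarrow> \<exists>g\<in>carrier G. \<phi> g ` e \<in> E"
    using finitely_many_orbits_of_cells [of "Suc n"] by blast
  \<comment> \<open>The radius \<open>m * m\<close> bounds the number of ordered pairs of cells in a support of at most \<open>m\<close> cells,
    and hence the length of a shortest adjacency path in it.\<close>
  define B where "B = (\<Union>e\<in>E. \<Union>k\<in>{..m * m}. (adjacent n ^^ k) `` {e})"
  have finB: "finite B" unfolding B_def using E(1) finite_adjacent_power by blast
  let ?P = "{c. supp c \<subseteq> B \<and> l1_norm c \<le> m} \<inter> cycles K (Suc n)"
  have finP: "finite ?P" using finite_bounded_chains [OF finB, of m] by blast
  have "\<exists>M. fillable K (Suc n) c M" if "c \<in> ?P" for c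
  proof -
    have "c \<in> cycles K (Suc n)" using that by (rule IntD2)
    from fill [OF this] obtain \<mu> where "\<mu> \<in> chains K (Suc (Suc n))" "boundary K (Suc (Suc n)) \<mu> = c" by (rule bexE)
    then have "fillable K (Suc n) c (l1_norm \<mu>)" unfolding fillable_def by (intro bexI [of _ \<mu>] conjI order_refl)
    then show ?thesis by (rule exI)
  qed
  then obtain M where M: "\<And>c. c \<in> ?P \<Longrightarrow> fillable K (Suc n) c M"
    using finite_uniform_fillable [OF finP, of K "Suc n"] by meson
  have "fillable K (Suc n) \<gamma> (M * l1_norm \<gamma>)" if "\<gamma> \<in> cycles K (Suc n)" "l1_norm \<gamma> \<le> m" for \<gamma>
    using that
  proof (induction "l1_norm \<gamma>" arbitrary: \<gamma> rule: less_induct)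
    case less
    let ?k = "supp \<gamma>"
    have k: "?k \<subseteq> cells K (Suc n)" using less.prems(1) by (auto simp: cycles_def chains_def)
    show ?case
    proof (cases "?k = {}")
      case True
      then have "\<gamma> = 0" by simp
      moreover have "fillable K (Suc n) 0 0"
        unfolding fillable_def by (intro bexI [of _ 0]) (simp_all add: chains_def l1_norm_def)
      ultimately show ?thesis using fillable_mono by blast
    next
      case False
      then obtain x where x: "x \<in> ?k" by blast
      define R where "R = adjacent n \<inter> (?k \<times> ?k)"
      define C where "C = R\<^sup>* `` {x}"
      define \<gamma>1 where "\<gamma>1 = restrict_chain C \<gamma>"
      have cyc1: "\<gamma>1 \<in> cycles K (Suc n)"
        unfolding \<gamma>1_def by (rule component_cycle [OF less.prems(1) R_def C_def])
      have split: "l1_norm \<gamma> = l1_norm \<gamma>1 + l1_norm (\<gamma> - \<gamma>1)"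
        unfolding \<gamma>1_def by (rule l1_norm_restrict_chain)
      have keys1: "supp \<gamma>1 = ?k \<inter> C" unfolding \<gamma>1_def by (rule keys_restrict_chain)
      have "x \<in> supp \<gamma>1" using x by (simp add: keys1 C_def)
      then have pos: "1 \<le> l1_norm \<gamma>1"
        using lookup_le_l1_norm [of \<gamma>1 x] by (simp add: in_keys_iff)
      have cyc2: "\<gamma> - \<gamma>1 \<in> cycles K (Suc n)"
        using less.prems(1) cyc1 keys_diff [of \<gamma> \<gamma>1] by (auto simp: cycles_def chains_def frag_extend_diff)
      have fill2: "fillable K (Suc n) (\<gamma> - \<gamma>1) (M * l1_norm (\<gamma> - \<gamma>1))"
        using less.hyps [OF _ cyc2] split pos less.prems(2) by simp
      obtain g where g: "g \<in> carrier G" "\<phi> g ` x \<in> E" using E(3) x k by blast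
      interpret a: cellular_automorphism K "\<phi> g" "\<phi> (inv\<^bsub>G\<^esub> g)" by (rule automorphism [OF g(1)])
      have k1: "supp \<gamma>1 \<subseteq> cells K (Suc n)" using keys1 k by blast
      have finR: "finite R" unfolding R_def by simp
      have "card R \<le> card (?k \<times> ?k)" unfolding R_def by (rule card_mono) auto
      also have "\<dots> \<le> m * m"
        using card_keys_le_l1_norm [of \<gamma>] less.prems(2) by (simp add: card_cartesian_product mult_mono)
      finally have cardR: "card R \<le> m * m" .
      have "supp (a.push_chain (Suc n) \<gamma>1) \<subseteq> B"
      proof
        fix y assume "y \<in> supp (a.push_chain (Suc n) \<gamma>1)"
        then obtain e where e: "e \<in> C" "y = \<phi> g ` e"
          using keys_signed_relabel [of "a.orientation_sign (Suc n)" "image (\<phi> g)" \<gamma>1] keys1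
          unfolding a.push_chain_def by blast
        then have "(x, e) \<in> R\<^sup>*" by (simp add: C_def)
        then obtain i where i: "i \<le> card R" "(x, e) \<in> R ^^ i"
          unfolding rtrancl_finite_eq_relpow [OF finR] by blast
        have "R \<subseteq> adjacent n" unfolding R_def by blast
        then have "(x, e) \<in> adjacent n ^^ i" using i(2) relpow_subset by blast
        then have "(\<phi> g ` x, y) \<in> adjacent n ^^ i" unfolding e(2) by (rule adjacent_power_translate [OF g(1)])
        moreover have "i \<in> {..m * m}" using i(1) cardR by simp
        ultimately show "y \<in> B" unfolding B_def using g(2) by blast
      qed
      moreover have "l1_norm (a.push_chain (Suc n) \<gamma>1) \<le> m"
        using a.l1_norm_push_chain [OF k1] split less.prems(2) by simp
      ultimately have "fillable K (Suc n) (a.push_chain (Suc n) \<gamma>1) M"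
        using M a.push_cycle [OF cyc1] by blast
      then obtain \<mu> where \<mu>: "\<mu> \<in> chains K (Suc (Suc n))"
          "boundary K (Suc (Suc n)) \<mu> = a.push_chain (Suc n) \<gamma>1" "l1_norm \<mu> \<le> M"
        unfolding fillable_def by blast
      have "\<gamma>1 \<in> chains K (Suc n)" using k1 by (simp add: chains_def)
      then obtain \<nu> where "\<nu> \<in> chains K (Suc (Suc n))" "boundary K (Suc (Suc n)) \<nu> = \<gamma>1" "l1_norm \<nu> = l1_norm \<mu>"
        using a.filling_pullback [OF _ \<mu>(1,2)] by blast
      then have fill1: "fillable K (Suc n) \<gamma>1 M" using \<mu>(3) unfolding fillable_def by auto
      have "fillable K (Suc n) (\<gamma>1 + (\<gamma> - \<gamma>1)) (M + M * l1_norm (\<gamma> - \<gamma>1))"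
        by (rule fillable_add [OF fill1 fill2])
      moreover have "M + M * l1_norm (\<gamma> - \<gamma>1) \<le> M * l1_norm \<gamma>"
      proof -
        have "M * (1 + l1_norm (\<gamma> - \<gamma>1)) \<le> M * l1_norm \<gamma>" using split pos by (intro mult_left_mono) auto
        then show ?thesis by simp
      qed
      ultimately show ?thesis using fillable_mono by simp
    qed
  qed
  then show ?thesis by blast
qed

end

lemma FV_finite_if_uniformly_fillable:
  assumes "\<And>\<gamma>. \<gamma> \<in> cycles K n \<Longrightarrow> l1_norm \<gamma> \<le> m \<Longrightarrow> fillable K n \<gamma> N"
  shows "FV K (Suc n) m \<noteq> \<infinity>"
proof -
  have "FV K (Suc n) m \<le> enat N"
    unfolding FV_def
  proof (rule SUP_least)
    fix \<gamma> assume "\<gamma> \<in> {\<gamma> \<in> cycles K (Suc n - 1). l1_norm \<gamma> \<le> m}"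
    then have "fillable K n \<gamma> N" using assms by simp
    then obtain \<mu> where "\<mu> \<in> {\<mu> \<in> chains K (Suc n). boundary K (Suc n) \<mu> = \<gamma>}" "l1_norm \<mu> \<le> N"
      unfolding fillable_def by blast
    then show "filling_norm K (Suc n) \<gamma> \<le> enat N"
      unfolding filling_norm_def by (intro INF_lower2 [of \<mu>]) simp_all
  qed
  then show ?thesis using infinity_ileE by metis
qed

theorem theorem1p1:
  fixes G :: "('g, 'm) monoid_scheme" and X :: "'a cell_complex"
    and \<phi> :: "'g \<Rightarrow> 'a \<Rightarrow> 'a" and d :: nat
  assumes "d \<ge> 1"
    and "combinatorial_complex X"
    and "acyclic_complex d X"
    and "group G"
    and "cellular_action G X \<phi>"
    and "proper_action G X \<phi>"
    and "cocompact_action G X \<phi>"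
  shows "\<forall>m::nat. FV X (d + 1) m \<noteq> \<infinity>"
proof
  fix m :: nat
  interpret geometric_action X G \<phi>
    using combinatorial_complex_closure_finite [OF assms(2)] assms(4-7)
    by (simp add: geometric_action_def cw_complex_def geometric_action_axioms_def)
  obtain n where d: "d = Suc n" using assms(1) by (cases d) auto
  have "trivial_group (reduced_homology_group (int d) (carrier_top X))"
    using assms(3) by (simp add: acyclic_complex_def)
  moreover have "int d \<noteq> 0" using assms(1) by simp
  ultimately have acyclic: "trivial_group (homology_group (int (Suc n)) (carrier_top X))"
    using un_reduced_homology_group [of "int d" "carrier_top X"] d by simp
  obtain M where M: "\<And>\<gamma>. \<gamma> \<in> cycles X (Suc n) \<Longrightarrow> l1_norm \<gamma> \<le> m \<Longrightarrow> fillable X (Suc n) \<gamma> (M * l1_norm \<gamma>)"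
    using linear_filling_bound [OF cellular_cycle_is_boundary [OF acyclic], of m] by blast
  have "fillable X (Suc n) \<gamma> (M * m)" if "\<gamma> \<in> cycles X (Suc n)" "l1_norm \<gamma> \<le> m" for \<gamma>
    using M [OF that] fillable_mono that(2) mult_le_mono2 by blast
  then show "FV X (d + 1) m \<noteq> \<infinity>"
    using FV_finite_if_uniformly_fillable [of X "Suc n" m "M * m"] d by simp
qed

end
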